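(* Let $D=\{\alpha_{1,4},\alpha_{2,5},\alpha_{3,9},\alpha_{4,10},\alpha_{5,6},\alpha_{6,7},\alpha_{7,8},\alpha_{8,11},\alpha_{9,12}\}$, a basic set for $U=U_{13}(q)$, let $\phi\in E(D)$, and let $R=R_D/(K_D\cap R_D)$, $V=(V_D\cap R_D)/(K_D\cap R_D)$, and $\mu=\lambda_D|_{V_D\cap R_D}$, regarded as a linear character of $V$. Then the induced character $\mu^R$ decomposes into - $q^3(2q-1)$ irreducible characters of degree $q^3$, each with multiplicity $q^3$; - $q(q-1)(3q^3+q^2+q-1)$ irreducible characters of degree $q^4$, each with multiplicity $q^4$; - $q^2(q+2)(q-1)^2$ irreducible characters of degree $q^5$, each with multiplicity $q^5$.
   Context: Let $q$ be a power of a prime, $\mathbb{F}_q$ the field with $q$ elements, and $U=U_{13}(q)$ the group of upper triangular $13\times13$ matrices over $\mathbb{F}_q$ with all diagonal entries $1$. Characters are complex characters; $\xi^G$ denotes induction to $G$ and $\chi|_H$ restriction to $H$. Let $\alpha_1,\dots,\alpha_{12}$ be the simple roots of type $A_{12}$, $\alpha_{i,j}=\alpha_i+\dots+\alpha_j$ for $1\le i\le j\le 12$ (so $\alpha_{i,i}=\alpha_i$), and $\Sigma^+=\{\alpha_{i,j}\}$. The root $\alpha_{i,j}$ lies on row $i$ and column $j+1$, and its root subgroup is $X_{\alpha_{i,j}}=\{x_{\alpha_{i,j}}(c)=I_{13}+c\,e_{i,j+1}:c\in\mathbb{F}_q\}$, where $e_{i,j+1}$ is the matrix unit. Fix a nontrivial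 linear character $\varphi:\mathbb{F}_q\to\mathbb{C}^\times$. Put $arm(\alpha_{i,j})=\{\alpha_{i,k}:i\le k<j\}$ and $V_\alpha=\langle X_\beta:\beta\in\Sigma^+\setminus arm(\alpha)\rangle$. For $s\in\mathbb{F}_q^\times$ let $\lambda_{\alpha,s}$ be the linear character of $V_\alpha$ with $\lambda_{\alpha,s}(x_\alpha(d))=\varphi(ds)$ for $d\in\mathbb{F}_q$, and trivial on all other $X_\beta\subset V_\alpha$, $\beta\neq\alpha$. A basic set is a nonempty subset of $\Sigma^+$ in which no two distinct roots are on the same row or column. For a basic set $D$, an element $\phi\in E(D)$ is a choice, for every $\alpha\in D$, of one $\lambda_{\alpha,s}$ with $s=s_\alpha\in\mathbb{F}_q^\times$. Put $V_D=\bigcap_{\alpha\in D}V_\alpha=\langle X_\beta:\beta\in\Sigma^+\setminus\bigcup_{\alpha\in D}arm(\alpha)\rangle$, $\lambda_D=\bigotimes_{\lambda_{\alpha,s}\in\phi}\lambda_{\alpha,s}|_{V_D}$ (a linear character of $V_D$), and $K_D=\langle X_\alpha:X_\alpha\subset V_D,\ \alpha\notin D\rangle$. Order $D=\{\tau_1,\dots,\tau_k\}$ by increasing column. For $i<j$ such that $\tau_i$ lies on row $m$, $\tau_j$ on row $l$ and $m<l$, let $\gamma_{i,j}=\alpha_{m,l-1}$ (the root on the row of $\tau_i$ with $\gamma_{i,j}+\tau_j\in\Sigma^+$). Let $\Gamma_D$ be the set of all these $\gamma_{i,j}$ and $R_D=\langle X_\gamma:\gamma\in\Gamma_D\rangle$.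 For the set $D$ in the claim, $\Gamma_D$ consists of the roots $\alpha_{1,j}$ $(1\le j\le8)$, $\alpha_{2,j}$ $(2\le j\le8)$, $\alpha_3,\alpha_{3,7},\alpha_{3,8}$, $\alpha_{4,7},\alpha_{4,8}$, $\alpha_{5,j}$ $(5\le j\le8)$, $\alpha_{6,j}$ $(6\le j\le 8)$, $\alpha_7,\alpha_{7,8}$, $\alpha_8$; the group $V_D\cap R_D$ is generated by the root subgroups of $\alpha_{1,4},\alpha_{2,5},\alpha_{5,6},\alpha_{6,7},\alpha_{7,8}$ (the elements of $D\cap\Gamma_D$) together with those of $\alpha_{1,5},\alpha_{1,6},\alpha_{1,7},\alpha_{1,8},\alpha_{2,6},\alpha_{2,7},\alpha_{2,8},\alpha_{5,7},\alpha_{5,8},\alpha_{6,8}$, and the latter ten generate $K_D\cap R_D$. The group $K_D\cap R_D$ is normal in $R_D$ and contained in $\ker\lambda_D$. *)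

theory Defs
  imports
    "HOL-Algebra.Coset"
    "HOL-Algebra.Generated_Groups"
    "Jordan_Normal_Form.VS_Connect"
begin

section \<open>Complex characters of finite groups\<close>

text \<open>
  A (complex) representation of degree \<open>d\<close> is a homomorphism into the unit group of the
  matrix ring, i.e. into \<open>GL\<close> of dimension \<open>d\<close>. Class functions on \<open>G\<close> are normalised to be
  \<open>undefined\<close> outside \<open>carrier G\<close>, so that sets of characters can be counted.
\<close>

definition representation ::
    "('g, 'b) monoid_scheme \<Rightarrow> nat \<Rightarrow> ('g \<Rightarrow> complex mat) \<Rightarrow> bool" where
  "representation G d \<rho> \<longleftrightarrow> \<rho> \<in> hom G (units_of (ring_mat TYPE(complex) d ()))"

definition irreducible_representation ::
    "('g, 'b) monoid_scheme \<Rightarrow> nat \<Rightarrow> ('g \<Rightarrow> complex mat) \<Rightarrow> bool" where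
  "irreducible_representation G d \<rho> \<longleftrightarrow>
     representation G d \<rho> \<and> d > 0 \<and>
     (\<forall>W. subspace class_ring W (module_vec TYPE(complex) d) \<and>
          (\<forall>g\<in>carrier G. \<forall>w\<in>W. \<rho> g *\<^sub>v w \<in> W)
        \<longrightarrow> W = {0\<^sub>v d} \<or> W = carrier_vec d)"

definition mat_trace :: "'a::comm_monoid_add mat \<Rightarrow> 'a" where
  "mat_trace A = (\<Sum>i<dim_row A. A $$ (i, i))"

definition rep_character ::
    "('g, 'b) monoid_scheme \<Rightarrow> ('g \<Rightarrow> complex mat) \<Rightarrow> 'g \<Rightarrow> complex" where
  "rep_character G \<rho> = (\<lambda>g\<in>carrier G. mat_trace (\<rho> g))"

definition irr_characters :: "('g, 'b) monoid_scheme \<Rightarrow> ('g \<Rightarrow> complex) set" where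
  "irr_characters G = {rep_character G \<rho> |d \<rho>. irreducible_representation G d \<rho>}"

text \<open>A linear character is a homomorphism into the multiplicative group of the complex numbers.\<close>

definition linear_character :: "('g, 'b) monoid_scheme \<Rightarrow> ('g \<Rightarrow> complex) \<Rightarrow> bool" where
  "linear_character G \<chi> \<longleftrightarrow> \<chi> \<in> hom G (units_of class_ring) \<and> \<chi> \<in> extensional (carrier G)"

definition induced_character ::
    "('g, 'b) monoid_scheme \<Rightarrow> 'g set \<Rightarrow> ('g \<Rightarrow> complex) \<Rightarrow> 'g \<Rightarrow> complex" where
  "induced_character G H \<xi> = (\<lambda>g\<in>carrier G.
     (\<Sum>x\<in>carrier G. if inv\<^bsub>G\<^esub> x \<otimes>\<^bsub>G\<^esub> g \<otimes>\<^bsub>G\<^esub> x \<in> H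
                        then \<xi> (inv\<^bsub>G\<^esub> x \<otimes>\<^bsub>G\<^esub> g \<otimes>\<^bsub>G\<^esub> x) else 0)
     / of_nat (card H))"


section \<open>Unitriangular groups and root subgroups\<close>

definition unitri :: "nat \<Rightarrow> 'a::semiring_1 mat monoid" where
  "unitri n = \<lparr>
     carrier = {A \<in> carrier_mat n n. upper_triangular A \<and> (\<forall>i<n. A $$ (i, i) = 1)},
     mult = (*),
     one = 1\<^sub>m n\<rparr>"

text \<open>
  The positive root \<open>\<alpha>\<^sub>i + \<dots> + \<alpha>\<^sub>j\<close> of type \<open>A\<close> is represented by the pair \<open>(i, j)\<close>; it lies
  on row \<open>i\<close> and column \<open>j + 1\<close>. Rows and columns of roots are counted from 1, whereas the entries
  of a matrix are indexed from 0, so the corresponding entry is \<open>A $$ (i - 1, j)\<close>.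
\<close>

type_synonym root = "nat \<times> nat"

definition pos_roots :: "nat \<Rightarrow> root set" where
  "pos_roots n = {(i, j). 1 \<le> i \<and> i \<le> j \<and> j \<le> n - 1}"

definition root_row :: "root \<Rightarrow> nat" where
  "root_row \<alpha> = fst \<alpha>"

definition root_col :: "root \<Rightarrow> nat" where
  "root_col \<alpha> = snd \<alpha> + 1"

definition matrix_unit :: "nat \<Rightarrow> nat \<Rightarrow> nat \<Rightarrow> 'a::semiring_1 mat" where
  "matrix_unit n r c = mat n n (\<lambda>p. if p = (r - 1, c - 1) then 1 else 0)"

definition root_elt :: "nat \<Rightarrow> root \<Rightarrow> 'a::semiring_1 \<Rightarrow> 'a mat" where
  "root_elt n \<alpha> c = 1\<^sub>m n + c \<cdot>\<^sub>m matrix_unit n (root_row \<alpha>) (root_col \<alpha>)"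

definition root_subgroup :: "nat \<Rightarrow> root \<Rightarrow> 'a::semiring_1 mat set" where
  "root_subgroup n \<alpha> = range (root_elt n \<alpha>)"

definition generated_by_roots :: "nat \<Rightarrow> root set \<Rightarrow> 'a::semiring_1 mat set" where
  "generated_by_roots n S = generate (unitri n) (\<Union>\<beta>\<in>S. root_subgroup n \<beta>)"

definition arm :: "root \<Rightarrow> root set" where
  "arm \<alpha> = {(fst \<alpha>, k) |k. fst \<alpha> \<le> k \<and> k < snd \<alpha>}"

definition V_root :: "nat \<Rightarrow> root \<Rightarrow> 'a::semiring_1 mat set" where
  "V_root n \<alpha> = generated_by_roots n (pos_roots n - arm \<alpha>)"

text \<open>The character \<open>\<lambda>\<^bsub>\<alpha>,s\<^esub>\<close> of \<open>V\<^sub>\<alpha>\<close>; it exists uniquely by \<open>lambda_root_unique\<close> below.\<close>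

definition is_lambda_root ::
    "nat \<Rightarrow> ('a::field \<Rightarrow> complex) \<Rightarrow> root \<Rightarrow> 'a \<Rightarrow> ('a mat \<Rightarrow> complex) \<Rightarrow> bool" where
  "is_lambda_root n \<phi> \<alpha> s \<chi> \<longleftrightarrow>
     linear_character (unitri n\<lparr>carrier := V_root n \<alpha>\<rparr>) \<chi> \<and>
     (\<forall>d. \<chi> (root_elt n \<alpha> d) = \<phi> (d * s)) \<and>
     (\<forall>\<beta>\<in>pos_roots n - {\<alpha>}. (root_subgroup n \<beta> :: 'a mat set) \<subseteq> V_root n \<alpha> \<longrightarrow>
        (\<forall>g\<in>root_subgroup n \<beta>. \<chi> g = 1))"

definition lambda_root ::
    "nat \<Rightarrow> ('a::field \<Rightarrow> complex) \<Rightarrow> root \<Rightarrow> 'a \<Rightarrow> 'a mat \<Rightarrow> complex" where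
  "lambda_root n \<phi> \<alpha> s = (THE \<chi>. is_lambda_root n \<phi> \<alpha> s \<chi>)"


subsection \<open>Existence and uniqueness of the characters of \<open>V\<^sub>\<alpha>\<close>\<close>

lemma unitri_simps:
  "carrier (unitri n) = {A \<in> carrier_mat n n. upper_triangular A \<and> (\<forall>i<n. A $$ (i, i) = 1)}"
  "x \<otimes>\<^bsub>unitri n\<^esub> y = x * y" "\<one>\<^bsub>unitri n\<^esub> = 1\<^sub>m n"
  by (simp_all add: unitri_def)

lemma unitri_mult_index:
  fixes A B :: "'a::semiring_1 mat"
  assumes A: "A \<in> carrier (unitri n)" and B: "B \<in> carrier (unitri n)" and ij: "i < n" "j < n"
  shows "(A * B) $$ (i, j) = (\<Sum>k\<in>{i..j}. A $$ (i, k) * B $$ (k, j))"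
proof -
  have *: "A \<in> carrier_mat n n" "B \<in> carrier_mat n n"
    "\<And>k. k < i \<Longrightarrow> A $$ (i, k) = 0" "\<And>k. k < n \<Longrightarrow> j < k \<Longrightarrow> B $$ (k, j) = 0"
    using A B ij by (auto simp: unitri_simps upper_triangular_def)
  have "(A * B) $$ (i, j) = (\<Sum>k\<in>{0..<n}. A $$ (i, k) * B $$ (k, j))"
    using * ij by (auto simp: scalar_prod_def)
  also have "\<dots> = (\<Sum>k\<in>{i..j}. A $$ (i, k) * B $$ (k, j))"
    by (rule sum.mono_neutral_right) (use * ij in \<open>auto simp: not_le\<close>)
  finally show ?thesis .
qed

lemma unitri_mult_closed:
  fixes A B :: "'a::semiring_1 mat"
  assumes A: "A \<in> carrier (unitri n)" and B: "B \<in> carrier (unitri n)"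
  shows "A * B \<in> carrier (unitri n)"
proof -
  have "A \<in> carrier_mat n n" "B \<in> carrier_mat n n" using A B by (auto simp: unitri_simps)
  moreover have "(A * B) $$ (i, j) = 0" if "i < n" "j < i" for i j
    using unitri_mult_index[OF A B, of i j] that by simp
  moreover have "(A * B) $$ (i, i) = 1" if "i < n" for i
    using unitri_mult_index[OF A B that that] that A B by (auto simp: unitri_simps)
  ultimately show ?thesis by (auto simp: unitri_simps upper_triangular_def)
qed

lemma unitri_group: "group (unitri n :: 'a::field mat monoid)"
proof (rule groupI)
  fix A :: "'a mat" assume A: "A \<in> carrier (unitri n)"
  hence A': "A \<in> carrier_mat n n" and ut: "upper_triangular A" by (auto simp: unitri_simps)
  have "diag_mat A = replicate n 1"
    using A by (auto simp: unitri_simps diag_mat_def intro!: nth_equalityI)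
  hence "det A = 1" using det_upper_triangular[OF ut A'] by simp
  then obtain B where B: "B \<in> carrier_mat n n" "B * A = 1\<^sub>m n" "A * B = 1\<^sub>m n"
    using det_non_zero_imp_unit[OF A', of "()"] by (auto simp: Units_def ring_mat_def)
  have An: "A $$ (i, k) = (if k < i then 0 else A $$ (i,k))" "A $$ (i,i) = 1" if "i < n" for i k
    using A that by (auto simp: unitri_simps upper_triangular_def)
  have z: "B $$ (i, j) = (if i = j then 1 else 0)" if "j \<le> i" "i < n" for i j
    using that
  proof (induction j arbitrary: i rule: less_induct)
    case (less j)
    have "(if i = j then 1 else 0) = (B * A) $$ (i, j)" unfolding B(2) using less.prems by simp
    also have "\<dots> = (\<Sum>k\<in>{0..<n}. B $$ (i, k) * A $$ (k, j))"
      using B(1) A' less.prems by (auto simp: scalar_prod_def)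
    also have "\<dots> = (\<Sum>k\<in>{j}. B $$ (i, k) * A $$ (k, j))"
    proof (rule sum.mono_neutral_right)
      show "\<forall>k\<in>{0..<n} - {j}. B $$ (i, k) * A $$ (k, j) = 0"
      proof
        fix k assume k: "k \<in> {0..<n} - {j}"
        show "B $$ (i, k) * A $$ (k, j) = 0"
        proof (cases "k < j")
          case True
          thus ?thesis using less.IH[of k i] less.prems by simp
        next
          case False
          thus ?thesis using An(1)[of k j] k by simp
        qed
      qed
    qed (use less.prems in auto)
    also have "\<dots> = B $$ (i, j)" using An(2)[of j] less.prems by simp
    finally show ?case by simp
  qed
  have "B \<in> carrier (unitri n)" using B z by (auto simp: unitri_simps upper_triangular_def)
  thus "\<exists>B\<in>carrier (unitri n). B \<otimes>\<^bsub>unitri n\<^esub> A = \<one>\<^bsub>unitri n\<^esub>"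
    using B by (auto simp: unitri_simps)
next
  fix x y z :: "'a mat"
  assume "x \<in> carrier (unitri n)" "y \<in> carrier (unitri n)" "z \<in> carrier (unitri n)"
  thus "x \<otimes>\<^bsub>unitri n\<^esub> y \<otimes>\<^bsub>unitri n\<^esub> z = x \<otimes>\<^bsub>unitri n\<^esub> (y \<otimes>\<^bsub>unitri n\<^esub> z)"
    by (auto simp: unitri_simps assoc_mult_mat[of _ n n _ n _ n])
next
  fix A B :: "'a mat" assume "A \<in> carrier (unitri n)" "B \<in> carrier (unitri n)"
  thus "A \<otimes>\<^bsub>unitri n\<^esub> B \<in> carrier (unitri n)"
    using unitri_mult_closed by (simp add: unitri_simps(2))
qed (auto simp: unitri_simps upper_triangular_def)

lemma root_elt_index:
  assumes "(a, b) \<in> pos_roots n" "i < n" "j < n"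
  shows "root_elt n (a, b) c $$ (i, j) = (if i = j then 1 else if i = a - 1 \<and> j = b then c else 0)"
  using assms by (auto simp: root_elt_def matrix_unit_def root_row_def root_col_def pos_roots_def)

lemma root_elt_carrier:
  assumes "\<alpha> \<in> pos_roots n"
  shows "root_elt n \<alpha> c \<in> carrier (unitri n)"
proof -
  obtain a b where \<alpha>: "\<alpha> = (a, b)" by force
  have "root_elt n \<alpha> c \<in> carrier_mat n n" by (simp add: root_elt_def matrix_unit_def)
  thus ?thesis using assms
    by (auto simp: unitri_simps upper_triangular_def \<alpha> root_elt_index) (auto simp: pos_roots_def)
qed

lemma generated_by_roots_subgroup:
  assumes "S \<subseteq> pos_roots n"
  shows "subgroup (generated_by_roots n S :: 'a::field mat set) (unitri n)"
  unfolding generated_by_roots_def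
  by (rule group.generate_is_subgroup[OF unitri_group])
     (use assms root_elt_carrier in \<open>unfold root_subgroup_def, blast\<close>)

text \<open>Contains \<open>V_root n (a, b)\<close>; on it the entry of the root is additive.\<close>

definition arm_free :: "nat \<Rightarrow> nat \<Rightarrow> nat \<Rightarrow> 'a::field mat set" where
  "arm_free n a b = {A \<in> carrier (unitri n). \<forall>k. a \<le> k \<and> k < b \<longrightarrow> A $$ (a - 1, k) = 0}"

lemma arm_free_mult:
  assumes r: "(a, b) \<in> pos_roots n" and A: "A \<in> arm_free n a b" and B: "B \<in> carrier (unitri n)"
    and k: "a \<le> k" "k \<le> b"
  shows "(A * B) $$ (a - 1, k) = (B $$ (a - 1, k) + (if k = b then A $$ (a - 1, b) else 0))"
proof -
  have *: "A \<in> carrier (unitri n)" "A $$ (a-1,a-1) = 1" "B $$ (k,k) = 1"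
     "\<And>k. a \<le> k \<Longrightarrow> k < b \<Longrightarrow> A $$ (a - 1, k) = 0"
    using A B r k by (auto simp: arm_free_def unitri_simps pos_roots_def)
  have r': "1 \<le> a" "b < n" using r by (auto simp: pos_roots_def)
  have "(A * B) $$ (a - 1, k) = (\<Sum>l\<in>{a-1..k}. A $$ (a-1, l) * B $$ (l, k))"
    using unitri_mult_index[OF *(1) B, of "a-1" k] r r' k by (auto simp: pos_roots_def)
  also have "\<dots> = (\<Sum>l\<in>{a-1,k}. A $$ (a-1, l) * B $$ (l, k))"
    by (rule sum.mono_neutral_right) (use k * in auto)
  also have "\<dots> = A $$ (a-1, a-1) * B $$ (a-1, k) + A $$ (a-1,k) * B $$ (k,k)"
    using r' k by (subst sum.insert) auto
  finally show ?thesis using * k by auto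
qed

lemma arm_free_subgroup:
  assumes r: "(a, b) \<in> pos_roots n"
  shows "subgroup (arm_free n a b) (unitri n)"
proof (rule group.subgroupI[OF unitri_group])
  show "arm_free n a b \<subseteq> carrier (unitri n)" by (auto simp: arm_free_def)
  have "1\<^sub>m n \<in> arm_free n a b"
    using group.subgroup_self[OF unitri_group] r
    by (auto simp: arm_free_def unitri_simps pos_roots_def upper_triangular_def)
  thus "arm_free n a b \<noteq> {}" by auto
next
  fix A :: "'a mat" assume A: "A \<in> arm_free n a b"
  let ?B = "inv\<^bsub>unitri n\<^esub> A"
  have Ac: "A \<in> carrier (unitri n)" using A by (auto simp: arm_free_def)
  have B: "?B \<in> carrier (unitri n)" by (rule group.inv_closed[OF unitri_group Ac])
  have AB: "A * ?B = 1\<^sub>m n" using group.r_inv[OF unitri_group Ac] by (simp add: unitri_simps)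
  show "?B \<in> arm_free n a b"
    unfolding arm_free_def
  proof (intro CollectI conjI allI impI B)
    fix k assume k: "a \<le> k \<and> k < b"
    show "?B $$ (a - 1, k) = 0"
      using arm_free_mult[OF r A B, of k] AB k r by (auto simp: pos_roots_def split: if_splits)
  qed
next
  fix A B :: "'a mat" assume "A \<in> arm_free n a b" "B \<in> arm_free n a b"
  thus "A \<otimes>\<^bsub>unitri n\<^esub> B \<in> arm_free n a b"
    using arm_free_mult[OF r, of A B] unitri_mult_closed[of A n B]
    by (auto simp: arm_free_def unitri_simps(2))
qed

lemma V_root_arm_free:
  assumes r: "(a, b) \<in> pos_roots n"
  shows "V_root n (a, b) \<subseteq> arm_free n a b"
  unfolding V_root_def generated_by_roots_def
proof (rule group.generate_subgroup_incl[OF unitri_group _ arm_free_subgroup[OF r]])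
  show "(\<Union>\<beta>\<in>pos_roots n - arm (a, b). root_subgroup n \<beta>) \<subseteq> arm_free n a b"
    using r root_elt_carrier
    by (auto simp: root_subgroup_def arm_free_def root_elt_index pos_roots_def arm_def)
qed

lemma lambda_root_unique:
  fixes \<phi> :: "'a::field \<Rightarrow> complex"
  assumes \<phi>: "linear_character (add_monoid class_ring) \<phi>" and \<alpha>: "\<alpha> \<in> pos_roots n"
  shows "\<exists>!\<chi>. is_lambda_root n \<phi> \<alpha> s \<chi>"
proof -
  obtain a b where ab: "\<alpha> = (a, b)" by force
  let ?V = "V_root n \<alpha> :: 'a mat set"
  let ?G = "unitri n\<lparr>carrier := ?V\<rparr>"
  let ?f = "\<lambda>A\<in>?V. \<phi> (A $$ (a - 1, b) * s)"
  have r: "(a, b) \<in> pos_roots n" "1 \<le> a" "a \<le> b" "b < n" using \<alpha> ab by (auto simp: pos_roots_def)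
  have sub: "subgroup ?V (unitri n)" unfolding V_root_def by (rule generated_by_roots_subgroup) auto
  have add: "\<phi> (x + y) = \<phi> x * \<phi> y" and nz: "\<phi> x \<noteq> 0" for x y
    using \<phi> by (auto simp: linear_character_def hom_def units_of_def Units_def Pi_def)
      (metis mult_zero_right zero_neq_one)
  have "\<phi> 0 = 1" using add[of 0 0] nz[of 0] by simp
  have VU: "?V \<subseteq> arm_free n a b" using V_root_arm_free[OF r(1)] ab by simp
  have X: "(root_subgroup n \<beta> :: 'a mat set) \<subseteq> ?V" if "\<beta> \<in> pos_roots n - arm \<alpha>" for \<beta>
    using that unfolding V_root_def generated_by_roots_def by (auto intro: generate.incl)
  have \<alpha>V: "\<alpha> \<in> pos_roots n - arm \<alpha>" using \<alpha> by (auto simp: arm_def ab)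
  have hom: "?f \<in> hom ?G (units_of class_ring)"
  proof (rule homI)
    fix A assume A: "A \<in> carrier ?G"
    have "\<phi> x \<in> Units class_ring" for x
      using nz[of x] by (auto simp: Units_def intro!: exI[of _ "inverse (\<phi> x)"])
    thus "?f A \<in> carrier (units_of class_ring)" using A by (auto simp: units_of_def)
  next
    fix A B assume AB: "A \<in> carrier ?G" "B \<in> carrier ?G"
    hence "A * B \<in> ?V" using subgroup.m_closed[OF sub] by (auto simp: unitri_simps(2))
    moreover have "(A * B) $$ (a - 1, b) = B $$ (a - 1, b) + A $$ (a - 1, b)"
      using arm_free_mult[OF r(1), of A B b] AB VU r by (auto simp: arm_free_def)
    ultimately show "?f (A \<otimes>\<^bsub>?G\<^esub> B) = ?f A \<otimes>\<^bsub>units_of class_ring\<^esub> ?f B"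
      using AB by (simp add: unitri_simps(2) units_of_def add algebra_simps)
  qed
  have ex: "is_lambda_root n \<phi> \<alpha> s ?f"
    unfolding is_lambda_root_def linear_character_def
  proof (intro conjI allI ballI impI hom)
    fix d show "?f (root_elt n \<alpha> d) = \<phi> (d * s)"
      using X[OF \<alpha>V] r by (auto simp: root_subgroup_def ab root_elt_index)
  next
    fix \<beta> and g :: "'a mat"
    assume b: "\<beta> \<in> pos_roots n - {\<alpha>}" "root_subgroup n \<beta> \<subseteq> ?V" "g \<in> root_subgroup n \<beta>"
    obtain c d where cd: "\<beta> = (c, d)" by force
    have "g $$ (a - 1, b) = 0" using b r ab cd
      by (auto simp: root_subgroup_def root_elt_index) (auto simp: pos_roots_def)
    thus "?f g = 1" using b \<open>\<phi> 0 = 1\<close> by auto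
  qed auto
  have uniq: "\<chi> = \<chi>'" if "is_lambda_root n \<phi> \<alpha> s \<chi>" "is_lambda_root n \<phi> \<alpha> s \<chi>'" for \<chi> \<chi>'
  proof (rule extensionalityI)
    note d = that[unfolded is_lambda_root_def linear_character_def]
    show "\<chi> \<in> extensional ?V" "\<chi>' \<in> extensional ?V" using d by auto
    have field_is_ring: "ring (class_ring :: complex ring)"
      using class_field[where 'a=complex] by (simp add: field_def domain_def cring_def)
    have h: "group_hom ?G (units_of (class_ring :: complex ring)) \<chi>" 
            "group_hom ?G (units_of (class_ring :: complex ring)) \<chi>'"
      using d group.subgroup_imp_group[OF unitri_group sub] monoid.units_group[OF ring.is_monoid[OF field_is_ring]]
      by (auto simp: group_hom_def group_hom_axioms_def)
    have gen: "\<chi> g = \<chi>' g" if gm: "g \<in> (\<Union>\<beta>\<in>pos_roots n - arm \<alpha>. root_subgroup n \<beta>)" for g :: "'a mat"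
    proof -
      obtain \<beta> where \<beta>: "\<beta> \<in> pos_roots n - arm \<alpha>" "g \<in> root_subgroup n \<beta>" using gm by blast
      show ?thesis
      proof (cases "\<beta> = \<alpha>")
        case True thus ?thesis using \<beta> d by (auto simp: root_subgroup_def)
      next
        case False thus ?thesis using \<beta> d X[OF \<beta>(1)] by auto
      qed
    qed
    fix g assume "g \<in> ?V"
    thus "\<chi> g = \<chi>' g"
      unfolding V_root_def generated_by_roots_def
    proof (induction rule: generate.induct)
      case one
      show ?case using h[THEN group_hom.hom_one] by (simp add: unitri_simps)
    next
      case (incl x) thus ?case by (rule gen)
    next
      case (inv x)
      have xV: "x \<in> ?V" using inv X by auto
      have "inv\<^bsub>?G\<^esub> x = inv\<^bsub>unitri n\<^esub> x"
        using group.m_inv_consistent[OF unitri_group sub xV] by simp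
      thus ?case using h[THEN group_hom.hom_inv, of x] xV gen[OF inv] by simp
    next
      case (eng x y)
      have xy: "x \<in> ?V" "y \<in> ?V" using eng unfolding V_root_def generated_by_roots_def by auto
      thus ?case using eng h[THEN group_hom.hom_mult, of x y] by simp
    qed
  qed
  show ?thesis using ex uniq by blast
qed


section \<open>Basic sets\<close>

definition basic_set :: "nat \<Rightarrow> root set \<Rightarrow> bool" where
  "basic_set n D \<longleftrightarrow> D \<noteq> {} \<and> D \<subseteq> pos_roots n \<and>
     (\<forall>\<alpha>\<in>D. \<forall>\<beta>\<in>D. \<alpha> \<noteq> \<beta> \<longrightarrow> root_row \<alpha> \<noteq> root_row \<beta> \<and> root_col \<alpha> \<noteq> root_col \<beta>)"

text \<open>An element of \<open>E(D)\<close> is the family \<open>(\<lambda>\<^bsub>\<alpha>,s\<^esub>)\<close> indexed by \<open>\<alpha> \<in> D\<close>, with \<open>s = s\<^sub>\<alpha> \<noteq> 0\<close>.\<close>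

definition E_set ::
    "nat \<Rightarrow> ('a::field \<Rightarrow> complex) \<Rightarrow> root set \<Rightarrow> (root \<Rightarrow> 'a mat \<Rightarrow> complex) set" where
  "E_set n \<phi> D = (\<Pi>\<^sub>E \<alpha>\<in>D. {lambda_root n \<phi> \<alpha> s |s. s \<noteq> 0})"

definition V_group :: "nat \<Rightarrow> root set \<Rightarrow> 'a::semiring_1 mat set" where
  "V_group n D = (\<Inter>\<alpha>\<in>D. V_root n \<alpha>)"

definition lambda_D ::
    "nat \<Rightarrow> root set \<Rightarrow> (root \<Rightarrow> 'a::semiring_1 mat \<Rightarrow> complex) \<Rightarrow> 'a mat \<Rightarrow> complex" where
  "lambda_D n D \<psi> = (\<lambda>v\<in>V_group n D. \<Prod>\<alpha>\<in>D. \<psi> \<alpha> v)"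

definition K_group :: "nat \<Rightarrow> root set \<Rightarrow> 'a::semiring_1 mat set" where
  "K_group n D = generated_by_roots n
     {\<alpha> \<in> pos_roots n. (root_subgroup n \<alpha> :: 'a mat set) \<subseteq> V_group n D \<and> \<alpha> \<notin> D}"

text \<open>
  In a basic set the columns are distinct, so ordering \<open>D\<close> by increasing column means that \<open>\<sigma>\<close>
  precedes \<open>\<tau>\<close> iff \<open>root_col \<sigma> < root_col \<tau>\<close>.
\<close>

definition Gamma_set :: "root set \<Rightarrow> root set" where
  "Gamma_set D = {(root_row \<sigma>, root_row \<tau> - 1) |\<sigma> \<tau>.
     \<sigma> \<in> D \<and> \<tau> \<in> D \<and> root_col \<sigma> < root_col \<tau> \<and> root_row \<sigma> < root_row \<tau>}"

definition R_group :: "nat \<Rightarrow> root set \<Rightarrow> 'a::semiring_1 mat set" where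
  "R_group n D = generated_by_roots n (Gamma_set D)"

definition R_quot :: "nat \<Rightarrow> root set \<Rightarrow> 'a::semiring_1 mat set monoid" where
  "R_quot n D = unitri n\<lparr>carrier := R_group n D\<rparr> Mod (K_group n D \<inter> R_group n D)"

definition V_quot :: "nat \<Rightarrow> root set \<Rightarrow> 'a::semiring_1 mat set set" where
  "V_quot n D =
     carrier (unitri n\<lparr>carrier := V_group n D \<inter> R_group n D\<rparr> Mod (K_group n D \<inter> R_group n D))"

text \<open>
  The character of \<open>V\<close> induced by \<open>\<lambda>\<^sub>D\<close>: its value at a coset is the common value of \<open>\<lambda>\<^sub>D\<close> on that
  coset, which exists because \<open>K\<^sub>D \<inter> R\<^sub>D\<close> lies in the kernel of \<open>\<lambda>\<^sub>D\<close>.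
\<close>

definition mu_char ::
    "nat \<Rightarrow> root set \<Rightarrow> (root \<Rightarrow> 'a::semiring_1 mat \<Rightarrow> complex) \<Rightarrow> 'a mat set \<Rightarrow> complex" where
  "mu_char n D \<psi> = (\<lambda>C\<in>V_quot n D. the_elem (lambda_D n D \<psi> ` C))"

end

theory Submission
  imports Defs
    "Jordan_Normal_Form.Char_Poly"
    "HOL-Computational_Algebra.Fundamental_Theorem_Algebra"
    "HOL-Algebra.Multiplicative_Group"
begin

text \<open>
  Number rows and columns from 1 and write \<open>ij\<close> for the matrix position \<open>(i, j)\<close>. Modulo \<open>K \<inter> R\<close>
  twenty positions survive in \<open>R\<close>. Nine of them, \<open>12, 23, 34, 25, 48, 56, 67, 78, 89\<close>, generate the
  group; the other eleven span its derived subgroup \<open>C\<close>, which is abelian and contains the central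
  subgroup \<open>V\<close> spanned by \<open>15, 26, 57, 68, 79\<close>. The linear characters \<open>\<lambda>\<close> of \<open>C\<close> above \<open>\<mu>\<close> are given
  by their six weights \<open>p, b, r, s, c, t\<close> at the positions \<open>13, 14, 24, 38, 39, 49\<close>.

  For each \<open>\<lambda>\<close> there is a subgroup \<open>A \<supseteq> C\<close> which is its own centraliser in the sense that
  \<open>g \<in> A\<close> iff \<open>\<lambda> [g, a] = 1\<close> for all \<open>a \<in> A\<close>. Then \<open>\<lambda>\<close> has \<open>[A : C]\<close> linear extensions to \<open>A\<close>, each of
  them has stabiliser \<open>A\<close> in \<open>R\<close>, and so each induces an irreducible character of degree \<open>[R : A]\<close>
  (\<open>induced_character_irreducible\<close>). Summing over all \<open>\<lambda>\<close> and all extensions gives \<open>\<mu>\<^sup>R\<close>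
  (\<open>sum_lin_exts\<close>). By Frobenius reciprocity an irreducible \<open>\<chi>\<close> above \<open>\<mu>\<close> has multiplicity \<open>\<chi>(1)\<close> in \<open>\<mu>\<^sup>R\<close>,
  so it arises from exactly \<open>\<chi>(1)\<close> of these pairs, and the number of \<open>\<chi>\<close> of degree \<open>d\<close> is
  \<open>d\<inverse> \<Sum> [A : C]\<close>, the sum running over the \<open>\<lambda>\<close> with \<open>[R : A] = d\<close> (\<open>central_induced_decomposition\<close>).

  It remains to find \<open>A\<close>. If \<open>b = c = 0\<close>, the commutator is, modulo the kernel of \<open>\<lambda>\<close>, an alternating
  form on \<open>R / C\<close> whose nonzero entries follow the nine-cycle
  \<open>12 - 23 - 34 - 48 - 89 - 78 - 67 - 56 - 25 - 12\<close> with edge weights \<open>p, r, s, t\<close> and the five nonzero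
  parameters of \<open>\<mu>\<close>. Its rank is 8, except that it is 6 when \<open>r = s = 0\<close> and \<open>p t = 0\<close>; a maximal
  isotropic subspace gives degree \<open>q\<^sup>4\<close> or \<open>q\<^sup>3\<close>. If \<open>b\<close> or \<open>c\<close> is nonzero, the degree is \<open>q\<^sup>4\<close> when
  \<open>b = p = 0\<close> or \<open>c = t = 0\<close>, and \<open>q\<^sup>5\<close> otherwise. Counting weights gives \<open>2q - 1\<close> characters \<open>\<lambda>\<close> for
  degree \<open>q\<^sup>3\<close>, \<open>q\<^sup>3 (q + 2) (q - 1)\<^sup>2\<close> for degree \<open>q\<^sup>5\<close>, and the rest of the \<open>q\<^sup>6\<close> for degree \<open>q\<^sup>4\<close>.

  The extensions of \<open>\<lambda>\<close> to \<open>A\<close> are obtained abstractly, one cyclic step at a time, since in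
  characteristic 2 the subgroup \<open>A\<close> for a cycle with nonzero weights may contain elements whose square
  is not in the kernel of \<open>\<lambda>\<close>, so that no formula in terms of \<open>\<phi>\<close> alone can describe them.
\<close>

section \<open>Representations and Schur's lemma\<close>

lemma mat_mult_entry:
  assumes "A \<in> carrier_mat n m" "B \<in> carrier_mat m l" "i < n" "j < l"
  shows "(A * B) $$ (i, j) = (\<Sum>k<m. A $$ (i, k) * B $$ (k, j))"
  using assms by (auto simp: scalar_prod_def atLeast0LessThan)

lemma mat_mult_vec_entry:
  assumes "A \<in> carrier_mat n m" "v \<in> carrier_vec m" "i < n"
  shows "(A *\<^sub>v v) $ i = (\<Sum>k<m. A $$ (i, k) * v $ k)"
  using assms by (auto simp: scalar_prod_def atLeast0LessThan)

lemma subspace_vecI: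
  fixes W :: "complex vec set"
  assumes "W \<subseteq> carrier_vec d" "0\<^sub>v d \<in> W"
    and "\<And>v w. v \<in> W \<Longrightarrow> w \<in> W \<Longrightarrow> v + w \<in> W" "\<And>c v. v \<in> W \<Longrightarrow> c \<cdot>\<^sub>v v \<in> W"
  shows "VectorSpace.subspace class_ring W (module_vec TYPE(complex) d)"
  unfolding VectorSpace.subspace_def submodule_def
  using assms vec_vs vec_module by (auto simp: module_vec_simps)

lemma subspace_vecD:
  fixes W :: "complex vec set"
  assumes "VectorSpace.subspace class_ring W (module_vec TYPE(complex) d)"
  shows "W \<subseteq> carrier_vec d" "0\<^sub>v d \<in> W"
    and "v \<in> W \<Longrightarrow> w \<in> W \<Longrightarrow> v + w \<in> W" "v \<in> W \<Longrightarrow> c \<cdot>\<^sub>v v \<in> W"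
  using assms unfolding VectorSpace.subspace_def submodule_def
  by (auto simp: module_vec_simps)

lemma representationI:
  assumes "group G" and "\<And>g. g \<in> carrier G \<Longrightarrow> \<rho> g \<in> carrier_mat d d"
    and mult: "\<And>g h. g \<in> carrier G \<Longrightarrow> h \<in> carrier G \<Longrightarrow> \<rho> (g \<otimes>\<^bsub>G\<^esub> h) = \<rho> g * \<rho> h"
    and one: "\<rho> \<one>\<^bsub>G\<^esub> = 1\<^sub>m d"
  shows "representation G d \<rho>"
proof -
  interpret group G by fact
  have "\<rho> g \<in> Units (ring_mat TYPE(complex) d ())" if g: "g \<in> carrier G" for g
  proof -
    have "\<rho> (inv\<^bsub>G\<^esub> g) * \<rho> g = 1\<^sub>m d" "\<rho> g * \<rho> (inv\<^bsub>G\<^esub> g) = 1\<^sub>m d"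
      using mult[of "inv\<^bsub>G\<^esub> g" g] mult[of g "inv\<^bsub>G\<^esub> g"] g one by auto
    thus ?thesis using assms(2) g unfolding Units_def ring_mat_def
      by (auto intro!: bexI[of _ "\<rho> (inv\<^bsub>G\<^esub> g)"])
  qed
  thus ?thesis using mult unfolding representation_def
    by (auto intro!: homI simp: units_of_def ring_mat_def)
qed

lemma representationD:
  assumes G: "group G" and "representation G d \<rho>"
  shows "g \<in> carrier G \<Longrightarrow> \<rho> g \<in> carrier_mat d d"
    and "g \<in> carrier G \<Longrightarrow> h \<in> carrier G \<Longrightarrow> \<rho> (g \<otimes>\<^bsub>G\<^esub> h) = \<rho> g * \<rho> h"
    and "\<rho> \<one>\<^bsub>G\<^esub> = 1\<^sub>m d"
proof -
  let ?M = "units_of (ring_mat TYPE(complex) d ())"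
  have h: "\<rho> \<in> hom G ?M" using assms by (simp add: representation_def)
  show "\<rho> g \<in> carrier_mat d d" if "g \<in> carrier G" for g
    using hom_carrier[OF h] that by (auto simp: units_of_def Units_def ring_mat_def)
  show "\<rho> (g \<otimes>\<^bsub>G\<^esub> h) = \<rho> g * \<rho> h" if "g \<in> carrier G" "h \<in> carrier G" for g h
    using hom_mult[OF h that] by (simp add: units_of_def ring_mat_def)
  have "group ?M"
    by (rule monoid.units_group[OF ring.is_monoid[OF ring_mat]])
  hence "\<rho> \<one>\<^bsub>G\<^esub> = \<one>\<^bsub>?M\<^esub>"
    using G h by (metis group.is_group hom_one)
  thus "\<rho> \<one>\<^bsub>G\<^esub> = 1\<^sub>m d" by (simp add: units_of_def ring_mat_def)
qed

text \<open>
  The kernel and the image of an intertwiner are invariant subspaces, so both are trivial or everything;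
  a two-sided inverse is then assembled from preimages of the unit vectors.
\<close>

lemma schur_invertible:
  assumes G: "group G" and \<rho>: "irreducible_representation G d \<rho>"
    and \<sigma>: "irreducible_representation G e \<sigma>"
    and T: "T \<in> carrier_mat d e" "T \<noteq> 0\<^sub>m d e"
    and tw: "\<And>h. h \<in> carrier G \<Longrightarrow> \<rho> h * T = T * \<sigma> h"
  shows "\<exists>U\<in>carrier_mat e d. T * U = 1\<^sub>m d \<and> U * T = 1\<^sub>m e"
proof -
  note r = representationD[OF G] 
  have rep: "representation G d \<rho>" "representation G e \<sigma>"
    using \<rho> \<sigma> by (auto simp: irreducible_representation_def)
  have rc: "\<rho> h \<in> carrier_mat d d" "\<sigma> h \<in> carrier_mat e e" if "h \<in> carrier G" for h
    using r(1)[OF rep(1) that] r(1)[OF rep(2) that] by auto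
  let ?K = "{v \<in> carrier_vec e. T *\<^sub>v v = 0\<^sub>v d}"
  let ?I = "{T *\<^sub>v v |v. v \<in> carrier_vec e}"
  have "VectorSpace.subspace class_ring ?K (module_vec TYPE(complex) e)"
    by (rule subspace_vecI) (use T in \<open>auto simp: mult_add_distrib_mat_vec mult_mat_vec\<close>)
  moreover have "\<sigma> g *\<^sub>v v \<in> ?K" if g: "g \<in> carrier G" and v: "v \<in> ?K" for g v
  proof -
    have "T *\<^sub>v (\<sigma> g *\<^sub>v v) = (T * \<sigma> g) *\<^sub>v v"
      using T rc[OF g] v by (simp add: assoc_mult_mat_vec[of _ d e _ e])
    also have "\<dots> = \<rho> g *\<^sub>v (T *\<^sub>v v)"
      unfolding tw[OF g, symmetric] using T rc[OF g] v by (auto simp: assoc_mult_mat_vec[of _ d d _ e])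
    finally show ?thesis using v T rc[OF g] by auto
  qed
  ultimately have K: "?K = {0\<^sub>v e} \<or> ?K = carrier_vec e"
    using \<sigma> by (auto simp: irreducible_representation_def)
  obtain i j where ij: "i < d" "j < e" "T $$ (i, j) \<noteq> 0"
    using T by (metis carrier_matD eq_matI index_zero_mat)
  have nz: "T *\<^sub>v unit_vec e j \<noteq> 0\<^sub>v d"
  proof
    assume "T *\<^sub>v unit_vec e j = 0\<^sub>v d"
    hence "(T *\<^sub>v unit_vec e j) $ i = 0" using ij by simp
    thus False using ij T by auto
  qed
  hence "unit_vec e j \<notin> ?K" by simp
  hence "?K \<noteq> carrier_vec e" using unit_vec_carrier[of e j] by metis
  hence K: "?K = {0\<^sub>v e}" using K by blast
  have "VectorSpace.subspace class_ring ?I (module_vec TYPE(complex) d)"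
  proof (rule subspace_vecI)
    show "0\<^sub>v d \<in> ?I" using T by (auto intro!: exI[of _ "0\<^sub>v e"])
    show "v + w \<in> ?I" if vw: "v \<in> ?I" "w \<in> ?I" for v w
    proof -
      obtain a b where "v = T *\<^sub>v a" "w = T *\<^sub>v b" "a \<in> carrier_vec e" "b \<in> carrier_vec e"
        using vw by auto
      thus ?thesis using T by (auto intro!: exI[of _ "a + b"] simp: mult_add_distrib_mat_vec)
    qed
    show "c \<cdot>\<^sub>v v \<in> ?I" if v: "v \<in> ?I" for c v
    proof -
      obtain a where "v = T *\<^sub>v a" "a \<in> carrier_vec e" using v by auto
      thus ?thesis using T by (auto intro!: exI[of _ "c \<cdot>\<^sub>v a"] simp: mult_mat_vec)
    qed
  qed (use T in auto)
  moreover have "\<rho> g *\<^sub>v v \<in> ?I" if g: "g \<in> carrier G" and v: "v \<in> ?I" for g v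
  proof -
    obtain a where a: "v = T *\<^sub>v a" "a \<in> carrier_vec e" using v by auto
    have "\<rho> g *\<^sub>v v = (\<rho> g * T) *\<^sub>v a"
      using T rc[OF g] a by (simp add: assoc_mult_mat_vec[of _ d d _ e])
    also have "\<dots> = T *\<^sub>v (\<sigma> g *\<^sub>v a)"
      unfolding tw[OF g] using T rc[OF g] a by (auto simp: assoc_mult_mat_vec[of _ d e _ e])
    finally show ?thesis using a rc[OF g] by auto
  qed
  ultimately have "?I = {0\<^sub>v d} \<or> ?I = carrier_vec d"
    using \<rho> by (auto simp: irreducible_representation_def)
  moreover have "?I \<noteq> {0\<^sub>v d}" using nz by (metis (mono_tags, lifting) mem_Collect_eq singletonD unit_vec_carrier)
  ultimately have I: "?I = carrier_vec d" by blast
  have "\<forall>i. \<exists>u. u \<in> carrier_vec e \<and> T *\<^sub>v u = unit_vec d i"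
  proof
    fix i
    have "unit_vec d i \<in> ?I" unfolding I by simp
    then obtain u where "unit_vec d i = T *\<^sub>v u" "u \<in> carrier_vec e" by blast
    thus "\<exists>u. u \<in> carrier_vec e \<and> T *\<^sub>v u = unit_vec d i" by metis
  qed
  then obtain u where u: "\<And>i. u i \<in> carrier_vec e" "\<And>i. T *\<^sub>v u i = unit_vec d i" by metis
  define U where "U = mat e d (\<lambda>(i, j). u j $ i)"
  have U: "U \<in> carrier_mat e d" by (simp add: U_def)
  have colU: "col U j = u j" if "j < d" for j
    using u(1)[of j] that by (auto simp: U_def)
  have TU: "T * U = 1\<^sub>m d"
  proof (rule eq_matI)
    fix i j assume "i < dim_row (1\<^sub>m d :: complex mat)" "j < dim_col (1\<^sub>m d :: complex mat)"
    hence ij: "i < d" "j < d" by auto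
    have "(T * U) $$ (i, j) = (T *\<^sub>v u j) $ i" using T U ij colU by auto
    thus "(T * U) $$ (i, j) = 1\<^sub>m d $$ (i, j)" using ij by (simp add: u(2))
  qed (use T U in auto)
  have "U * T = 1\<^sub>m e"
  proof (rule mat_col_eqI)
    fix j assume "j < dim_col (1\<^sub>m e :: complex mat)"
    hence j: "j < e" by simp
    have cT: "col T j \<in> carrier_vec d" using T by auto
    have UcT: "U *\<^sub>v col T j \<in> carrier_vec e" using U cT by auto
    have Te: "T *\<^sub>v unit_vec e j = col T j" using T j by (intro eq_vecI) auto
    have "T *\<^sub>v (U *\<^sub>v col T j - unit_vec e j) = T *\<^sub>v (U *\<^sub>v col T j) - T *\<^sub>v unit_vec e j"
      by (rule mult_minus_distrib_mat_vec[OF T(1) UcT]) auto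
    also have "T *\<^sub>v (U *\<^sub>v col T j) = (T * U) *\<^sub>v col T j"
      using T U cT by (simp add: assoc_mult_mat_vec[of _ d e _ d])
    also have "\<dots> = col T j" unfolding TU using cT by simp
    finally have "U *\<^sub>v col T j - unit_vec e j \<in> ?K" using UcT cT by (simp add: Te)
    hence z: "U *\<^sub>v col T j - unit_vec e j = 0\<^sub>v e" using K by blast
    have "U *\<^sub>v col T j = unit_vec e j"
    proof (rule eq_vecI)
      fix i assume "i < dim_vec (unit_vec e j :: complex vec)"
      hence i: "i < e" by simp
      have "(U *\<^sub>v col T j - unit_vec e j) $ i = 0" using z i by simp
      thus "(U *\<^sub>v col T j) $ i = unit_vec e j $ i" using i UcT by auto
    qed (use UcT U in auto)
    moreover have "col (U * T) j = U *\<^sub>v col T j" by (rule eq_vecI) (use U T j in auto)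
    ultimately show "col (U * T) j = col (1\<^sub>m e) j" using j by simp
  qed (use U T in auto)
  thus ?thesis using U TU by blast
qed

text \<open>
  Subtracting an eigenvalue leaves an intertwiner that is not injective, hence zero.
\<close>

lemma schur_scalar:
  assumes G: "group G" and \<rho>: "irreducible_representation G d \<rho>"
    and T: "T \<in> carrier_mat d d"
    and tw: "\<And>h. h \<in> carrier G \<Longrightarrow> \<rho> h * T = T * \<rho> h"
  shows "\<exists>c. T = c \<cdot>\<^sub>m 1\<^sub>m d"
proof -
  have rep: "representation G d \<rho>" and d: "d > 0"
    using \<rho> by (auto simp: irreducible_representation_def)
  have "\<not> constant (poly (char_poly T))"
    using degree_monic_char_poly[OF T] d by (simp add: constant_degree)
  then obtain c where "eigenvalue T c"
    using fundamental_theorem_of_algebra eigenvalue_root_char_poly[OF T] by blast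
  then obtain v where v: "v \<in> carrier_vec d" "v \<noteq> 0\<^sub>v d" "T *\<^sub>v v = c \<cdot>\<^sub>v v"
    using T by (auto simp: eigenvalue_def eigenvector_def)
  define S where "S = T - c \<cdot>\<^sub>m 1\<^sub>m d"
  have S: "S \<in> carrier_mat d d" unfolding S_def by (rule minus_carrier_mat) simp
  have "S = 0\<^sub>m d d"
  proof (rule ccontr)
    assume nz: "S \<noteq> 0\<^sub>m d d"
    have "\<rho> h * S = S * \<rho> h" if h: "h \<in> carrier G" for h
    proof -
      have r: "\<rho> h \<in> carrier_mat d d" by (rule representationD(1)[OF G rep h])
      show ?thesis unfolding S_def
        using mult_minus_distrib_mat[OF r T, of "c \<cdot>\<^sub>m 1\<^sub>m d"] minus_mult_distrib_mat[OF T _ r, of "c \<cdot>\<^sub>m 1\<^sub>m d"]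
          r tw[OF h] by auto
    qed
    from schur_invertible[OF G \<rho> \<rho> S nz this] obtain U
      where U: "U \<in> carrier_mat d d" "U * S = 1\<^sub>m d" by blast
    have "S *\<^sub>v v = T *\<^sub>v v - (c \<cdot>\<^sub>m 1\<^sub>m d) *\<^sub>v v"
      unfolding S_def by (rule minus_mult_distrib_mat_vec[OF T _ v(1)]) auto
    also have "\<dots> = 0\<^sub>v d" using v by auto
    finally have "S *\<^sub>v v = 0\<^sub>v d" .
    hence "(U * S) *\<^sub>v v = 0\<^sub>v d"
      unfolding assoc_mult_mat_vec[OF U(1) S v(1)] using U(1) by (auto intro!: eq_vecI)
    thus False using U v by simp
  qed
  have "T = c \<cdot>\<^sub>m 1\<^sub>m d"
  proof (rule eq_matI)
    fix i j assume "i < dim_row (c \<cdot>\<^sub>m 1\<^sub>m d)" "j < dim_col (c \<cdot>\<^sub>m 1\<^sub>m d)"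
    hence ij: "i < d" "j < d" by auto
    have "S $$ (i, j) = 0" using \<open>S = 0\<^sub>m d d\<close> ij by simp
    thus "T $$ (i, j) = (c \<cdot>\<^sub>m 1\<^sub>m d) $$ (i, j)" using ij T by (simp add: S_def)
  qed (use T in auto)
  thus ?thesis ..
qed

lemma mat_trace_eq: "A \<in> carrier_mat d d \<Longrightarrow> mat_trace A = (\<Sum>i<d. A $$ (i, i))"
  by (auto simp: mat_trace_def)

lemma mat_trace_comm:
  fixes A B :: "'a::comm_semiring_0 mat"
  assumes A: "A \<in> carrier_mat d e" and B: "B \<in> carrier_mat e d"
  shows "mat_trace (A * B) = mat_trace (B * A)"
proof -
  have "mat_trace (A * B) = (\<Sum>i<d. \<Sum>k<e. A $$ (i, k) * B $$ (k, i))"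
    unfolding mat_trace_eq[OF mult_carrier_mat[OF A B]]
    by (intro sum.cong refl mat_mult_entry[OF A B]) auto
  also have "\<dots> = (\<Sum>k<e. \<Sum>i<d. B $$ (k, i) * A $$ (i, k))"
    by (subst sum.swap) (simp add: mult.commute)
  also have "\<dots> = mat_trace (B * A)"
    unfolding mat_trace_eq[OF mult_carrier_mat[OF B A]]
    by (intro sum.cong refl mat_mult_entry[OF B A, symmetric]) auto
  finally show ?thesis .
qed

section \<open>Orthogonality of irreducible characters\<close>

definition char_inner :: "('g, 'b) monoid_scheme \<Rightarrow> ('g \<Rightarrow> complex) \<Rightarrow> ('g \<Rightarrow> complex) \<Rightarrow> complex" where
  "char_inner G \<chi> \<xi> = (\<Sum>g\<in>carrier G. \<chi> g * \<xi> (inv\<^bsub>G\<^esub> g)) / of_nat (card (carrier G))"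

text \<open>
  The average over the group of \<open>\<rho>(g) E \<sigma>(g\<inverse>)\<close> for the matrix unit \<open>E\<close> at \<open>(j, k)\<close>, up to the factor
  \<open>1 / |G|\<close>. Averaging makes any matrix an intertwiner.
\<close>

definition schur_avg where
  "schur_avg G d e \<rho> \<sigma> j k =
     mat d e (\<lambda>(i, l). \<Sum>g\<in>carrier G. \<rho> g $$ (i, j) * \<sigma> (inv\<^bsub>G\<^esub> g) $$ (k, l) :: complex)"

lemma schur_avg_intertwines:
  assumes G: "group G" and \<rho>: "representation G d \<rho>" and \<sigma>: "representation G e \<sigma>"
    and jk: "j < d" "k < e" and h: "h \<in> carrier G"
  shows "\<rho> h * schur_avg G d e \<rho> \<sigma> j k = schur_avg G d e \<rho> \<sigma> j k * \<sigma> h"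
proof (rule eq_matI)
  interpret group G by fact
  let ?T = "schur_avg G d e \<rho> \<sigma> j k"
  have T: "?T \<in> carrier_mat d e" by (simp add: schur_avg_def)
  have r: "\<And>g. g \<in> carrier G \<Longrightarrow> \<rho> g \<in> carrier_mat d d"
     "\<And>g. g \<in> carrier G \<Longrightarrow> \<sigma> g \<in> carrier_mat e e"
    using representationD(1)[OF G \<rho>] representationD(1)[OF G \<sigma>] by auto
  fix i l assume "i < dim_row (?T * \<sigma> h)" "l < dim_col (?T * \<sigma> h)"
  hence il: "i < d" "l < e" using T r(2)[OF h] by auto
  have "(\<rho> h * ?T) $$ (i, l) = (\<Sum>m<d. \<rho> h $$ (i, m) * (\<Sum>g\<in>carrier G. \<rho> g $$ (m, j) * \<sigma> (inv\<^bsub>G\<^esub> g) $$ (k, l)))"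
    unfolding mat_mult_entry[OF r(1)[OF h] T il] using il by (simp add: schur_avg_def)
  also have "\<dots> = (\<Sum>g\<in>carrier G. (\<Sum>m<d. \<rho> h $$ (i, m) * \<rho> g $$ (m, j)) * \<sigma> (inv\<^bsub>G\<^esub> g) $$ (k, l))"
    unfolding sum_distrib_left sum_distrib_right by (subst sum.swap) (simp add: mult.assoc)
  also have "\<dots> = (\<Sum>g\<in>carrier G. \<rho> (h \<otimes>\<^bsub>G\<^esub> g) $$ (i, j) * \<sigma> (inv\<^bsub>G\<^esub> g) $$ (k, l))"
    using representationD(2)[OF G \<rho> h] il jk h
    by (intro sum.cong refl) (simp add: mat_mult_entry[OF r(1) r(1)])
  also have "\<dots> = (\<Sum>g\<in>carrier G. \<rho> g $$ (i, j) * \<sigma> (inv\<^bsub>G\<^esub> g \<otimes>\<^bsub>G\<^esub> h) $$ (k, l))"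
    by (rule sum.reindex_bij_witness[of _ "\<lambda>g. inv\<^bsub>G\<^esub> h \<otimes>\<^bsub>G\<^esub> g" "\<lambda>g. h \<otimes>\<^bsub>G\<^esub> g"])
       (use h in \<open>auto simp: m_assoc[symmetric] inv_mult_group\<close>, simp add: m_assoc)
  also have "\<dots> = (\<Sum>g\<in>carrier G. \<rho> g $$ (i, j) * (\<Sum>m<e. \<sigma> (inv\<^bsub>G\<^esub> g) $$ (k, m) * \<sigma> h $$ (m, l)))"
    using representationD(2)[OF G \<sigma> _ h] il jk h
    by (intro sum.cong refl) (simp add: mat_mult_entry[OF r(2) r(2)])
  also have "\<dots> = (\<Sum>m<e. (\<Sum>g\<in>carrier G. \<rho> g $$ (i, j) * \<sigma> (inv\<^bsub>G\<^esub> g) $$ (k, m)) * \<sigma> h $$ (m, l))"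
    unfolding sum_distrib_left sum_distrib_right by (subst sum.swap) (simp add: mult.assoc)
  also have "\<dots> = (?T * \<sigma> h) $$ (i, l)"
    unfolding mat_mult_entry[OF T r(2)[OF h] il] using il by (simp add: schur_avg_def)
  finally show "(\<rho> h * ?T) $$ (i, l) = (?T * \<sigma> h) $$ (i, l)" .
qed (use representationD(1)[OF G \<rho> h] representationD(1)[OF G \<sigma> h] in \<open>auto simp: schur_avg_def\<close>)

lemma char_inner_schur_avg:
  assumes G: "group G" and \<rho>: "representation G d \<rho>" and \<sigma>: "representation G e \<sigma>"
  shows "(\<Sum>g\<in>carrier G. rep_character G \<rho> g * rep_character G \<sigma> (inv\<^bsub>G\<^esub> g)) =
    (\<Sum>i<d. \<Sum>k<e. schur_avg G d e \<rho> \<sigma> i k $$ (i, k))"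
proof -
  interpret group G by fact
  have "(\<Sum>g\<in>carrier G. rep_character G \<rho> g * rep_character G \<sigma> (inv\<^bsub>G\<^esub> g)) =
      (\<Sum>g\<in>carrier G. \<Sum>i<d. \<Sum>k<e. \<rho> g $$ (i, i) * \<sigma> (inv\<^bsub>G\<^esub> g) $$ (k, k))"
    by (intro sum.cong refl)
       (simp add: rep_character_def mat_trace_eq[OF representationD(1)[OF G \<rho>]]
          mat_trace_eq[OF representationD(1)[OF G \<sigma>]] sum_product)
  also have "\<dots> = (\<Sum>i<d. \<Sum>g\<in>carrier G. \<Sum>k<e. \<rho> g $$ (i, i) * \<sigma> (inv\<^bsub>G\<^esub> g) $$ (k, k))"
    by (rule sum.swap)
  also have "\<dots> = (\<Sum>i<d. \<Sum>k<e. \<Sum>g\<in>carrier G. \<rho> g $$ (i, i) * \<sigma> (inv\<^bsub>G\<^esub> g) $$ (k, k))"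
    by (intro sum.cong refl sum.swap)
  also have "\<dots> = (\<Sum>i<d. \<Sum>k<e. schur_avg G d e \<rho> \<sigma> i k $$ (i, k))"
    by (intro sum.cong refl) (simp add: schur_avg_def)
  finally show ?thesis .
qed

text \<open>
  Schur's lemma determines all averages: they vanish unless the characters agree, and for one
  irreducible representation they are scalars that the trace identifies.
\<close>

theorem irr_characters_orthonormal:
  assumes G: "group G" and fin: "finite (carrier G)"
    and \<chi>: "\<chi> \<in> irr_characters G" and \<xi>: "\<xi> \<in> irr_characters G"
  shows "char_inner G \<chi> \<xi> = (if \<chi> = \<xi> then 1 else 0)"
proof -
  interpret group G by fact
  let ?n = "of_nat (card (carrier G)) :: complex"
  have n0: "?n \<noteq> 0" using fin one_closed by (auto simp: card_eq_0_iff)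
  obtain d \<rho> where \<rho>: "irreducible_representation G d \<rho>" "\<chi> = rep_character G \<rho>"
    using \<chi> by (auto simp: irr_characters_def)
  have rr: "representation G d \<rho>" and d: "d > 0" using \<rho> by (auto simp: irreducible_representation_def)
  show ?thesis
  proof (cases "\<chi> = \<xi>")
    case True
    have diag: "schur_avg G d d \<rho> \<rho> j k $$ (j, k) = (if j = k then ?n / of_nat d else 0)"
      if jk: "j < d" "k < d" for j k
    proof -
      let ?T = "schur_avg G d d \<rho> \<rho> j k"
      have T: "?T \<in> carrier_mat d d" by (simp add: schur_avg_def)
      obtain c where c: "?T = c \<cdot>\<^sub>m 1\<^sub>m d"
        using schur_scalar[OF G \<rho>(1) T schur_avg_intertwines[OF G rr rr jk]] by blast
      have "of_nat d * c = mat_trace ?T" unfolding mat_trace_eq[OF T] by (simp add: c)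
      also have "\<dots> = (\<Sum>i<d. \<Sum>g\<in>carrier G. \<rho> g $$ (i, j) * \<rho> (inv\<^bsub>G\<^esub> g) $$ (k, i))"
        unfolding mat_trace_eq[OF T] by (simp add: schur_avg_def)
      also have "\<dots> = (\<Sum>g\<in>carrier G. \<Sum>i<d. \<rho> (inv\<^bsub>G\<^esub> g) $$ (k, i) * \<rho> g $$ (i, j))"
        by (subst sum.swap) (simp add: mult.commute)
      also have "\<dots> = (\<Sum>g\<in>carrier G. (\<rho> (inv\<^bsub>G\<^esub> g) * \<rho> g) $$ (k, j))"
        using jk representationD(1)[OF G rr]
        by (intro sum.cong refl) (simp add: mat_mult_entry[of _ d d _ d])
      also have "\<dots> = (\<Sum>g\<in>carrier G. if j = k then 1 else 0)"
        using jk representationD(2)[OF G rr, symmetric] representationD(3)[OF G rr]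
        by (intro sum.cong refl) auto
      finally have "of_nat d * c = (if j = k then ?n else 0)" by simp
      hence "c = (if j = k then ?n / of_nat d else 0)" using d by (auto simp: field_simps)
      moreover have "?T $$ (j, k) = (if j = k then c else 0)" using jk by (simp add: c)
      ultimately show ?thesis by simp
    qed
    have "(\<Sum>i<d. \<Sum>k<d. schur_avg G d d \<rho> \<rho> i k $$ (i, k)) = (\<Sum>i<d. \<Sum>k<d. if i = k then ?n / of_nat d else 0)"
      by (intro sum.cong refl) (simp add: diag)
    also have "\<dots> = ?n" using d by simp
    finally show ?thesis
      using True n0 char_inner_schur_avg[OF G rr rr] by (simp add: char_inner_def \<rho>(2))
  next
    case False
    obtain e \<sigma> where \<sigma>: "irreducible_representation G e \<sigma>" "\<xi> = rep_character G \<sigma>"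
      using \<xi> by (auto simp: irr_characters_def)
    have rs: "representation G e \<sigma>" using \<sigma> by (auto simp: irreducible_representation_def)
    have "schur_avg G d e \<rho> \<sigma> j k = 0\<^sub>m d e" if jk: "j < d" "k < e" for j k
    proof (rule ccontr)
      let ?T = "schur_avg G d e \<rho> \<sigma> j k"
      assume nz: "?T \<noteq> 0\<^sub>m d e"
      have T: "?T \<in> carrier_mat d e" by (simp add: schur_avg_def)
      note tw = schur_avg_intertwines[OF G rr rs jk]
      from schur_invertible[OF G \<rho>(1) \<sigma>(1) T nz tw] obtain U
        where U: "U \<in> carrier_mat e d" "?T * U = 1\<^sub>m d" "U * ?T = 1\<^sub>m e" by blast
      \<comment> \<open>An invertible intertwiner makes the two representations similar.\<close>
      have "mat_trace (\<rho> g) = mat_trace (\<sigma> g)" if g: "g \<in> carrier G" for g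
      proof -
        have r: "\<rho> g \<in> carrier_mat d d" "\<sigma> g \<in> carrier_mat e e"
          using representationD(1)[OF G rr g] representationD(1)[OF G rs g] by auto
        have "\<rho> g = (\<rho> g * ?T) * U" using U r T by (simp add: assoc_mult_mat[of _ d d _ e _ d])
        hence "mat_trace (\<rho> g) = mat_trace (U * (\<rho> g * ?T))"
          using mat_trace_comm[OF mult_carrier_mat[OF r(1) T] U(1)] by simp
        also have "U * (\<rho> g * ?T) = (U * ?T) * \<sigma> g"
          unfolding tw[OF g] by (rule assoc_mult_mat[OF U(1) T r(2), symmetric])
        finally show ?thesis using U r by simp
      qed
      hence "\<chi> = \<xi>" unfolding \<rho>(2) \<sigma>(2) rep_character_def by (auto intro!: restrict_ext)
      thus False using False by simp
    qed
    hence "(\<Sum>i<d. \<Sum>k<e. schur_avg G d e \<rho> \<sigma> i k $$ (i, k)) = 0" by simp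
    thus ?thesis
      using False char_inner_schur_avg[OF G rr rs] by (simp add: char_inner_def \<rho>(2) \<sigma>(2))
  qed
qed

section \<open>Extending linear characters\<close>

lemma linear_character_on_iff:
  "linear_character (G\<lparr>carrier := H\<rparr>) \<kappa> \<longleftrightarrow>
     \<kappa> \<in> extensional H \<and> (\<forall>x\<in>H. \<kappa> x \<noteq> 0) \<and> (\<forall>x\<in>H. \<forall>y\<in>H. \<kappa> (x \<otimes>\<^bsub>G\<^esub> y) = \<kappa> x * \<kappa> y)"
proof -
  have U: "carrier (units_of class_ring) = {z::complex. z \<noteq> 0}"
  proof -
    have "\<exists>y. y * z = 1 \<and> z * y = 1" if "z \<noteq> 0" for z :: complex
      using that by (intro exI[of _ "inverse z"]) simp
    moreover have "z \<noteq> 0" if "y * z = 1" for y z :: complex using that by auto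
    ultimately show ?thesis by (auto simp: units_of_def Units_def)
  qed
  show ?thesis by (auto simp: linear_character_def hom_def U Pi_def) (auto simp: units_of_def)
qed

lemma exists_root_ne_1:
  assumes "m \<ge> 2" "z \<noteq> (0::complex)"
  shows "\<exists>w. w ^ m = z \<and> w \<noteq> 1"
proof (cases "z = 1")
  case True
  have "card {w::complex. w ^ m = 1} = m" using assms by (intro card_roots_unity_eq) auto
  hence "\<not> {w::complex. w ^ m = 1} \<subseteq> {1}"
    using assms card_mono[of "{1::complex}" "{w::complex. w ^ m = 1}"] by auto
  thus ?thesis using True by auto
next
  case False
  have "(rcis (root m (cmod z)) (Arg z / m)) ^ m = z"
    using assms by (simp add: DeMoivre2 rcis_cmod_Arg)
  moreover have "w \<noteq> 1" if "w ^ m = z" for w :: complex using that False by auto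
  ultimately show ?thesis by blast
qed

locale finite_group = group +
  assumes fin: "finite (carrier G)"
begin

lemma mult_closed_subgroup:
  assumes "S \<subseteq> carrier G" "S \<noteq> {}" "\<And>a b. a \<in> S \<Longrightarrow> b \<in> S \<Longrightarrow> a \<otimes> b \<in> S"
  shows "subgroup S G"
proof (rule subgroupI)
  fix a assume a: "a \<in> S"
  have ac: "a \<in> carrier G" using a assms by auto
  have pw: "a [^] Suc k \<in> S" for k
    by (induction k) (use a ac assms in \<open>auto simp: nat_pow_Suc\<close>)
  have "Coset.order G > 0" using fin one_closed by (auto simp: Coset.order_def card_gt_0_iff)
  then obtain N where N: "Coset.order G = Suc N" by (cases "Coset.order G") auto
  have "a [^] N \<otimes> a = \<one>" using pow_order_eq_1[OF ac] N by simp
  hence iv: "inv a = a [^] N" using ac by (intro inv_equality) auto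
  show "inv a \<in> S"
  proof (cases N)
    case 0
    hence "a = \<one>" using \<open>a [^] N \<otimes> a = \<one>\<close> ac by simp
    thus ?thesis using a by simp
  next
    case (Suc M)
    thus ?thesis using pw[of M] iv by simp
  qed
qed (use assms in auto)

text \<open>
  One cyclic step of the extension: if \<open>m\<close> is the least positive exponent with \<open>x\<^sup>m \<in> H\<close>, the
  value at \<open>x\<close> may be any \<open>m\<close>-th root of \<open>\<kappa> (x\<^sup>m)\<close>, and \<open>m \<ge> 2\<close> leaves a root different from 1.
\<close>

lemma linear_character_adjoin:
  assumes H: "subgroup H G" and \<kappa>: "linear_character (G\<lparr>carrier := H\<rparr>) \<kappa>"
    and x: "x \<in> carrier G" "x \<notin> H"
    and comm: "\<And>h. h \<in> H \<Longrightarrow> \<exists>h'\<in>H. x \<otimes> h = h' \<otimes> x \<and> \<kappa> h' = \<kappa> h"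
  shows "\<exists>H' \<kappa>'. subgroup H' G \<and> H \<subseteq> H' \<and> x \<in> H' \<and> H' = {h \<otimes> x [^] (i::nat) |h i. h \<in> H} \<and>
    linear_character (G\<lparr>carrier := H'\<rparr>) \<kappa>' \<and> (\<forall>h\<in>H. \<kappa>' h = \<kappa> h) \<and> \<kappa>' x \<noteq> 1"
proof -
  have HG: "h \<in> carrier G" if "h \<in> H" for h using subgroup.subset[OF H] that by auto
  have mH: "h \<otimes> k \<in> H" if "h \<in> H" "k \<in> H" for h k using subgroup.m_closed[OF H] that by auto
  have iH: "inv h \<in> H" if "h \<in> H" for h using subgroup.m_inv_closed[OF H] that by auto
  have \<kappa>m: "\<kappa> (h \<otimes> k) = \<kappa> h * \<kappa> k" if "h \<in> H" "k \<in> H" for h k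
    using \<kappa> that by (auto simp: linear_character_on_iff)
  have \<kappa>0: "\<kappa> h \<noteq> 0" if "h \<in> H" for h using \<kappa> that by (auto simp: linear_character_on_iff)
  have oneH: "\<one> \<in> H" by (rule subgroup.one_closed[OF H])
  have \<kappa>1: "\<kappa> \<one> = 1" using \<kappa>m[OF oneH oneH] \<kappa>0[OF oneH] by simp
  have pwH: "h [^] (k::nat) \<in> H \<and> \<kappa> (h [^] k) = \<kappa> h ^ k" if "h \<in> H" for h k
    by (induction k) (use that oneH \<kappa>1 mH \<kappa>m in auto)
  have comm': "\<exists>h'\<in>H. x [^] i \<otimes> h = h' \<otimes> x [^] i \<and> \<kappa> h' = \<kappa> h" if "h \<in> H" for h and i :: nat
  proof (induction i)
    case 0 show ?case using that HG by (auto intro!: bexI[of _ h])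
  next
    case (Suc i)
    then obtain l where l: "l \<in> H" "x [^] i \<otimes> h = l \<otimes> x [^] i" "\<kappa> l = \<kappa> h" by blast
    from comm[OF l(1)] obtain l' where l': "l' \<in> H" "x \<otimes> l = l' \<otimes> x" "\<kappa> l' = \<kappa> l" by blast
    have "x [^] Suc i \<otimes> h = x \<otimes> (x [^] i \<otimes> h)" using x that HG by (simp only: nat_pow_Suc2 m_assoc nat_pow_closed)
    also have "\<dots> = (x \<otimes> l) \<otimes> x [^] i" unfolding l(2) using x l HG by (simp add: m_assoc)
    also have "\<dots> = l' \<otimes> x [^] Suc i" unfolding l'(2) using x l' HG by (simp only: nat_pow_Suc2 m_assoc nat_pow_closed)
    finally show ?case using l l' by auto
  qed
  have ex: "\<exists>k::nat. k > 0 \<and> x [^] k \<in> H"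
    using pow_order_eq_1[OF x(1)] oneH fin one_closed
    by (intro exI[of _ "Coset.order G"]) (auto simp: Coset.order_def card_gt_0_iff)
  define m where "m = (LEAST k::nat. k > 0 \<and> x [^] k \<in> H)"
  have m: "m > 0" "x [^] m \<in> H" using LeastI_ex[OF ex] by (auto simp: m_def)
  have mmin: "m \<le> k" if "k > 0" "x [^] k \<in> H" for k using that by (auto simp: m_def intro: Least_le)
  have "m \<noteq> 1" using m x by auto
  then obtain w where w: "w ^ m = \<kappa> (x [^] m)" "w \<noteq> 1"
    using exists_root_ne_1[of m "\<kappa> (x [^] m)"] m \<kappa>0 by auto
  have xk: "\<kappa> (x [^] k) = w ^ k" if k: "x [^] k \<in> H" for k :: nat
  proof -
    have e: "x [^] k = (x [^] m) [^] (k div m) \<otimes> x [^] (k mod m)"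
      using x by (simp add: nat_pow_pow nat_pow_mult)
    have p: "(x [^] m) [^] (k div m) \<in> H" "\<kappa> ((x [^] m) [^] (k div m)) = w ^ (m * (k div m))"
      using pwH[OF m(2), of "k div m"] w by (auto simp: power_mult)
    have "x [^] (k mod m) = inv ((x [^] m) [^] (k div m)) \<otimes> x [^] k"
      unfolding e using x by (simp add: m_assoc[symmetric])
    hence "x [^] (k mod m) \<in> H" using mH iH p k by simp
    hence "k mod m = 0" using mmin[of "k mod m"] m by (metis gr0I mod_less_divisor not_le)
    hence "x [^] k = (x [^] m) [^] (k div m)" "m * (k div m) = k" using e x by auto
    thus ?thesis using p(2) by simp
  qed
  have w0: "w \<noteq> 0" using w(1) m \<kappa>0[OF m(2)] by (metis power_0_left not_gr_zero)
  have le: "\<kappa> h * w ^ i = \<kappa> k * w ^ j"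
    if "h \<in> H" "k \<in> H" "h \<otimes> x [^] i = k \<otimes> x [^] j" "i \<le> j" for h k and i j :: nat
  proof -
    have "k \<otimes> x [^] (j - i) \<otimes> x [^] i = h \<otimes> x [^] i"
      using that x HG by (simp add: m_assoc nat_pow_mult)
    hence e: "k \<otimes> x [^] (j - i) = h" using x that HG by (metis m_closed nat_pow_closed right_cancel)
    hence e2: "x [^] (j - i) = inv k \<otimes> h" using x that HG by (metis inv_solve_left nat_pow_closed)
    hence "x [^] (j - i) \<in> H" using mH iH that by simp
    hence "\<kappa> h = \<kappa> k * w ^ (j - i)" using \<kappa>m[OF that(2), of "x [^] (j - i)"] xk e by simp
    thus ?thesis using that(4) by (simp add: power_add[symmetric])
  qed
  have wd: "\<kappa> h * w ^ i = \<kappa> k * w ^ j"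
    if "h \<in> H" "k \<in> H" "h \<otimes> x [^] i = k \<otimes> x [^] j" for h k and i j :: nat
    using le[OF that] le[OF that(2,1) that(3)[symmetric]] by (cases "i \<le> j") auto
  \<comment> \<open>The extension sends \<open>h x\<^sup>i\<close> to \<open>\<kappa>(h) w\<^sup>i\<close>, which does not depend on the chosen expression.\<close>
  define H' where "H' = {h \<otimes> x [^] (i::nat) |h i. h \<in> H}"
  define \<kappa>' where "\<kappa>' = (\<lambda>y\<in>H'. THE c. \<exists>h\<in>H. \<exists>i::nat. y = h \<otimes> x [^] i \<and> c = \<kappa> h * w ^ i)"
  have \<kappa>': "\<kappa>' (h \<otimes> x [^] i) = \<kappa> h * w ^ i" if "h \<in> H" for h and i :: nat
  proof -
    have "h \<otimes> x [^] i \<in> H'" using that by (auto simp: H'_def)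
    moreover have "(THE c. \<exists>k\<in>H. \<exists>j::nat. h \<otimes> x [^] i = k \<otimes> x [^] j \<and> c = \<kappa> k * w ^ j) = \<kappa> h * w ^ i"
      by (rule the_equality) (use that wd in metis)+
    ultimately show ?thesis by (simp add: \<kappa>'_def)
  qed
  have mul: "\<exists>l\<in>H. (h \<otimes> x [^] i) \<otimes> (k \<otimes> x [^] j) = l \<otimes> x [^] (i + j) \<and> \<kappa> l = \<kappa> h * \<kappa> k"
    if "h \<in> H" "k \<in> H" for h k and i j :: nat
  proof -
    from comm'[OF that(2)] obtain k'
      where k': "k' \<in> H" "x [^] i \<otimes> k = k' \<otimes> x [^] i" "\<kappa> k' = \<kappa> k" by blast
    have "(h \<otimes> x [^] i) \<otimes> (k \<otimes> x [^] j) = h \<otimes> (x [^] i \<otimes> k) \<otimes> x [^] j"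
      using that HG x by (simp add: m_assoc)
    also have "\<dots> = (h \<otimes> k') \<otimes> x [^] (i + j)"
      unfolding k' using that k' HG x by (simp add: m_assoc nat_pow_mult)
    finally show ?thesis using k' mH \<kappa>m that by (intro bexI[of _ "h \<otimes> k'"]) auto
  qed
  have HH': "H \<subseteq> H'"
  proof
    fix h assume "h \<in> H"
    moreover have "h = h \<otimes> x [^] (0::nat)" using HG[OF \<open>h \<in> H\<close>] by simp
    ultimately show "h \<in> H'" unfolding H'_def by blast
  qed
  have xe: "x = \<one> \<otimes> x [^] (1::nat)" using x by simp
  hence xH': "x \<in> H'" using oneH unfolding H'_def by blast
  have sub: "subgroup H' G"
  proof (rule mult_closed_subgroup)
    fix a b assume "a \<in> H'" "b \<in> H'"
    then obtain h i k j where ab: "h \<in> H" "k \<in> H" "a = h \<otimes> x [^] (i::nat)" "b = k \<otimes> x [^] (j::nat)"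
      by (auto simp: H'_def)
    obtain l where "l \<in> H" "a \<otimes> b = l \<otimes> x [^] (i + j)" using mul[OF ab(1,2), of i j] ab(3,4) by auto
    thus "a \<otimes> b \<in> H'" unfolding H'_def by blast
  qed (use HG x xH' in \<open>auto simp: H'_def\<close>)
  have "linear_character (G\<lparr>carrier := H'\<rparr>) \<kappa>'"
    unfolding linear_character_on_iff
  proof (intro conjI ballI)
    fix a assume "a \<in> H'"
    then obtain h i where a: "h \<in> H" "a = h \<otimes> x [^] (i::nat)" by (auto simp: H'_def)
    show "\<kappa>' a \<noteq> 0" unfolding a(2) \<kappa>'[OF a(1)] using \<kappa>0 a w0 by simp
    fix b assume "b \<in> H'"
    then obtain k j where b: "k \<in> H" "b = k \<otimes> x [^] (j::nat)" by (auto simp: H'_def)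
    obtain l where l: "l \<in> H" "a \<otimes> b = l \<otimes> x [^] (i + j)" "\<kappa> l = \<kappa> h * \<kappa> k"
      using mul[OF a(1) b(1), of i j] a b by auto
    show "\<kappa>' (a \<otimes> b) = \<kappa>' a * \<kappa>' b"
      unfolding l(2) \<kappa>'[OF l(1)] unfolding a(2) b(2) \<kappa>'[OF a(1)] \<kappa>'[OF b(1)] l(3)
      by (simp add: power_add)
  qed (auto simp: \<kappa>'_def)
  moreover have "\<kappa>' h = \<kappa> h" if "h \<in> H" for h using \<kappa>'[OF that, of 0] HG[OF that] by simp
  moreover have "\<kappa>' x \<noteq> 1" using \<kappa>'[OF oneH, of 1] x w \<kappa>1 by simp
  ultimately show ?thesis using sub HH' xH' H'_def by blast
qed

text \<open>
  The commutator condition keeps every intermediate character invariant under \<open>A\<close>, so cyclic steps can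
  be repeated until \<open>A\<close> is reached.
\<close>

lemma linear_character_extends:
  assumes A: "subgroup A G" and H: "subgroup H G" and BH: "B \<subseteq> H" "H \<subseteq> A"
    and \<kappa>: "linear_character (G\<lparr>carrier := H\<rparr>) \<kappa>"
    and comm: "\<And>a h. a \<in> A \<Longrightarrow> h \<in> A \<Longrightarrow> \<exists>c\<in>B. a \<otimes> h = c \<otimes> h \<otimes> a \<and> \<kappa> c = 1"
  shows "\<exists>\<kappa>'. linear_character (G\<lparr>carrier := A\<rparr>) \<kappa>' \<and> (\<forall>h\<in>H. \<kappa>' h = \<kappa> h)"
  using H BH \<kappa> comm
proof (induction "card A - card H" arbitrary: H \<kappa> rule: less_induct)
  case less
  have finA: "finite A" using subgroup.subset[OF A] fin finite_subset by auto
  show ?case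
  proof (cases "H = A")
    case True thus ?thesis using less by auto
  next
    case False
    then obtain x where x: "x \<in> A" "x \<notin> H" using less by auto
    have xG: "x \<in> carrier G" using x subgroup.subset[OF A] by auto
    have "\<exists>h'\<in>H. x \<otimes> h = h' \<otimes> x \<and> \<kappa> h' = \<kappa> h" if h: "h \<in> H" for h
    proof -
      have hA: "h \<in> A" using h less.prems by auto
      from less.prems(5)[OF x(1) hA] obtain c where c: "c \<in> B" "x \<otimes> h = c \<otimes> h \<otimes> x" "\<kappa> c = 1" by blast
      have cH: "c \<in> H" using c less.prems by auto
      thus ?thesis using c h less.prems(4) subgroup.m_closed[OF less.prems(1) cH h]
        by (intro bexI[of _ "c \<otimes> h"]) (auto simp: linear_character_on_iff)
    qed
    from linear_character_adjoin[OF less.prems(1,4) xG x(2) this] obtain H' \<kappa>' where H': "subgroup H' G" "H \<subseteq> H'" "x \<in> H'"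
      "H' = {h \<otimes> x [^] (i::nat) |h i. h \<in> H}"
      "linear_character (G\<lparr>carrier := H'\<rparr>) \<kappa>'" "\<And>h. h \<in> H \<Longrightarrow> \<kappa>' h = \<kappa> h"
      by blast
    have xp: "x [^] (i::nat) \<in> A" for i
      by (induction i) (use x subgroup.m_closed[OF A] subgroup.one_closed[OF A] in auto)
    have HA: "H' \<subseteq> A" using H'(4) xp less.prems subgroup.m_closed[OF A] by auto
    have "card H < card H'" using H'(2,3) x finA HA by (intro psubset_card_mono) (auto intro: finite_subset)
    moreover have "card H' \<le> card A" using finA HA by (rule card_mono)
    ultimately have lt: "card A - card H' < card A - card H" by auto
    have c': "\<exists>c\<in>B. a \<otimes> h = c \<otimes> h \<otimes> a \<and> \<kappa>' c = 1" if "a \<in> A" "h \<in> A" for a h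
      using less.prems(5)[OF that] H'(6) less.prems(2) by (metis subsetD)
    obtain \<kappa>'' where "linear_character (G\<lparr>carrier := A\<rparr>) \<kappa>''" "\<forall>h\<in>H'. \<kappa>'' h = \<kappa>' h"
      using less.hyps[OF lt H'(1) _ HA H'(5) c'] less.prems(2) H'(2) by auto
    thus ?thesis using H'(2,6) by (intro exI[of _ \<kappa>'']) auto
  qed
qed

definition lin_exts :: "'a set \<Rightarrow> 'a set \<Rightarrow> ('a \<Rightarrow> complex) \<Rightarrow> ('a \<Rightarrow> complex) set" where
  "lin_exts B A \<kappa> = {\<kappa>'. linear_character (G\<lparr>carrier := A\<rparr>) \<kappa>' \<and> (\<forall>b\<in>B. \<kappa>' b = \<kappa> b)}"

lemma linear_character_values:
  assumes A: "subgroup A G" and \<kappa>: "linear_character (G\<lparr>carrier := A\<rparr>) \<kappa>"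
  shows "\<kappa> \<one> = 1" and "a \<in> A \<Longrightarrow> b \<in> A \<Longrightarrow> \<kappa> (a \<otimes> b) = \<kappa> a * \<kappa> b" and "a \<in> A \<Longrightarrow> \<kappa> a \<noteq> 0"
    and "a \<in> A \<Longrightarrow> \<kappa> (inv a) = inverse (\<kappa> a)" and "a \<in> A \<Longrightarrow> \<kappa> a ^ Coset.order G = 1"
proof -
  note k = \<kappa>[unfolded linear_character_on_iff]
  have one: "\<one> \<in> A" by (rule subgroup.one_closed[OF A])
  have "\<kappa> (\<one> \<otimes> \<one>) = \<kappa> \<one> * \<kappa> \<one>" "\<kappa> \<one> \<noteq> 0" using k one by blast+
  thus k1: "\<kappa> \<one> = 1" by simp
  show m: "\<kappa> (a \<otimes> b) = \<kappa> a * \<kappa> b" if "a \<in> A" "b \<in> A" for a b using k that by blast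
  show nz: "\<kappa> a \<noteq> 0" if "a \<in> A" using k that by blast
  show "\<kappa> (inv a) = inverse (\<kappa> a)" if a: "a \<in> A"
  proof -
    have "a \<in> carrier G" using subgroup.subset[OF A] a by auto
    hence "\<kappa> (inv a) * \<kappa> a = 1" using m[OF subgroup.m_inv_closed[OF A a] a] k1 by simp
    thus ?thesis using k a by (simp add: field_simps)
  qed
  show "\<kappa> a ^ Coset.order G = 1" if a: "a \<in> A"
  proof -
    have "a [^] k \<in> A \<and> \<kappa> (a [^] k) = \<kappa> a ^ k" for k :: nat
      by (induction k) (use a k1 one m subgroup.m_closed[OF A] in auto)
    moreover have "a \<in> carrier G" using subgroup.subset[OF A] a by auto
    ultimately show ?thesis using pow_order_eq_1[of a] k1 by metis
  qed
qed

lemma finite_linear_characters: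
  assumes A: "subgroup A G"
  shows "finite {\<kappa>. linear_character (G\<lparr>carrier := A\<rparr>) \<kappa>}"
proof (rule finite_subset)
  have "Coset.order G > 0" using fin one_closed by (auto simp: Coset.order_def card_gt_0_iff)
  thus "finite (\<Pi>\<^sub>E a\<in>A. {z::complex. z ^ Coset.order G = 1})"
    using subgroup.subset[OF A] fin finite_subset
    by (intro finite_PiE finite_roots_unity) auto
  show "{\<kappa>. linear_character (G\<lparr>carrier := A\<rparr>) \<kappa>} \<subseteq> (\<Pi>\<^sub>E a\<in>A. {z::complex. z ^ Coset.order G = 1})"
  proof
    fix \<kappa> :: "'a \<Rightarrow> complex" assume "\<kappa> \<in> {\<kappa>. linear_character (G\<lparr>carrier := A\<rparr>) \<kappa>}"
    hence k: "linear_character (G\<lparr>carrier := A\<rparr>) \<kappa>" by simp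
    hence "\<kappa> \<in> extensional A" by (simp add: linear_character_on_iff)
    thus "\<kappa> \<in> (\<Pi>\<^sub>E a\<in>A. {z::complex. z ^ Coset.order G = 1})"
      using linear_character_values(5)[OF A k] by (auto simp: PiE_iff)
  qed
qed

lemma sum_nontrivial_linear_character:
  assumes A: "subgroup A G" and m: "\<And>a b. a \<in> A \<Longrightarrow> b \<in> A \<Longrightarrow> \<nu> (a \<otimes> b) = \<nu> a * (\<nu> b :: complex)"
    and b: "b \<in> A" "\<nu> b \<noteq> 1"
  shows "(\<Sum>a\<in>A. \<nu> a) = 0"
proof -
  have AG: "a \<in> carrier G" if "a \<in> A" for a using subgroup.subset[OF A] that by auto
  have "(\<Sum>a\<in>A. \<nu> a) = (\<Sum>a\<in>A. \<nu> (b \<otimes> a))"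
    by (rule sum.reindex_bij_witness[of _ "\<lambda>a. b \<otimes> a" "\<lambda>a. inv b \<otimes> a"])
       (use b A AG in \<open>auto simp: m_assoc[symmetric] subgroup.m_closed subgroup.m_inv_closed\<close>)
  also have "\<dots> = \<nu> b * (\<Sum>a\<in>A. \<nu> a)" using b m by (simp add: sum_distrib_left)
  finally show ?thesis using b by simp
qed

text \<open>
  If \<open>\<kappa>\<close> kills the commutators of \<open>A\<close>, then inducing it from \<open>B\<close> to \<open>A\<close> gives the sum of all
  its linear extensions. Off \<open>B\<close> the sum vanishes because multiplying by a character of \<open>A / B\<close>
  permutes the extensions; the number of extensions follows by summing over \<open>A\<close>.
\<close>

theorem sum_lin_exts:
  assumes A: "subgroup A G" and B: "subgroup B G" "B \<subseteq> A"
    and \<kappa>: "linear_character (G\<lparr>carrier := B\<rparr>) \<kappa>"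
    and comm: "\<And>a h. a \<in> A \<Longrightarrow> h \<in> A \<Longrightarrow> \<exists>c\<in>B. a \<otimes> h = c \<otimes> h \<otimes> a \<and> \<kappa> c = 1"
  shows "finite (lin_exts B A \<kappa>)"
    and "a \<in> A \<Longrightarrow> (\<Sum>\<kappa>'\<in>lin_exts B A \<kappa>. \<kappa>' a) =
      (if a \<in> B then of_nat (card A) / of_nat (card B) * \<kappa> a else 0)"
    and "card (lin_exts B A \<kappa>) * card B = card A"
proof -
  let ?E = "lin_exts B A \<kappa>"
  have AG: "a \<in> carrier G" if "a \<in> A" for a using subgroup.subset[OF A] that by auto
  have finA: "finite A" "finite B" using AG B fin finite_subset by (blast intro: finite_subset)+
  have cB: "card B > 0" using finA subgroup.one_closed[OF B(1)] by (auto simp: card_gt_0_iff)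
  show finE: "finite ?E"
    using finite_linear_characters[OF A] unfolding lin_exts_def by (rule rev_finite_subset) auto
  have lin: "linear_character (G\<lparr>carrier := A\<rparr>) \<kappa>'" if "\<kappa>' \<in> ?E" for \<kappa>'
    using that by (auto simp: lin_exts_def)
  note val = linear_character_values[OF A lin]
  have off: "(\<Sum>\<kappa>'\<in>?E. \<kappa>' a) = 0" if a: "a \<in> A" "a \<notin> B" for a
  proof -
    let ?t = "\<lambda>b\<in>B. 1::complex"
    have t: "linear_character (G\<lparr>carrier := B\<rparr>) ?t"
      using subgroup.m_closed[OF B(1)] by (auto simp: linear_character_on_iff)
    have "\<exists>h'\<in>B. a \<otimes> h = h' \<otimes> a \<and> ?t h' = ?t h" if h: "h \<in> B" for h
    proof -
      have "h \<in> A" using h B by auto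
      from comm[OF a(1) this] obtain c where "c \<in> B" "a \<otimes> h = c \<otimes> h \<otimes> a" by blast
      thus ?thesis using h subgroup.m_closed[OF B(1)] by (intro bexI[of _ "c \<otimes> h"]) auto
    qed
    from linear_character_adjoin[OF B(1) t AG[OF a(1)] a(2) this] obtain H \<nu>' where
      H: "subgroup H G" "B \<subseteq> H" "a \<in> H" "H = {h \<otimes> a [^] (i::nat) |h i. h \<in> B}"
        "linear_character (G\<lparr>carrier := H\<rparr>) \<nu>'" "\<And>h. h \<in> B \<Longrightarrow> \<nu>' h = ?t h" "\<nu>' a \<noteq> 1" by blast
    have "a [^] (i::nat) \<in> A" for i
      by (induction i) (use a subgroup.m_closed[OF A] subgroup.one_closed[OF A] in auto)
    hence HA: "H \<subseteq> A" using H(4) B(2) subgroup.m_closed[OF A] by auto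
    have "\<exists>c\<in>B. a \<otimes> h = c \<otimes> h \<otimes> a \<and> \<nu>' c = 1" if "a \<in> A" "h \<in> A" for a h
      using comm[OF that] H(6) by auto
    from linear_character_extends[OF A H(1,2) HA H(5) this] obtain \<nu>
      where \<nu>: "linear_character (G\<lparr>carrier := A\<rparr>) \<nu>" "\<forall>h\<in>H. \<nu> h = \<nu>' h" by blast
    note n = linear_character_values[OF A \<nu>(1)]
    have nB: "\<nu> b = 1" if "b \<in> B" for b using that H(2,6) \<nu>(2) by auto
    have na: "\<nu> a \<noteq> 1" using H(3,7) \<nu>(2) by auto
    have "(\<Sum>\<kappa>'\<in>?E. \<kappa>' a) = (\<Sum>\<kappa>'\<in>?E. (\<lambda>b\<in>A. \<kappa>' b * \<nu> b) a)"
    proof (rule sum.reindex_bij_witness[of _ "\<lambda>\<kappa>'. (\<lambda>b\<in>A. \<kappa>' b * \<nu> b)" "\<lambda>\<kappa>'. (\<lambda>b\<in>A. \<kappa>' b * inverse (\<nu> b))"])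
      fix \<kappa>' assume k: "\<kappa>' \<in> ?E"
      have ext: "\<kappa>' \<in> extensional A" using lin[OF k] by (simp add: linear_character_on_iff)
      show "(\<lambda>b\<in>A. (\<lambda>b\<in>A. \<kappa>' b * inverse (\<nu> b)) b * \<nu> b) = \<kappa>'"
        using ext n(3) by (intro extensionalityI[of _ A]) auto
      show "(\<lambda>b\<in>A. (\<lambda>b\<in>A. \<kappa>' b * \<nu> b) b * inverse (\<nu> b)) = \<kappa>'"
        using ext n(3) by (intro extensionalityI[of _ A]) auto
      show "(\<lambda>b\<in>A. \<kappa>' b * inverse (\<nu> b)) \<in> ?E"
        using n(2,3) val(2,3)[OF k] k B(2) nB subgroup.m_closed[OF A]
        by (auto simp: lin_exts_def linear_character_on_iff)
      show "(\<lambda>b\<in>A. \<kappa>' b * \<nu> b) \<in> ?E"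
        using n(2,3) val(2,3)[OF k] k B(2) nB subgroup.m_closed[OF A]
        by (auto simp: lin_exts_def linear_character_on_iff)
      show "(\<lambda>b\<in>A. (\<lambda>b\<in>A. \<kappa>' b * inverse (\<nu> b)) b * \<nu> b) a = \<kappa>' a"
        using a n(3) by simp
    qed
    also have "\<dots> = (\<Sum>\<kappa>'\<in>?E. \<kappa>' a) * \<nu> a" using a by (simp add: sum_distrib_right)
    finally show ?thesis using na by simp
  qed
  obtain \<kappa>0 where k0: "\<kappa>0 \<in> ?E"
    using linear_character_extends[OF A B(1) _ B(2) \<kappa> comm] by (auto simp: lin_exts_def)
  have on: "(\<Sum>\<kappa>'\<in>?E. \<kappa>' b) = of_nat (card ?E) * \<kappa> b" if "b \<in> B" for b
  proof -
    have "(\<Sum>\<kappa>'\<in>?E. \<kappa>' b) = (\<Sum>\<kappa>'\<in>?E. \<kappa> b)"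
      by (rule sum.cong) (use that in \<open>auto simp: lin_exts_def\<close>)
    thus ?thesis by simp
  qed
  \<comment> \<open>Pairing all extensions with one of them counts them.\<close>
  have inner: "(\<Sum>a\<in>A. \<kappa>' a * inverse (\<kappa>0 a)) = (if \<kappa>' = \<kappa>0 then of_nat (card A) else 0)" if k: "\<kappa>' \<in> ?E" for \<kappa>'
  proof (cases "\<kappa>' = \<kappa>0")
    case True thus ?thesis using val(3)[OF k0] by simp
  next
    case False
    hence "\<exists>b\<in>A. \<kappa>' b \<noteq> \<kappa>0 b"
      using lin[OF k] lin[OF k0] by (metis extensionalityI linear_character_on_iff)
    then obtain b where b: "b \<in> A" "\<kappa>' b \<noteq> \<kappa>0 b" by blast
    have "(\<Sum>a\<in>A. \<kappa>' a * inverse (\<kappa>0 a)) = 0"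
      by (rule sum_nontrivial_linear_character[OF A _ b(1)])
         (use b val(2,3)[OF k] val(2,3)[OF k0] in \<open>auto simp: field_simps\<close>)
    thus ?thesis using False by simp
  qed
  have "of_nat (card A) = (\<Sum>\<kappa>'\<in>?E. \<Sum>a\<in>A. \<kappa>' a * inverse (\<kappa>0 a))"
    using k0 finE by (simp add: inner)
  also have "\<dots> = (\<Sum>a\<in>A. (\<Sum>\<kappa>'\<in>?E. \<kappa>' a) * inverse (\<kappa>0 a))"
    by (subst sum.swap) (simp add: sum_distrib_right)
  also have "\<dots> = (\<Sum>a\<in>B. (\<Sum>\<kappa>'\<in>?E. \<kappa>' a) * inverse (\<kappa>0 a))"
    by (rule sum.mono_neutral_right) (use B finA off in auto)
  also have "\<dots> = (\<Sum>a\<in>B. of_nat (card ?E))"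
  proof (rule sum.cong[OF refl])
    fix b assume b: "b \<in> B"
    have "\<kappa>0 b = \<kappa> b" "\<kappa>0 b \<noteq> 0" using k0 val(3)[OF k0, of b] B b by (auto simp: lin_exts_def)
    thus "(\<Sum>\<kappa>'\<in>?E. \<kappa>' b) * inverse (\<kappa>0 b) = of_nat (card ?E)" by (simp add: on[OF b])
  qed
  finally have "complex_of_nat (card A) = of_nat (card ?E * card B)" by simp
  thus card: "card ?E * card B = card A" by (metis of_nat_eq_iff)
  show "(\<Sum>\<kappa>'\<in>?E. \<kappa>' a) = (if a \<in> B then of_nat (card A) / of_nat (card B) * \<kappa> a else 0)" if "a \<in> A"
    using off[OF that] on cB by (simp add: card[symmetric])
qed

end

section \<open>Induction from normal subgroups\<close>

context finite_group
begin

lemma inv_cancel [simp]: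
  assumes "x \<in> carrier G" "y \<in> carrier G"
  shows "inv x \<otimes> (x \<otimes> y) = y" "x \<otimes> (inv x \<otimes> y) = y"
  using assms by (simp_all add: m_assoc[symmetric])

lemma transversal:
  assumes A: "subgroup A G"
  obtains t :: "nat \<Rightarrow> 'a" where
    "\<And>i. i < card (carrier G) div card A \<Longrightarrow> t i \<in> carrier G"
    "\<And>g. g \<in> carrier G \<Longrightarrow> \<exists>i<card (carrier G) div card A. g \<otimes> inv (t i) \<in> A"
    "\<And>i j. i < card (carrier G) div card A \<Longrightarrow> j < card (carrier G) div card A \<Longrightarrow>
       t i \<otimes> inv (t j) \<in> A \<Longrightarrow> i = j"
proof -
  let ?d = "card (carrier G) div card A"
  have fA: "finite A" using subgroup.subset[OF A] fin finite_subset by auto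
  have cA: "card A > 0" using fA subgroup.one_closed[OF A] by (auto simp: card_gt_0_iff)
  have "card (rcosets A) * card A = card (carrier G)"
    using lagrange[OF A] by (simp add: Coset.order_def)
  hence d: "card (rcosets A) = ?d" using cA by (metis nonzero_mult_div_cancel_right not_gr_zero)
  have "finite (rcosets A)" using fin by (auto simp: RCOSETS_def)
  then obtain f where f: "bij_betw f {..<?d} (rcosets A)"
    using d ex_bij_betw_nat_finite[of "rcosets A"] by (auto simp: atLeast0LessThan)
  have "\<exists>x\<in>carrier G. f i = A #> x" if "i < ?d" for i
  proof -
    have "f i \<in> rcosets A" using bij_betwE[OF f] that by auto
    thus ?thesis by (auto simp: RCOSETS_def)
  qed
  then obtain t where t: "\<And>i. i < ?d \<Longrightarrow> t i \<in> carrier G \<and> f i = A #> t i" by metis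
  show thesis
  proof
    show "t i \<in> carrier G" if "i < ?d" for i using t that by blast
    show "\<exists>i<?d. g \<otimes> inv (t i) \<in> A" if g: "g \<in> carrier G" for g
    proof -
      have "A #> g \<in> rcosets A" using g by (auto simp: RCOSETS_def)
      then obtain i where i: "i < ?d" "f i = A #> g" using f by (auto simp: bij_betw_def) (metis imageE lessThan_iff)
      hence "g \<in> A #> t i" using t rcos_self[OF g A] by auto
      then obtain a where a: "a \<in> A" "g = a \<otimes> t i" by (auto simp: r_coset_def)
      hence "g \<otimes> inv (t i) = a" using t[OF i(1)] subgroup.subset[OF A] by (auto simp: m_assoc)
      thus ?thesis using a i by auto
    qed
    show "i = j" if "i < ?d" "j < ?d" "t i \<otimes> inv (t j) \<in> A" for i j
    proof -
      have "t i = (t i \<otimes> inv (t j)) \<otimes> t j" using t that by (simp add: m_assoc)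
      hence "t i \<in> A #> t j" using that by (auto simp: r_coset_def)
      hence "A #> t i = A #> t j" using repr_independence[OF _ _ A] t that by auto
      thus ?thesis using f t that by (auto simp: bij_betw_def inj_on_def)
    qed
  qed
qed

lemma subspace_vec_sum:
  fixes W :: "complex vec set"
  assumes W: "VectorSpace.subspace class_ring W (module_vec TYPE(complex) d)"
    and S: "finite S" "\<And>n. n \<in> S \<Longrightarrow> u n \<in> W"
  shows "vec d (\<lambda>j. \<Sum>n\<in>S. c n * u n $ j) \<in> W"
  using S
proof (induction S rule: finite_induct)
  case empty
  have "vec d (\<lambda>j. 0 :: complex) = 0\<^sub>v d" by auto
  thus ?case using subspace_vecD(2)[OF W] by simp
next
  case (insert m S)
  have u: "u m \<in> carrier_vec d" using subspace_vecD(1)[OF W] insert by auto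
  have "c m \<cdot>\<^sub>v u m + vec d (\<lambda>j. \<Sum>n\<in>S. c n * u n $ j) \<in> W"
    using subspace_vecD(3,4)[OF W] insert by auto
  also have "c m \<cdot>\<^sub>v u m + vec d (\<lambda>j. \<Sum>n\<in>S. c n * u n $ j) = vec d (\<lambda>j. \<Sum>n\<in>insert m S. c n * u n $ j)"
    using u insert by (intro eq_vecI) auto
  finally show ?case .
qed

text \<open>
  The induced representation is monomial. Restricted to the normal subgroup it is the sum of the
  conjugates of \<open>\<kappa>\<close>, which are pairwise distinct by the hypothesis on stabilisers; hence a nonzero
  invariant subspace contains a basis vector, and the group permutes the basis lines transitively.
\<close>

theorem induced_character_irreducible:
  assumes A: "subgroup A G" and nor: "\<And>g a. g \<in> carrier G \<Longrightarrow> a \<in> A \<Longrightarrow> g \<otimes> a \<otimes> inv g \<in> A"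
    and \<kappa>: "linear_character (G\<lparr>carrier := A\<rparr>) \<kappa>"
    and stab: "\<And>g. g \<in> carrier G \<Longrightarrow> \<forall>a\<in>A. \<kappa> (g \<otimes> a \<otimes> inv g) = \<kappa> a \<Longrightarrow> g \<in> A"
  shows "induced_character G A \<kappa> \<in> irr_characters G"
proof -
  note val = linear_character_values[OF A \<kappa>]
  let ?d = "card (carrier G) div card A"
  obtain t where t: "\<And>i. i < ?d \<Longrightarrow> t i \<in> carrier G"
    "\<And>g. g \<in> carrier G \<Longrightarrow> \<exists>i<?d. g \<otimes> inv (t i) \<in> A"
    "\<And>i j. i < ?d \<Longrightarrow> j < ?d \<Longrightarrow> t i \<otimes> inv (t j) \<in> A \<Longrightarrow> i = j"
    using transversal[OF A] by blast
  have AG: "a \<in> carrier G" if "a \<in> A" for a using subgroup.subset[OF A] that by auto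
  have mA: "a \<otimes> b \<in> A" if "a \<in> A" "b \<in> A" for a b using subgroup.m_closed[OF A] that .
  have iA: "inv a \<in> A" if "a \<in> A" for a using subgroup.m_inv_closed[OF A] that .
  have fA: "finite A" using subgroup.subset[OF A] fin finite_subset by auto
  have cA: "card A > 0" using fA subgroup.one_closed[OF A] by (auto simp: card_gt_0_iff)
  have tt: "t i \<otimes> inv (t j) \<in> A \<longleftrightarrow> i = j" if "i < ?d" "j < ?d" for i j
    using t that subgroup.one_closed[OF A] by auto
  define k0 where "k0 = (\<lambda>x. if x \<in> A then \<kappa> x else 0)"
  have Ax: "a \<otimes> x \<in> A \<longleftrightarrow> x \<in> A" if "a \<in> A" "x \<in> carrier G" for a x
  proof
    assume "a \<otimes> x \<in> A"
    hence "inv a \<otimes> (a \<otimes> x) \<in> A" using mA iA that by blast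
    thus "x \<in> A" using that AG by (simp add: m_assoc)
  qed (use mA that in auto)
  have k0m: "k0 (a \<otimes> x) = \<kappa> a * k0 x" if "a \<in> A" "x \<in> carrier G" for a x
    using Ax[OF that] that val(2) by (auto simp: k0_def)
  define \<rho> where "\<rho> = (\<lambda>g. mat ?d ?d (\<lambda>(i, j). k0 (t i \<otimes> g \<otimes> inv (t j))))"
  have \<rho>c: "\<rho> g \<in> carrier_mat ?d ?d" for g by (simp add: \<rho>_def)
  have \<rho>e: "\<rho> g $$ (i, j) = k0 (t i \<otimes> g \<otimes> inv (t j))" if "i < ?d" "j < ?d" for g i j
    using that by (simp add: \<rho>_def)
  have grp: "group G" by (rule is_group)
  have rep: "representation G ?d \<rho>"
  proof (rule representationI[OF grp \<rho>c])
    fix g h assume gh: "g \<in> carrier G" "h \<in> carrier G"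
    show "\<rho> (g \<otimes> h) = \<rho> g * \<rho> h"
    proof (rule eq_matI)
      fix i j assume "i < dim_row (\<rho> g * \<rho> h)" "j < dim_col (\<rho> g * \<rho> h)"
      hence ij: "i < ?d" "j < ?d" by (auto simp: \<rho>_def)
      have tig: "t i \<otimes> g \<in> carrier G" using t ij gh by auto
      obtain k where k: "k < ?d" "t i \<otimes> g \<otimes> inv (t k) \<in> A" using t(2)[OF tig] by blast
      have other: "t i \<otimes> g \<otimes> inv (t l) \<notin> A" if l: "l < ?d" "l \<noteq> k" for l
      proof
        assume a: "t i \<otimes> g \<otimes> inv (t l) \<in> A"
        have "t k \<otimes> inv (t l) = inv (t i \<otimes> g \<otimes> inv (t k)) \<otimes> (t i \<otimes> g \<otimes> inv (t l))"
          using t(1)[OF k(1)] t(1)[OF l(1)] t(1)[OF ij(1)] gh by (simp add: inv_mult_group m_assoc)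
        hence "t k \<otimes> inv (t l) \<in> A" using a k mA iA by metis
        thus False using t(3)[OF k(1) l(1)] l by auto
      qed
      have "(\<rho> g * \<rho> h) $$ (i, j) = (\<Sum>l<?d. k0 (t i \<otimes> g \<otimes> inv (t l)) * k0 (t l \<otimes> h \<otimes> inv (t j)))"
        unfolding mat_mult_entry[OF \<rho>c \<rho>c ij] using ij by (simp add: \<rho>e)
      also have "\<dots> = (\<Sum>l\<in>{k}. k0 (t i \<otimes> g \<otimes> inv (t l)) * k0 (t l \<otimes> h \<otimes> inv (t j)))"
        by (rule sum.mono_neutral_right) (use k other in \<open>auto simp: k0_def\<close>)
      also have "\<dots> = \<kappa> (t i \<otimes> g \<otimes> inv (t k)) * k0 (t k \<otimes> h \<otimes> inv (t j))"
        using k by (simp add: k0_def)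
      also have "\<dots> = k0 ((t i \<otimes> g \<otimes> inv (t k)) \<otimes> (t k \<otimes> h \<otimes> inv (t j)))"
        using k0m[OF k(2)] t(1)[OF k(1)] t(1)[OF ij(2)] gh by simp
      also have "(t i \<otimes> g \<otimes> inv (t k)) \<otimes> (t k \<otimes> h \<otimes> inv (t j)) = t i \<otimes> (g \<otimes> h) \<otimes> inv (t j)"
        using t(1)[OF k(1)] t(1)[OF ij(1)] t(1)[OF ij(2)] gh by (simp add: m_assoc)
      finally show "\<rho> (g \<otimes> h) $$ (i, j) = (\<rho> g * \<rho> h) $$ (i, j)" using ij by (simp add: \<rho>e)
    qed (auto simp: \<rho>_def)
  next
    show "\<rho> \<one> = 1\<^sub>m ?d"
      by (rule eq_matI) (use t(1) tt val(1) in \<open>auto simp: \<rho>_def k0_def subgroup.one_closed[OF A]\<close>)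
  qed
  have dvd: "?d * card A = card (carrier G)"
    using lagrange[OF A] cA by (metis Coset.order_def nonzero_mult_div_cancel_right not_gr_zero)
  hence d0: "?d > 0" using fin one_closed by (metis card_gt_0_iff empty_iff gr0I mult_0)
  have irr: "irreducible_representation G ?d \<rho>"
    unfolding irreducible_representation_def
  proof (intro conjI rep d0 allI impI)
    fix W assume W': "VectorSpace.subspace class_ring W (module_vec TYPE(complex) ?d) \<and>
          (\<forall>g\<in>carrier G. \<forall>w\<in>W. \<rho> g *\<^sub>v w \<in> W)"
    hence W: "VectorSpace.subspace class_ring W (module_vec TYPE(complex) ?d)"
      and inv: "\<And>g w. g \<in> carrier G \<Longrightarrow> w \<in> W \<Longrightarrow> \<rho> g *\<^sub>v w \<in> W" by auto
    note Wd = subspace_vecD[OF W]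
    show "W = {0\<^sub>v ?d} \<or> W = carrier_vec ?d"
    proof (cases "W = {0\<^sub>v ?d}")
      case False
      then obtain w where w: "w \<in> W" "w \<noteq> 0\<^sub>v ?d" using Wd(2) by blast
      have wc: "w \<in> carrier_vec ?d" using w Wd(1) by auto
      obtain m where m: "m < ?d" "w $ m \<noteq> 0" using w wc by (metis carrier_vecD eq_vecI index_zero_vec)
      \<comment> \<open>Averaging \<open>\<rho>(n) w\<close> over \<open>n \<in> A\<close> against the \<open>m\<close>-th conjugate of \<open>\<kappa>\<close> isolates the \<open>m\<close>-th coordinate.\<close>
      define c where "c = (\<lambda>n. inverse (\<kappa> (t m \<otimes> n \<otimes> inv (t m))))"
      have cj: "t j \<otimes> n \<otimes> inv (t j) \<in> A" if "j < ?d" "n \<in> A" for j n using nor t that by auto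
      have diag: "(\<rho> n *\<^sub>v w) $ j = \<kappa> (t j \<otimes> n \<otimes> inv (t j)) * w $ j" if j: "j < ?d" and n: "n \<in> A" for j n
      proof -
        have off: "k0 (t j \<otimes> n \<otimes> inv (t l)) = 0" if l: "l < ?d" "l \<noteq> j" for l
        proof -
          have "t j \<otimes> n \<otimes> inv (t l) = (t j \<otimes> n \<otimes> inv (t j)) \<otimes> (t j \<otimes> inv (t l))"
            using t(1)[OF j] t(1)[OF l(1)] AG[OF n] by (simp add: m_assoc)
          hence "t j \<otimes> n \<otimes> inv (t l) \<in> A \<longleftrightarrow> t j \<otimes> inv (t l) \<in> A"
            using Ax[OF cj[OF j n], of "t j \<otimes> inv (t l)"] t(1)[OF j] t(1)[OF l(1)] by simp
          thus ?thesis using tt[OF j l(1)] l by (simp add: k0_def)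
        qed
        have "(\<rho> n *\<^sub>v w) $ j = (\<Sum>l<?d. k0 (t j \<otimes> n \<otimes> inv (t l)) * w $ l)"
          unfolding mat_mult_vec_entry[OF \<rho>c wc j] using j by (simp add: \<rho>e)
        also have "\<dots> = (\<Sum>l\<in>{j}. k0 (t j \<otimes> n \<otimes> inv (t l)) * w $ l)"
          by (rule sum.mono_neutral_right) (use j off in auto)
        finally show ?thesis using cj[OF j n] by (simp add: k0_def)
      qed
      have proj: "(\<Sum>n\<in>A. c n * \<kappa> (t j \<otimes> n \<otimes> inv (t j))) = (if j = m then of_nat (card A) else 0)"
        if j: "j < ?d" for j
      proof (cases "j = m")
        case True
        thus ?thesis using val(3) cj[OF m(1)] by (simp add: c_def)
      next
        case False
        have "\<exists>n\<in>A. \<kappa> (t j \<otimes> n \<otimes> inv (t j)) \<noteq> \<kappa> (t m \<otimes> n \<otimes> inv (t m))"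
        proof (rule ccontr)
          assume "\<not> ?thesis"
          hence eq: "\<kappa> (t j \<otimes> n \<otimes> inv (t j)) = \<kappa> (t m \<otimes> n \<otimes> inv (t m))" if "n \<in> A" for n using that by blast
          let ?g = "t j \<otimes> inv (t m)"
          have gG: "?g \<in> carrier G" using t(1) j m by auto
          have "\<kappa> (?g \<otimes> a \<otimes> inv ?g) = \<kappa> a" if a: "a \<in> A" for a
          proof -
            have n: "inv (t m) \<otimes> a \<otimes> t m \<in> A" using nor[of "inv (t m)" a] a t(1)[OF m(1)] by simp
            have "?g \<otimes> a \<otimes> inv ?g = t j \<otimes> (inv (t m) \<otimes> a \<otimes> t m) \<otimes> inv (t j)"
              using t(1)[OF j] t(1)[OF m(1)] AG[OF a] by (simp add: inv_mult_group m_assoc)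
            moreover have "t m \<otimes> (inv (t m) \<otimes> a \<otimes> t m) \<otimes> inv (t m) = a"
              using t(1)[OF m(1)] AG[OF a] by (simp add: m_assoc)
            ultimately show ?thesis using eq[OF n] by simp
          qed
          hence "?g \<in> A" using stab[OF gG] by blast
          thus False using tt[OF j m(1)] False by simp
        qed
        then obtain n where n: "n \<in> A" "\<kappa> (t j \<otimes> n \<otimes> inv (t j)) \<noteq> \<kappa> (t m \<otimes> n \<otimes> inv (t m))" by blast
        have conj: "t i \<otimes> (a \<otimes> b) \<otimes> inv (t i) = (t i \<otimes> a \<otimes> inv (t i)) \<otimes> (t i \<otimes> b \<otimes> inv (t i))"
          if "i < ?d" "a \<in> A" "b \<in> A" for i a b
          using t(1)[OF that(1)] AG[OF that(2)] AG[OF that(3)] by (simp add: m_assoc)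
        have "(\<Sum>n\<in>A. c n * \<kappa> (t j \<otimes> n \<otimes> inv (t j))) = 0"
        proof (rule sum_nontrivial_linear_character[OF A _ n(1)])
          fix a b assume ab: "a \<in> A" "b \<in> A"
          show "c (a \<otimes> b) * \<kappa> (t j \<otimes> (a \<otimes> b) \<otimes> inv (t j)) =
            c a * \<kappa> (t j \<otimes> a \<otimes> inv (t j)) * (c b * \<kappa> (t j \<otimes> b \<otimes> inv (t j)))"
            unfolding c_def conj[OF j ab] conj[OF m(1) ab]
            using val(2)[OF cj[OF j ab(1)] cj[OF j ab(2)]] val(2)[OF cj[OF m(1) ab(1)] cj[OF m(1) ab(2)]]
            by (simp add: inverse_eq_divide)
        next
          show "c n * \<kappa> (t j \<otimes> n \<otimes> inv (t j)) \<noteq> 1"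
            using n val(3)[OF cj[OF m(1) n(1)]] by (simp add: c_def field_simps)
        qed
        thus ?thesis using False by simp
      qed
      have "vec ?d (\<lambda>j. \<Sum>n\<in>A. c n * (\<rho> n *\<^sub>v w) $ j) \<in> W"
        by (rule subspace_vec_sum[OF W fA]) (use inv AG w in auto)
      also have "vec ?d (\<lambda>j. \<Sum>n\<in>A. c n * (\<rho> n *\<^sub>v w) $ j) = (of_nat (card A) * w $ m) \<cdot>\<^sub>v unit_vec ?d m"
      proof (rule eq_vecI)
        fix j assume "j < dim_vec ((of_nat (card A) * w $ m) \<cdot>\<^sub>v unit_vec ?d m)"
        hence j: "j < ?d" by simp
        have "(\<Sum>n\<in>A. c n * (\<rho> n *\<^sub>v w) $ j) = (\<Sum>n\<in>A. c n * \<kappa> (t j \<otimes> n \<otimes> inv (t j))) * w $ j"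
          unfolding sum_distrib_right by (intro sum.cong refl) (simp only: diag[OF j] mult.assoc)
        thus "vec ?d (\<lambda>j. \<Sum>n\<in>A. c n * (\<rho> n *\<^sub>v w) $ j) $ j = ((of_nat (card A) * w $ m) \<cdot>\<^sub>v unit_vec ?d m) $ j"
          using j m proj[OF j] by simp
      qed simp
      finally have "inverse (of_nat (card A) * w $ m) \<cdot>\<^sub>v ((of_nat (card A) * w $ m) \<cdot>\<^sub>v unit_vec ?d m) \<in> W"
        by (rule Wd(4))
      moreover have "inverse (of_nat (card A) * w $ m) * (of_nat (card A) * w $ m) = 1"
        by (rule left_inverse) (use m cA in simp)
      ultimately have em: "unit_vec ?d m \<in> W" unfolding smult_smult_assoc by simp
      have ej: "unit_vec ?d j \<in> W" if j: "j < ?d" for j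
      proof -
        let ?g = "inv (t j) \<otimes> t m"
        have g: "?g \<in> carrier G" using t(1) j m by auto
        have "\<rho> ?g *\<^sub>v unit_vec ?d m = unit_vec ?d j"
        proof (rule eq_vecI)
          fix i assume "i < dim_vec (unit_vec ?d j :: complex vec)"
          hence i: "i < ?d" by simp
          have "(\<rho> ?g *\<^sub>v unit_vec ?d m) $ i = \<rho> ?g $$ (i, m)" using i m \<rho>c[of ?g] by auto
          also have "\<dots> = k0 (t i \<otimes> inv (t j))"
            using t(1)[OF i] t(1)[OF j] t(1)[OF m(1)] i m by (simp add: \<rho>e m_assoc)
          also have "\<dots> = unit_vec ?d j $ i" using tt[OF i j] i j t(1)[OF j] val(1) by (auto simp: k0_def)
          finally show "(\<rho> ?g *\<^sub>v unit_vec ?d m) $ i = unit_vec ?d j $ i" .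
        qed (use \<rho>c[of ?g] in auto)
        thus ?thesis using inv[OF g em] by simp
      qed
      have "v \<in> W" if v: "v \<in> carrier_vec ?d" for v
      proof -
        have "vec ?d (\<lambda>j. \<Sum>n\<in>{..<?d}. v $ n * unit_vec ?d n $ j) \<in> W"
          by (rule subspace_vec_sum[OF W]) (use ej in auto)
        also have "vec ?d (\<lambda>j. \<Sum>n\<in>{..<?d}. v $ n * unit_vec ?d n $ j) = v"
          using v by (intro eq_vecI) (auto simp: unit_vec_def if_distrib cong: if_cong)
        finally show ?thesis .
      qed
      thus ?thesis using Wd(1) by auto
    qed simp
  qed
  have "rep_character G \<rho> = induced_character G A \<kappa>"
    unfolding rep_character_def induced_character_def
  proof (rule restrict_ext)
    fix g assume g: "g \<in> carrier G"
    have conj: "k0 ((a \<otimes> t i) \<otimes> g \<otimes> inv (a \<otimes> t i)) = k0 (t i \<otimes> g \<otimes> inv (t i))"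
      if a: "a \<in> A" and i: "i < ?d" for a i
    proof -
      let ?y = "t i \<otimes> g \<otimes> inv (t i)"
      have y: "?y \<in> carrier G" using t(1)[OF i] g by auto
      have e: "(a \<otimes> t i) \<otimes> g \<otimes> inv (a \<otimes> t i) = a \<otimes> (?y \<otimes> inv a)"
        using t(1)[OF i] g AG[OF a] by (simp add: inv_mult_group m_assoc)
      have "?y \<otimes> inv a \<in> A \<longleftrightarrow> ?y \<in> A"
      proof
        assume "?y \<otimes> inv a \<in> A"
        hence "(?y \<otimes> inv a) \<otimes> a \<in> A" using mA a by blast
        thus "?y \<in> A" using y AG[OF a] by (simp add: m_assoc)
      qed (use mA iA a in auto)
      hence "k0 (?y \<otimes> inv a) = k0 ?y * inverse (\<kappa> a)"
        using val(2)[of ?y "inv a"] val(4) iA a by (auto simp: k0_def)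
      thus ?thesis unfolding e using k0m[OF a, of "?y \<otimes> inv a"] y AG[OF a] val(3)[OF a] by simp
    qed
    have bij: "bij_betw (\<lambda>(a, i). a \<otimes> t i) (A \<times> {..<?d}) (carrier G)"
    proof (rule bij_betwI')
      fix p p' assume "p \<in> A \<times> {..<?d}" "p' \<in> A \<times> {..<?d}"
      then obtain a i b j where p: "p = (a, i)" "p' = (b, j)" "a \<in> A" "b \<in> A" "i < ?d" "j < ?d" by auto
      note c = t(1)[OF p(5)] t(1)[OF p(6)] AG[OF p(3)] AG[OF p(4)]
      show "((case p of (a, i) \<Rightarrow> a \<otimes> t i) = (case p' of (a, i) \<Rightarrow> a \<otimes> t i)) = (p = p')"
      proof
        assume "(case p of (a, i) \<Rightarrow> a \<otimes> t i) = (case p' of (a, i) \<Rightarrow> a \<otimes> t i)"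
        hence e: "a \<otimes> t i = b \<otimes> t j" using p by simp
        have "t i \<otimes> inv (t j) = inv a \<otimes> (a \<otimes> t i) \<otimes> inv (t j)" using c by (simp add: m_assoc)
        also have "\<dots> = inv a \<otimes> b" unfolding e using c by (simp add: m_assoc)
        finally have "t i \<otimes> inv (t j) \<in> A" using mA iA p by simp
        hence "i = j" using t(3) p by auto
        thus "p = p'" using e c p by simp
      qed auto
    next
      fix p assume "p \<in> A \<times> {..<?d}" thus "(case p of (a, i) \<Rightarrow> a \<otimes> t i) \<in> carrier G" using t(1) AG by auto
    next
      fix y assume y: "y \<in> carrier G"
      then obtain i where i: "i < ?d" "y \<otimes> inv (t i) \<in> A" using t(2) by blast
      moreover have "y = (y \<otimes> inv (t i)) \<otimes> t i" using y t(1)[OF i(1)] by (simp add: m_assoc)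
      ultimately show "\<exists>p\<in>A \<times> {..<?d}. y = (case p of (a, i) \<Rightarrow> a \<otimes> t i)"
        by (intro bexI[of _ "(y \<otimes> inv (t i), i)"]) auto
    qed
    have "(\<Sum>x\<in>carrier G. if inv x \<otimes> g \<otimes> x \<in> A then \<kappa> (inv x \<otimes> g \<otimes> x) else 0) =
        (\<Sum>y\<in>carrier G. k0 (y \<otimes> g \<otimes> inv y))"
      by (rule sum.reindex_bij_witness[of _ "\<lambda>y. inv y" "\<lambda>x. inv x"]) (auto simp: k0_def)
    also have "\<dots> = (\<Sum>p\<in>A \<times> {..<?d}. k0 ((case p of (a, i) \<Rightarrow> a \<otimes> t i) \<otimes> g \<otimes> inv (case p of (a, i) \<Rightarrow> a \<otimes> t i)))"
      by (rule sum.reindex_bij_betw[OF bij, symmetric])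
    also have "\<dots> = (\<Sum>(a, i)\<in>A \<times> {..<?d}. k0 (t i \<otimes> g \<otimes> inv (t i)))"
      by (rule sum.cong) (auto simp: conj)
    also have "\<dots> = of_nat (card A) * (\<Sum>i<?d. k0 (t i \<otimes> g \<otimes> inv (t i)))"
      by (simp add: sum.cartesian_product[symmetric])
    also have "(\<Sum>i<?d. k0 (t i \<otimes> g \<otimes> inv (t i))) = mat_trace (\<rho> g)"
      unfolding mat_trace_eq[OF \<rho>c] by (intro sum.cong refl) (simp add: \<rho>e)
    finally show "mat_trace (\<rho> g) =
       (\<Sum>x\<in>carrier G. if inv x \<otimes> g \<otimes> x \<in> A then \<kappa> (inv x \<otimes> g \<otimes> x) else 0) / of_nat (card A)"
      using cA by simp
  qed
  thus ?thesis using irr unfolding irr_characters_def by (metis (mono_tags, lifting) mem_Collect_eq)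
qed

end

section \<open>Decomposing a character induced from a central subgroup\<close>

lemma induced_character_eval:
  "g \<in> carrier G \<Longrightarrow> induced_character G H \<xi> g =
     (\<Sum>x\<in>carrier G. if inv\<^bsub>G\<^esub> x \<otimes>\<^bsub>G\<^esub> g \<otimes>\<^bsub>G\<^esub> x \<in> H
        then \<xi> (inv\<^bsub>G\<^esub> x \<otimes>\<^bsub>G\<^esub> g \<otimes>\<^bsub>G\<^esub> x) else 0) / of_nat (card H)"
  by (simp add: induced_character_def)

context finite_group
begin

definition commutator :: "'a \<Rightarrow> 'a \<Rightarrow> 'a" where
  "commutator g h = g \<otimes> h \<otimes> inv g \<otimes> inv h"

lemma commutator_closed [simp]: "g \<in> carrier G \<Longrightarrow> h \<in> carrier G \<Longrightarrow> commutator g h \<in> carrier G"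
  by (simp add: commutator_def)

lemma commutator_swap:
  assumes "g \<in> carrier G" "h \<in> carrier G"
  shows "g \<otimes> h = commutator g h \<otimes> h \<otimes> g" "g \<otimes> h \<otimes> inv g = commutator g h \<otimes> h"
  using assms by (simp_all add: commutator_def m_assoc)

lemma induced_character_central_value:
  assumes A: "subgroup A G" and v: "v \<in> A" "\<And>g. g \<in> carrier G \<Longrightarrow> v \<otimes> g = g \<otimes> v"
  shows "induced_character G A \<kappa> v = of_nat (card (carrier G)) / of_nat (card A) * \<kappa> v"
proof -
  have vG: "v \<in> carrier G" using subgroup.subset[OF A] v by auto
  have "inv x \<otimes> v \<otimes> x = v" if "x \<in> carrier G" for x
    using v(2)[OF that] vG that by (simp add: m_assoc)
  thus ?thesis using vG v(1) by (simp add: induced_character_eval)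
qed

text \<open>
  The pairs \<open>(i, \<kappa>)\<close> index constituents of the induced character with repetition. Each induced
  \<open>\<kappa>\<close> is irreducible because \<open>A i\<close> is its own centraliser with respect to \<open>lam i\<close>. As these
  characters are orthonormal, pairing the total with one of them counts its repetitions, and by
  Frobenius reciprocity this count is its degree.
\<close>

theorem central_induced_decomposition:
  fixes I :: "'i set" and A :: "'i \<Rightarrow> 'a set" and lam :: "'i \<Rightarrow> 'a \<Rightarrow> complex" and T :: "nat set"
  assumes V: "subgroup V G" "V \<subseteq> C" and central: "\<And>v g. v \<in> V \<Longrightarrow> g \<in> carrier G \<Longrightarrow> v \<otimes> g = g \<otimes> v"
    and C: "subgroup C G" and comm: "\<And>g h. g \<in> carrier G \<Longrightarrow> h \<in> carrier G \<Longrightarrow> commutator g h \<in> C"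
    and I: "finite I" and lam: "\<And>i. i \<in> I \<Longrightarrow> linear_character (G\<lparr>carrier := C\<rparr>) (lam i)"
    and lamV: "\<And>i v. i \<in> I \<Longrightarrow> v \<in> V \<Longrightarrow> lam i v = \<mu> v"
    and lamsum: "\<And>c. c \<in> C \<Longrightarrow> (\<Sum>i\<in>I. lam i c) =
        (if c \<in> V then of_nat (card C) / of_nat (card V) * \<mu> c else 0)"
    and A: "\<And>i. i \<in> I \<Longrightarrow> subgroup (A i) G" "\<And>i. i \<in> I \<Longrightarrow> C \<subseteq> A i"
    and selfcent: "\<And>i g. i \<in> I \<Longrightarrow> g \<in> carrier G \<Longrightarrow> g \<in> A i \<longleftrightarrow> (\<forall>a\<in>A i. lam i (commutator g a) = 1)"
    and T: "finite T" "\<And>i. i \<in> I \<Longrightarrow> card (carrier G) div card (A i) \<in> T"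
  shows "\<exists>X :: nat \<Rightarrow> ('a \<Rightarrow> complex) set.
    (\<forall>d. X d \<subseteq> irr_characters G \<and> (\<forall>\<chi>\<in>X d. \<chi> \<one> = of_nat d) \<and>
       d * card (X d) = (\<Sum>i\<in>{i\<in>I. card (carrier G) div card (A i) = d}. card (A i) div card C)) \<and>
    (\<forall>g\<in>carrier G. induced_character G V \<mu> g = (\<Sum>d\<in>T. of_nat d * (\<Sum>\<chi>\<in>X d. \<chi> g)))"
proof -
  let ?deg = "\<lambda>i. card (carrier G) div card (A i)"
  \<comment> \<open>\<open>X d\<close> collects the characters of degree \<open>d\<close> that the pairs in \<open>P\<close> induce.\<close>
  define P where "P = Sigma I (\<lambda>i. lin_exts C (A i) (lam i))"
  define Ind where "Ind = (\<lambda>(i, \<kappa>). induced_character G (A i) \<kappa>)"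
  define X where "X = (\<lambda>d. Ind ` {p \<in> P. ?deg (fst p) = d})"
  have grp: "group G" by (rule is_group)
  have cardpos: "card H > 0" if "subgroup H G" for H
    using that subgroup.subset[OF that] subgroup.one_closed[OF that] finite_subset[OF _ fin]
    by (auto simp: card_gt_0_iff)
  have degdiv: "of_nat (?deg i) = (of_nat (card (carrier G)) / of_nat (card (A i)) :: complex)" if "i \<in> I" for i
  proof -
    have "card (A i) dvd card (carrier G)"
      using lagrange[OF A(1)[OF that]] by (metis Coset.order_def dvd_triv_right)
    then obtain k where "card (carrier G) = card (A i) * k" by (auto elim: dvdE)
    thus ?thesis using cardpos[OF A(1)[OF that]] by simp
  qed
  have ker: "\<exists>c\<in>C. a \<otimes> h = c \<otimes> h \<otimes> a \<and> lam i c = 1" if "i \<in> I" "a \<in> A i" "h \<in> A i" for i a h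
  proof -
    have ah: "a \<in> carrier G" "h \<in> carrier G" using subgroup.subset[OF A(1)] that by auto
    show ?thesis using comm[OF ah] commutator_swap(1)[OF ah] selfcent[OF that(1) ah(1)] that by blast
  qed
  have ext: "finite (lin_exts C (A i) (lam i))"
    "a \<in> A i \<Longrightarrow> (\<Sum>\<kappa>'\<in>lin_exts C (A i) (lam i). \<kappa>' a) =
       (if a \<in> C then of_nat (card (A i)) / of_nat (card C) * lam i a else 0)"
    "card (lin_exts C (A i) (lam i)) * card C = card (A i)" if i: "i \<in> I" for i a
    using sum_lin_exts[OF A(1)[OF i] C A(2)[OF i] lam[OF i] ker[OF i]] by blast+
  have finP: "finite P" unfolding P_def using I ext(1) by (intro finite_SigmaI) auto
  have kappa: "i \<in> I" "linear_character (G\<lparr>carrier := A i\<rparr>) \<kappa>" "\<And>c. c \<in> C \<Longrightarrow> \<kappa> c = lam i c"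
    if "(i, \<kappa>) \<in> P" for i \<kappa> using that by (auto simp: P_def lin_exts_def)
  have Iirr: "Ind p \<in> irr_characters G" if p: "p \<in> P" for p
  proof -
    obtain i \<kappa> where ik: "p = (i, \<kappa>)" by force
    note k = kappa[of i \<kappa>, OF p[unfolded ik]]
    note Ai = A[OF k(1)]
    have AG: "a \<in> carrier G" if "a \<in> A i" for a using that subgroup.subset[OF Ai(1)] by auto
    have conj: "g \<otimes> a \<otimes> inv g \<in> A i \<and> \<kappa> (g \<otimes> a \<otimes> inv g) = lam i (commutator g a) * \<kappa> a"
      if g: "g \<in> carrier G" and a: "a \<in> A i" for g a
    proof -
      have c: "commutator g a \<in> C" "commutator g a \<in> A i" using comm[OF g AG[OF a]] Ai(2) by auto
      show ?thesis unfolding commutator_swap(2)[OF g AG[OF a]]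
        using subgroup.m_closed[OF Ai(1) c(2) a] linear_character_values(2)[OF Ai(1) k(2) c(2) a] k(3)[OF c(1)]
        by simp
    qed
    have "induced_character G (A i) \<kappa> \<in> irr_characters G"
    proof (rule induced_character_irreducible[OF Ai(1) _ k(2)])
      fix g assume g: "g \<in> carrier G" and s: "\<forall>a\<in>A i. \<kappa> (g \<otimes> a \<otimes> inv g) = \<kappa> a"
      have "\<forall>a\<in>A i. lam i (commutator g a) = 1"
        using s conj[OF g] linear_character_values(3)[OF Ai(1) k(2)] by (metis mult_cancel_right1)
      thus "g \<in> A i" using selfcent[OF k(1) g] by simp
    qed (use conj in blast)
    thus ?thesis by (simp add: Ind_def ik)
  qed
  have Ival: "Ind p v = of_nat (?deg (fst p)) * \<mu> v" if p: "p \<in> P" and v: "v \<in> V" for p v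
  proof -
    obtain i \<kappa> where ik: "p = (i, \<kappa>)" by force
    note k = kappa[of i \<kappa>, OF p[unfolded ik]]
    have vC: "v \<in> C" "v \<in> A i" using v V A(2)[OF k(1)] by auto
    show ?thesis unfolding ik Ind_def using central[OF v]
      by (simp add: induced_character_central_value[OF A(1)[OF k(1)] vC(2)] degdiv[OF k(1)] k(3)[OF vC(1)] lamV[OF k(1) v])
  qed
  have oneV: "\<one> \<in> V" by (rule subgroup.one_closed[OF V(1)])
  have P_deg1: "Ind p \<one> = of_nat (?deg (fst p))" if p: "p \<in> P" for p
  proof -
    obtain i \<kappa> where ik: "p = (i, \<kappa>)" by force
    note k = kappa[of i \<kappa>, OF p[unfolded ik]]
    have "lam i \<one> = 1" by (rule linear_character_values(1)[OF C lam[OF k(1)]])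
    thus ?thesis using Ival[OF p oneV] lamV[OF k(1) oneV] by simp
  qed
  have total: "(\<Sum>p\<in>P. Ind p g) = induced_character G V \<mu> g" if g: "g \<in> carrier G" for g
  proof -
    let ?y = "\<lambda>x. inv x \<otimes> g \<otimes> x"
    have inner: "(\<Sum>\<kappa>\<in>lin_exts C (A i) (lam i). induced_character G (A i) \<kappa> g) =
       (\<Sum>x\<in>carrier G. if ?y x \<in> C then lam i (?y x) else 0) / of_nat (card C)" if i: "i \<in> I" for i
    proof -
      have "(\<Sum>\<kappa>\<in>lin_exts C (A i) (lam i). induced_character G (A i) \<kappa> g) =
         (\<Sum>x\<in>carrier G. \<Sum>\<kappa>\<in>lin_exts C (A i) (lam i). if ?y x \<in> A i then \<kappa> (?y x) else 0) / of_nat (card (A i))"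
        by (simp add: induced_character_eval[OF g] sum_divide_distrib[symmetric] sum.swap[of _ _ "carrier G"])
      also have "(\<Sum>x\<in>carrier G. \<Sum>\<kappa>\<in>lin_exts C (A i) (lam i). if ?y x \<in> A i then \<kappa> (?y x) else 0) =
         (\<Sum>x\<in>carrier G. of_nat (card (A i)) / of_nat (card C) * (if ?y x \<in> C then lam i (?y x) else 0))"
      proof (rule sum.cong[OF refl])
        fix x assume "x \<in> carrier G"
        show "(\<Sum>\<kappa>\<in>lin_exts C (A i) (lam i). if ?y x \<in> A i then \<kappa> (?y x) else 0) =
            of_nat (card (A i)) / of_nat (card C) * (if ?y x \<in> C then lam i (?y x) else 0)"
        proof (cases "?y x \<in> A i")
          case True
          thus ?thesis using ext(2)[OF i True] by simp
        next
          case False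
          hence "?y x \<notin> C" using A(2)[OF i] by auto
          thus ?thesis using False by simp
        qed
      qed
      also have "\<dots> = of_nat (card (A i)) / of_nat (card C) * (\<Sum>x\<in>carrier G. if ?y x \<in> C then lam i (?y x) else 0)"
        by (rule sum_distrib_left[symmetric])
      finally show ?thesis using cardpos[OF A(1)[OF i]] by simp
    qed
    have "(\<Sum>p\<in>P. Ind p g) = (\<Sum>i\<in>I. \<Sum>\<kappa>\<in>lin_exts C (A i) (lam i). induced_character G (A i) \<kappa> g)"
      unfolding P_def using I ext(1) by (subst sum.Sigma) (auto simp: Ind_def intro!: sum.cong)
    also have "\<dots> = (\<Sum>i\<in>I. \<Sum>x\<in>carrier G. if ?y x \<in> C then lam i (?y x) else 0) / of_nat (card C)"
      by (simp add: inner sum_divide_distrib[symmetric])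
    also have "(\<Sum>i\<in>I. \<Sum>x\<in>carrier G. if ?y x \<in> C then lam i (?y x) else 0) =
       (\<Sum>x\<in>carrier G. \<Sum>i\<in>I. if ?y x \<in> C then lam i (?y x) else 0)" by (rule sum.swap)
    also have "\<dots> = (\<Sum>x\<in>carrier G. of_nat (card C) / of_nat (card V) * (if ?y x \<in> V then \<mu> (?y x) else 0))"
    proof (rule sum.cong[OF refl])
      fix x assume "x \<in> carrier G"
      show "(\<Sum>i\<in>I. if ?y x \<in> C then lam i (?y x) else 0) =
          of_nat (card C) / of_nat (card V) * (if ?y x \<in> V then \<mu> (?y x) else 0)"
      proof (cases "?y x \<in> C")
        case True
        thus ?thesis using lamsum[OF True] by simp
      next
        case False
        hence "?y x \<notin> V" using V(2) by auto
        thus ?thesis using False by simp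
      qed
    qed
    also have "\<dots> = of_nat (card C) / of_nat (card V) * (\<Sum>x\<in>carrier G. if ?y x \<in> V then \<mu> (?y x) else 0)"
      by (rule sum_distrib_left[symmetric])
    finally show ?thesis using cardpos[OF C] by (simp add: induced_character_eval[OF g])
  qed
  have mu_off: "induced_character G V \<mu> g = 0" if g: "g \<in> carrier G" "g \<notin> V" for g
  proof -
    have "inv x \<otimes> g \<otimes> x \<notin> V" if x: "x \<in> carrier G" for x
    proof
      assume v: "inv x \<otimes> g \<otimes> x \<in> V"
      have "g = x \<otimes> (inv x \<otimes> g \<otimes> x) \<otimes> inv x" using g x by (simp add: m_assoc)
      also have "x \<otimes> (inv x \<otimes> g \<otimes> x) = (inv x \<otimes> g \<otimes> x) \<otimes> x" using central[OF v x] by simp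
      also have "\<dots> \<otimes> inv x = inv x \<otimes> g \<otimes> x" using g x by (simp add: m_assoc)
      finally show False using v g by simp
    qed
    thus ?thesis by (simp add: induced_character_eval[OF g(1)])
  qed
  have frob: "char_inner G (induced_character G V \<mu>) (Ind p) = of_nat (?deg (fst p))" if p: "p \<in> P" for p
  proof -
    let ?G = "of_nat (card (carrier G)) :: complex" and ?D = "of_nat (?deg (fst p)) :: complex"
    have VG: "V \<subseteq> carrier G" by (rule subgroup.subset[OF V(1)])
    obtain i \<kappa> where ik: "p = (i, \<kappa>)" by force
    note k = kappa[of i \<kappa>, OF p[unfolded ik]]
    have mu: "\<mu> v * \<mu> (inv v) = 1" if v: "v \<in> V" for v
    proof -
      have "v \<in> C" "inv v \<in> V" using v V subgroup.m_inv_closed[OF V(1)] by auto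
      thus ?thesis using linear_character_values(3,4)[OF C lam[OF k(1)], of v] lamV[OF k(1) v] lamV[OF k(1), of "inv v"] by simp
    qed
    have "(\<Sum>g\<in>carrier G. induced_character G V \<mu> g * Ind p (inv g)) =
        (\<Sum>g\<in>V. induced_character G V \<mu> g * Ind p (inv g))"
      by (rule sum.mono_neutral_right) (use fin VG mu_off in auto)
    also have "\<dots> = (\<Sum>g\<in>V. ?G / of_nat (card V) * ?D)"
    proof (rule sum.cong[OF refl])
      fix v assume v: "v \<in> V"
      have iv: "inv v \<in> V" by (rule subgroup.m_inv_closed[OF V(1) v])
      have mv: "induced_character G V \<mu> v = ?G / of_nat (card V) * \<mu> v"
        by (rule induced_character_central_value[OF V(1) v]) (rule central[OF v])
      have "induced_character G V \<mu> v * Ind p (inv v) = ?G / of_nat (card V) * ?D * (\<mu> v * \<mu> (inv v))"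
        unfolding Ival[OF p iv] mv by (simp add: mult_ac)
      thus "induced_character G V \<mu> v * Ind p (inv v) = ?G / of_nat (card V) * ?D" using mu[OF v] by simp
    qed
    also have "\<dots> = ?G * ?D" using cardpos[OF V(1)] by simp
    finally show ?thesis using fin one_closed by (auto simp: char_inner_def)
  qed
  have fibre: "card {p' \<in> P. Ind p' = Ind p} = ?deg (fst p)" if p: "p \<in> P" for p
  proof -
    have "of_nat (?deg (fst p)) = char_inner G (\<lambda>g. \<Sum>p'\<in>P. Ind p' g) (Ind p)"
      unfolding frob[OF p, symmetric] char_inner_def
      by (intro arg_cong2[where f="(/)"] sum.cong refl) (simp add: total)
    also have "\<dots> = (\<Sum>p'\<in>P. char_inner G (Ind p') (Ind p))"
      by (simp add: char_inner_def sum_distrib_right sum_divide_distrib[symmetric] sum.swap[of _ _ "carrier G"])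
    also have "\<dots> = (\<Sum>p'\<in>P. if Ind p' = Ind p then 1 else 0)"
      by (intro sum.cong refl irr_characters_orthonormal[OF grp fin] Iirr p)
    also have "\<dots> = of_nat (card {p' \<in> P. Ind p' = Ind p})"
      using finP by (simp add: sum.If_cases Int_def)
    finally have "complex_of_nat (card {p' \<in> P. Ind p' = Ind p}) = of_nat (?deg (fst p))" by (rule sym)
    thus ?thesis by (simp only: of_nat_eq_iff)
  qed
  let ?P = "\<lambda>d. {p \<in> P. ?deg (fst p) = d}"
  have fibre': "{p \<in> ?P d. Ind p = \<chi>} = {p \<in> P. Ind p = \<chi>} \<and> card {p \<in> P. Ind p = \<chi>} = d"
    if chi: "\<chi> \<in> X d" for d \<chi>
  proof -
    obtain p where p: "p \<in> P" "?deg (fst p) = d" "\<chi> = Ind p" using chi unfolding X_def by blast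
    have "?deg (fst p') = d" if "p' \<in> P" "Ind p' = Ind p" for p'
      using P_deg1[OF that(1)] P_deg1[OF p(1)] that(2) p(2) by (metis of_nat_eq_iff)
    thus ?thesis using fibre[OF p(1)] p by auto
  qed
  have finPd: "finite (?P d)" for d using finP by simp
  have group_sum: "(\<Sum>p\<in>?P d. f (Ind p)) = (\<Sum>\<chi>\<in>X d. of_nat d * f \<chi>)" for d and f :: "('a \<Rightarrow> complex) \<Rightarrow> 'c::comm_semiring_1"
  proof -
    have "(\<Sum>p\<in>?P d. f (Ind p)) = (\<Sum>\<chi>\<in>X d. \<Sum>p\<in>{p \<in> ?P d. Ind p = \<chi>}. f (Ind p))"
      unfolding X_def by (rule sum.image_gen[OF finPd])
    also have "\<dots> = (\<Sum>\<chi>\<in>X d. of_nat d * f \<chi>)"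
    proof (rule sum.cong[OF refl])
      fix \<chi> assume c: "\<chi> \<in> X d"
      have "(\<Sum>p\<in>{p \<in> ?P d. Ind p = \<chi>}. f (Ind p)) = (\<Sum>p\<in>{p \<in> P. Ind p = \<chi>}. f \<chi>)"
        using fibre'[OF c] by (intro sum.cong) auto
      also have "\<dots> = of_nat d * f \<chi>" using fibre'[OF c] by simp
      finally show "(\<Sum>p\<in>{p \<in> ?P d. Ind p = \<chi>}. f (Ind p)) = of_nat d * f \<chi>" .
    qed
    finally show ?thesis .
  qed
  have cnt: "d * card (X d) = (\<Sum>i\<in>{i\<in>I. ?deg i = d}. card (A i) div card C)" for d
  proof -
    have "d * card (X d) = (\<Sum>p\<in>?P d. 1)" using group_sum[of "\<lambda>_. 1::nat" d] by simp
    also have "?P d = Sigma {i\<in>I. ?deg i = d} (\<lambda>i. lin_exts C (A i) (lam i))" by (auto simp: P_def)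
    also have "(\<Sum>p\<in>\<dots>. 1) = (\<Sum>i\<in>{i\<in>I. ?deg i = d}. card (lin_exts C (A i) (lam i)))"
      using I ext(1) by (simp add: card_SigmaI)
    also have "\<dots> = (\<Sum>i\<in>{i\<in>I. ?deg i = d}. card (A i) div card C)"
    proof (rule sum.cong[OF refl])
      fix i assume "i \<in> {i\<in>I. ?deg i = d}"
      hence i: "i \<in> I" by simp
      show "card (lin_exts C (A i) (lam i)) = card (A i) div card C"
        using ext(3)[OF i] cardpos[OF C] by (metis nonzero_mult_div_cancel_right not_gr_zero)
    qed
    finally show ?thesis .
  qed
  have sum: "induced_character G V \<mu> g = (\<Sum>d\<in>T. of_nat d * (\<Sum>\<chi>\<in>X d. \<chi> g))" if g: "g \<in> carrier G" for g
  proof -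
    have "induced_character G V \<mu> g = (\<Sum>d\<in>T. \<Sum>p\<in>?P d. Ind p g)"
      unfolding total[OF g, symmetric]
      by (rule sum.group[symmetric]) (use finP T in \<open>auto simp: P_def\<close>)
    thus ?thesis by (simp add: group_sum[of "\<lambda>\<chi>. \<chi> g"] sum_distrib_left)
  qed
  have irr: "X d \<subseteq> irr_characters G" "\<forall>\<chi>\<in>X d. \<chi> \<one> = of_nat d" for d
    using Iirr P_deg1 unfolding X_def by blast+
  show ?thesis
    by (intro exI[of _ X] conjI allI) (rule irr cnt ballI sum, assumption?)+
qed

end

section \<open>A coordinate model of the quotient group\<close>

text \<open>
  An element of the quotient group is given by its nine generator entries and its eleven entries in the
  derived subgroup. The name of a coordinate is the position of the matrix entry; the prefix \<open>z\<close> marks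
  the central subgroup \<open>V\<close>.
\<close>

datatype 'a gen = Gen (x12: 'a) (x23: 'a) (x34: 'a) (x25: 'a) (x48: 'a) (x56: 'a) (x67: 'a) (x78: 'a) (x89: 'a)

datatype 'a cen = Cen (c13: 'a) (c14: 'a) (c24: 'a) (c38: 'a) (c39: 'a) (c49: 'a)
    (z15: 'a) (z26: 'a) (z57: 'a) (z68: 'a) (z79: 'a)

lemma UNIV_gen: "UNIV = range (\<lambda>(a, b, c, d, e, f, g, h, i). Gen a b c d e f g h i)"
proof -
  have "x \<in> range (\<lambda>(a, b, c, d, e, f, g, h, i). Gen a b c d e f g h i)" for x :: "'a gen"
    by (cases x) (auto simp: image_iff)
  thus ?thesis by auto
qed

lemma UNIV_cen: "UNIV = range (\<lambda>(a, b, c, d, e, f, g, h, i, j, k). Cen a b c d e f g h i j k)"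
proof -
  have "x \<in> range (\<lambda>(a, b, c, d, e, f, g, h, i, j, k). Cen a b c d e f g h i j k)" for x :: "'a cen"
    by (cases x) (auto simp: image_iff)
  thus ?thesis by auto
qed

instance gen :: (finite) finite
  by standard (subst UNIV_gen, rule finite_imageI, simp)

instance cen :: (finite) finite
  by standard (subst UNIV_cen, rule finite_imageI, simp)

lemma card_UNIV_prod: "card (UNIV :: ('a::finite \<times> 'b::finite) set) = card (UNIV :: 'a set) * card (UNIV :: 'b set)"
  by (simp add: UNIV_Times_UNIV[symmetric] card_cartesian_product del: UNIV_Times_UNIV)

lemma card_UNIV_gen: "card (UNIV :: 'a::finite gen set) = card (UNIV :: 'a set) ^ 9"
proof -
  have "inj (\<lambda>(a, b, c, d, e, f, g, h, i). Gen a b c d e f g h i :: 'a gen)" by (auto intro: injI)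
  hence "card (UNIV :: 'a gen set) = card (UNIV :: ('a \<times> 'a \<times> 'a \<times> 'a \<times> 'a \<times> 'a \<times> 'a \<times> 'a \<times> 'a) set)"
    by (subst UNIV_gen) (rule card_image)
  thus ?thesis by (simp add: card_UNIV_prod eval_nat_numeral)
qed

lemma card_UNIV_cen: "card (UNIV :: 'a::finite cen set) = card (UNIV :: 'a set) ^ 11"
proof -
  have "inj (\<lambda>(a, b, c, d, e, f, g, h, i, j, k). Cen a b c d e f g h i j k :: 'a cen)" by (auto intro: injI)
  hence "card (UNIV :: 'a cen set) =
      card (UNIV :: ('a \<times> 'a \<times> 'a \<times> 'a \<times> 'a \<times> 'a \<times> 'a \<times> 'a \<times> 'a \<times> 'a \<times> 'a) set)"
    by (subst UNIV_cen) (rule card_image)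
  thus ?thesis by (simp add: card_UNIV_prod eval_nat_numeral)
qed

definition gen_zero :: "'a::zero gen" where "gen_zero = Gen 0 0 0 0 0 0 0 0 0"

definition cen_zero :: "'a::zero cen" where "cen_zero = Cen 0 0 0 0 0 0 0 0 0 0 0"

text \<open>
  Matrix multiplication with the ten positions of \<open>K \<inter> R\<close> discarded: entry \<open>ik\<close> of a product receives
  \<open>ij\<close> times \<open>jk\<close> for those \<open>j\<close> where both positions belong to \<open>R\<close>.
\<close>

definition model_mult :: "'a::field gen \<times> 'a cen \<Rightarrow> 'a gen \<times> 'a cen \<Rightarrow> 'a gen \<times> 'a cen" where
  "model_mult = (\<lambda>(x, c) (y, d).
     (Gen (x12 x + x12 y) (x23 x + x23 y) (x34 x + x34 y) (x25 x + x25 y) (x48 x + x48 y)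
          (x56 x + x56 y) (x67 x + x67 y) (x78 x + x78 y) (x89 x + x89 y),
      Cen (c13 c + c13 d + x12 x * x23 y)
          (c14 c + c14 d + x12 x * c24 d + c13 c * x34 y)
          (c24 c + c24 d + x23 x * x34 y)
          (c38 c + c38 d + x34 x * x48 y)
          (c39 c + c39 d + x34 x * c49 d + c38 c * x89 y)
          (c49 c + c49 d + x48 x * x89 y)
          (z15 c + z15 d + x12 x * x25 y)
          (z26 c + z26 d + x25 x * x56 y)
          (z57 c + z57 d + x56 x * x67 y)
          (z68 c + z68 d + x67 x * x78 y)
          (z79 c + z79 d + x78 x * x89 y)))"

definition model :: "('a::field gen \<times> 'a cen) monoid" where
  "model = \<lparr>carrier = UNIV, monoid.mult = model_mult, one = (gen_zero, cen_zero)\<rparr>"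

lemma model_simps [simp]:
  "carrier model = UNIV" "g \<otimes>\<^bsub>model\<^esub> h = model_mult g h" "\<one>\<^bsub>model\<^esub> = (gen_zero, cen_zero)"
  by (simp_all add: model_def)

lemma model_group: "group (model :: ('a::field gen \<times> 'a cen) monoid)"
proof (rule groupI)
  fix g h k :: "'a gen \<times> 'a cen"
  show "g \<otimes>\<^bsub>model\<^esub> h \<otimes>\<^bsub>model\<^esub> k = g \<otimes>\<^bsub>model\<^esub> (h \<otimes>\<^bsub>model\<^esub> k)"
    by (simp add: model_mult_def split_beta algebra_simps)
next
  fix g :: "'a gen \<times> 'a cen"
  obtain x c where g: "g = (x, c)" by force
  let ?h = "(Gen (- x12 x) (- x23 x) (- x34 x) (- x25 x) (- x48 x) (- x56 x) (- x67 x) (- x78 x) (- x89 x),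
    Cen (x12 x * x23 x - c13 c) (x12 x * c24 c - (x12 x * x23 x - c13 c) * x34 x - c14 c) (x23 x * x34 x - c24 c)
        (x34 x * x48 x - c38 c) (x34 x * c49 c - (x34 x * x48 x - c38 c) * x89 x - c39 c) (x48 x * x89 x - c49 c)
        (x12 x * x25 x - z15 c) (x25 x * x56 x - z26 c) (x56 x * x67 x - z57 c) (x67 x * x78 x - z68 c)
        (x78 x * x89 x - z79 c))"
  have "?h \<otimes>\<^bsub>model\<^esub> g = \<one>\<^bsub>model\<^esub>"
    by (simp add: model_mult_def g gen_zero_def cen_zero_def algebra_simps)
  thus "\<exists>h\<in>carrier model. h \<otimes>\<^bsub>model\<^esub> g = \<one>\<^bsub>model\<^esub>" by (intro bexI[of _ ?h]) simp_all
next
  fix g :: "'a gen \<times> 'a cen"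
  show "\<one>\<^bsub>model\<^esub> \<otimes>\<^bsub>model\<^esub> g = g"
    by (cases g) (simp add: model_mult_def gen_zero_def cen_zero_def)
qed simp_all

text \<open>
  The commutator of two elements of the model. Apart from the correction terms at \<open>14\<close> and \<open>39\<close>, which
  come from the nilpotency class 3, it is the alternating expression in the edges of a nine-cycle on the
  generators.
\<close>

definition model_comm :: "'a::field gen \<times> 'a cen \<Rightarrow> 'a gen \<times> 'a cen \<Rightarrow> 'a cen" where
  "model_comm = (\<lambda>(x, c) (y, d).
     Cen (x12 x * x23 y - x12 y * x23 x)
         (x12 x * c24 d - x12 y * c24 c + c13 c * x34 y - c13 d * x34 x
            - (x12 x * x23 y - x12 y * x23 x) * (x34 x + x34 y))
         (x23 x * x34 y - x23 y * x34 x)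
         (x34 x * x48 y - x34 y * x48 x)
         (x34 x * c49 d - x34 y * c49 c + c38 c * x89 y - c38 d * x89 x
            - (x34 x * x48 y - x34 y * x48 x) * (x89 x + x89 y))
         (x48 x * x89 y - x48 y * x89 x)
         (x12 x * x25 y - x12 y * x25 x)
         (x25 x * x56 y - x25 y * x56 x)
         (x56 x * x67 y - x56 y * x67 x)
         (x67 x * x78 y - x67 y * x78 x)
         (x78 x * x89 y - x78 y * x89 x))"

lemma (in finite_group) commutator_unique:
  assumes "g \<in> carrier G" "h \<in> carrier G" "k \<in> carrier G" "g \<otimes> h = k \<otimes> h \<otimes> g"
  shows "commutator g h = k"
  using assms by (simp add: commutator_def m_assoc)

lemma model_finite_group: "finite_group (model :: ('a::{field,finite} gen \<times> 'a cen) monoid)"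
  using model_group by (simp add: finite_group_def finite_group_axioms_def)

interpretation model: finite_group "model :: ('a::{field,finite} gen \<times> 'a cen) monoid"
  by (rule model_finite_group)

lemma commutator_M: "finite_group.commutator model g h = (gen_zero, model_comm g h)"
  for g h :: "'a::{field,finite} gen \<times> 'a cen"
  by (rule model.commutator_unique)
     (simp_all add: model_mult_def model_comm_def gen_zero_def split_beta algebra_simps)

text \<open>The weights \<open>((b, p), (c, t), (r, s))\<close> at the positions \<open>((14, 13), (39, 49), (24, 38))\<close>.\<close>

type_synonym 'a idx = "('a \<times> 'a) \<times> ('a \<times> 'a) \<times> ('a \<times> 'a)"

definition model_C :: "('a::field gen \<times> 'a cen) set" where
  "model_C = {gen_zero} \<times> UNIV"

definition model_V :: "('a::field gen \<times> 'a cen) set" where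
  "model_V = {gen_zero} \<times> {c. c13 c = 0 \<and> c14 c = 0 \<and> c24 c = 0 \<and> c38 c = 0 \<and> c39 c = 0 \<and> c49 c = 0}"

lemma model_mult_C:
  "model_mult (gen_zero, c) (gen_zero, d) = (gen_zero,
     Cen (c13 c + c13 d) (c14 c + c14 d) (c24 c + c24 d) (c38 c + c38 d) (c39 c + c39 d) (c49 c + c49 d)
       (z15 c + z15 d) (z26 c + z26 d) (z57 c + z57 d) (z68 c + z68 d) (z79 c + z79 d))"
  by (simp add: model_mult_def gen_zero_def)

lemma model_V_central: "v \<in> model_V \<Longrightarrow> model_mult v g = model_mult g v"
  by (auto simp: model_V_def model_mult_def gen_zero_def split_beta algebra_simps)

text \<open>Additive subsets of the abelianisation give subgroups containing the derived subgroup.\<close>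

lemma subgroup_over_C:
  fixes L :: "'a::{field,finite} gen set"
  assumes "gen_zero \<in> L" and "\<And>x y. x \<in> L \<Longrightarrow> y \<in> L \<Longrightarrow> Gen (x12 x + x12 y) (x23 x + x23 y) (x34 x + x34 y)
     (x25 x + x25 y) (x48 x + x48 y) (x56 x + x56 y) (x67 x + x67 y) (x78 x + x78 y) (x89 x + x89 y) \<in> L"
  shows "subgroup (L \<times> UNIV) model"
  by (rule model.mult_closed_subgroup) (use assms in \<open>auto simp: model_mult_def\<close>)

lemma model_C_subgroup: "subgroup (model_C :: ('a::{field,finite} gen \<times> 'a cen) set) model"
  unfolding model_C_def by (rule subgroup_over_C) (auto simp: gen_zero_def)

lemma model_V_subgroup: "subgroup (model_V :: ('a::{field,finite} gen \<times> 'a cen) set) model"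
proof (rule model.mult_closed_subgroup)
  have "(gen_zero, cen_zero) \<in> model_V" by (simp add: model_V_def cen_zero_def)
  thus "model_V \<noteq> {}" by blast
qed (auto simp: model_V_def model_mult_C)

lemma card_M_C: "card (model_C :: ('a::{field,finite} gen \<times> 'a cen) set) = card (UNIV :: 'a set) ^ 11"
  by (simp add: model_C_def card_cartesian_product card_UNIV_cen)

lemma card_M_V: "card (model_V :: ('a::{field,finite} gen \<times> 'a cen) set) = card (UNIV :: 'a set) ^ 5"
proof -
  let ?f = "\<lambda>(a, b, c, d, e). (gen_zero, Cen 0 0 0 0 0 0 a b c d e) :: 'a gen \<times> 'a cen"
  have "g \<in> range ?f" if g: "g \<in> model_V" for g :: "'a gen \<times> 'a cen"
  proof -
    obtain c where c: "g = (gen_zero, c)" using g by (auto simp: model_V_def)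
    thus ?thesis using g by (cases c) (auto simp: model_V_def image_iff)
  qed
  hence "(model_V :: ('a gen \<times> 'a cen) set) = range ?f" by (auto simp: model_V_def)
  hence "card (model_V :: ('a gen \<times> 'a cen) set) = card (range ?f)" by (rule arg_cong)
  also have "\<dots> = card (UNIV :: ('a \<times> 'a \<times> 'a \<times> 'a \<times> 'a) set)"
    by (rule card_image) (auto intro: injI)
  finally have "card (model_V :: ('a gen \<times> 'a cen) set) = card (UNIV :: ('a \<times> 'a \<times> 'a \<times> 'a \<times> 'a) set)" .
  thus ?thesis by (simp add: card_UNIV_prod eval_nat_numeral)
qed

section \<open>Self-centralising subgroups of the model\<close>

lemma sum_UNIV_prod:
  "(\<Sum>x\<in>(UNIV :: ('b::finite \<times> 'c::finite) set). f x) = (\<Sum>a\<in>UNIV. \<Sum>b\<in>UNIV. f (a, b))"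
  by (simp add: sum.cartesian_product)

text \<open>
  The parameters \<open>a1, \<dots>, a5\<close> describe the central character at \<open>15, 26, 57, 68, 79\<close>.
\<close>

locale weighted_model =
  fixes \<phi> :: "'a::{field,finite} \<Rightarrow> complex" and a1 a2 a3 a4 a5 :: 'a
  assumes phi_add: "\<And>x y. \<phi> (x + y) = \<phi> x * \<phi> y" and phi_nz: "\<And>x. \<phi> x \<noteq> 0"
    and phi_nontrivial: "\<exists>c. \<phi> c \<noteq> 1"
    and a_nz: "a1 \<noteq> 0" "a2 \<noteq> 0" "a3 \<noteq> 0" "a4 \<noteq> 0" "a5 \<noteq> 0"
begin

lemma phi_0: "\<phi> 0 = 1"
  using phi_add[of 0 0] phi_nz[of 0] by simp

lemma phi_trivialD:
  assumes "\<And>u. \<phi> (u * k) = 1"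
  shows "k = 0"
proof (rule ccontr)
  assume k: "k \<noteq> 0"
  obtain c where c: "\<phi> c \<noteq> 1" using phi_nontrivial by blast
  have "\<phi> (c / k * k) = 1" by (rule assms)
  thus False using k c by simp
qed

lemma sum_phi: "(\<Sum>u\<in>UNIV. \<phi> (u * k)) = (if k = 0 then of_nat (card (UNIV :: 'a set)) else 0)"
proof (cases "k = 0")
  case False
  then obtain c where c: "\<phi> (c * k) \<noteq> 1" using phi_trivialD by blast
  have "(\<Sum>u\<in>UNIV. \<phi> (u * k)) = (\<Sum>u\<in>UNIV. \<phi> ((c + u) * k))"
    by (rule sum.reindex_bij_witness[of _ "\<lambda>u. c + u" "\<lambda>u. u - c"]) auto
  also have "\<dots> = \<phi> (c * k) * (\<Sum>u\<in>UNIV. \<phi> (u * k))"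
    by (simp add: ring_distribs phi_add sum_distrib_left)
  finally show ?thesis using c False by simp
qed (simp add: phi_0)

definition central_form :: "'a cen \<Rightarrow> 'a" where
  "central_form z = a1 * z15 z + a2 * z26 z + a3 * z57 z + a4 * z68 z + a5 * z79 z"

definition form :: "'a idx \<Rightarrow> 'a cen \<Rightarrow> 'a" where
  "form = (\<lambda>((b, p), (c, t), (r, s)) z. central_form z +
     b * c14 z + p * c13 z + c * c39 z + t * c49 z + r * c24 z + s * c38 z)"

definition mu :: "'a gen \<times> 'a cen \<Rightarrow> complex" where
  "mu = (\<lambda>g\<in>model_V. \<phi> (central_form (snd g)))"

definition lam :: "'a idx \<Rightarrow> 'a gen \<times> 'a cen \<Rightarrow> complex" where
  "lam i = (\<lambda>g\<in>model_C. \<phi> (form i (snd g)))"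

lemma lam_linear: "linear_character (model\<lparr>carrier := model_C\<rparr>) (lam i)"
proof -
  obtain b p c t r s where i: "i = ((b, p), (c, t), (r, s))" by (metis prod.exhaust)
  have C: "g \<in> model_C \<Longrightarrow> h \<in> model_C \<Longrightarrow> model_mult g h \<in> model_C" for g h :: "'a gen \<times> 'a cen"
    by (auto simp: model_C_def model_mult_C)
  have "form i (snd (model_mult g h)) = form i (snd g) + form i (snd h)" if "g \<in> model_C" "h \<in> model_C" for g h
    using that by (auto simp: model_C_def model_mult_C form_def central_form_def i algebra_simps)
  thus ?thesis
    using C by (auto simp: linear_character_on_iff lam_def phi_add phi_nz)
qed

lemma lam_M_V: "v \<in> model_V \<Longrightarrow> lam i v = mu v"
  by (cases i) (auto simp: model_V_def model_C_def lam_def mu_def form_def)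

text \<open>
  Summing \<open>\<phi>(u k)\<close> over all values \<open>u\<close> of a weight detects whether the entry \<open>k\<close> vanishes, so only the
  elements of \<open>V\<close> survive.
\<close>

lemma sum_lam:
  assumes g: "g \<in> model_C"
  shows "(\<Sum>i\<in>UNIV. lam i g) =
    (if g \<in> model_V then of_nat (card (model_C :: ('a gen \<times> 'a cen) set)) / of_nat (card (model_V :: ('a gen \<times> 'a cen) set)) * mu g else 0)"
proof -
  obtain z where z: "g = (gen_zero, z)" using g by (auto simp: model_C_def)
  define S where "S = (\<lambda>k. \<Sum>u\<in>UNIV. \<phi> (u * k))"
  let ?q = "of_nat (card (UNIV :: 'a set)) :: complex"
  have q: "?q \<noteq> 0" by simp
  have "(\<Sum>i\<in>UNIV. lam i g) = (\<Sum>b\<in>UNIV. \<Sum>p\<in>UNIV. \<Sum>c\<in>UNIV. \<Sum>t\<in>UNIV. \<Sum>r\<in>UNIV. \<Sum>s\<in>UNIV.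
      \<phi> (central_form z) * \<phi> (b * c14 z) * \<phi> (p * c13 z) * \<phi> (c * c39 z) * \<phi> (t * c49 z) * \<phi> (r * c24 z) * \<phi> (s * c38 z))"
    using g by (simp add: sum_UNIV_prod lam_def form_def z phi_add)
  also have "\<dots> = \<phi> (central_form z) * S (c14 z) * S (c13 z) * S (c39 z) * S (c49 z) * S (c24 z) * S (c38 z)"
    by (simp add: S_def sum_distrib_left[symmetric] sum_distrib_right[symmetric])
  also have "\<dots> = (if g \<in> model_V then ?q ^ 6 * \<phi> (central_form z) else 0)"
    by (simp add: S_def sum_phi z model_V_def eval_nat_numeral)
  also have "\<dots> = (if g \<in> model_V then of_nat (card (model_C :: ('a gen \<times> 'a cen) set)) /
      of_nat (card (model_V :: ('a gen \<times> 'a cen) set)) * mu g else 0)"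
    using q by (simp add: card_M_C card_M_V mu_def z power_diff[symmetric] eval_nat_numeral)
  finally show ?thesis .
qed

text \<open>
  Images in \<open>R / C\<close> of the self-centralising subgroups. The generators \<open>23, 25, 48, 67\<close> commute pairwise and
  always give \<open>L_generic\<close>. When \<open>c = t = 0\<close> the generator \<open>89\<close> commutes with them modulo the kernel
  (\<open>L_lower\<close>); when \<open>b = p = 0\<close> one may use \<open>12, 23, 48, 56, 78\<close> instead (\<open>L_upper\<close>); when moreover
  \<open>b = c = r = s = 0\<close>, each can be enlarged by \<open>34\<close>. \<open>L_cycle\<close> is the centraliser of \<open>L_generic\<close> for
  \<open>b = c = 0\<close>; when \<open>p\<close> and \<open>t\<close> are nonzero, its elements are determined modulo \<open>L_generic\<close> by the entry
  at \<open>34\<close>.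
\<close>

definition L_generic :: "'a gen set" where
  "L_generic = {x. x12 x = 0 \<and> x34 x = 0 \<and> x56 x = 0 \<and> x78 x = 0 \<and> x89 x = 0}"
definition L_lower :: "'a gen set" where
  "L_lower = {x. x12 x = 0 \<and> x34 x = 0 \<and> x56 x = 0 \<and> x78 x = 0}"
definition L_upper :: "'a gen set" where
  "L_upper = {x. x34 x = 0 \<and> x25 x = 0 \<and> x67 x = 0 \<and> x89 x = 0}"
definition L_cycle :: "'a \<Rightarrow> 'a \<Rightarrow> 'a \<Rightarrow> 'a \<Rightarrow> 'a gen set" where
  "L_cycle p t r s = {x. p * x12 x = r * x34 x \<and> t * x89 x = s * x34 x \<and> a1 * x12 x = a2 * x56 x \<and> a3 * x56 x = a4 * x78 x}"
definition L_upper_wide :: "'a gen set" where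
  "L_upper_wide = {x. x25 x = 0 \<and> x67 x = 0 \<and> x89 x = 0}"
definition L_lower_wide :: "'a gen set" where
  "L_lower_wide = {x. x12 x = 0 \<and> x56 x = 0 \<and> x78 x = 0}"

lemmas L_defs = L_generic_def L_lower_def L_upper_def L_cycle_def L_upper_wide_def L_lower_wide_def

text \<open>
  By definition of \<open>lam\<close> this says that \<open>L \<times> UNIV\<close> is its own centraliser modulo the kernel of \<open>lam i\<close>.
\<close>

definition selfcentralising :: "'a idx \<Rightarrow> 'a gen set \<Rightarrow> bool" where
  "selfcentralising i L \<longleftrightarrow>
     (\<forall>g. g \<in> L \<times> UNIV \<longleftrightarrow> (\<forall>a\<in>L \<times> UNIV. \<phi> (form i (model_comm g a)) = 1))"

text \<open>
  Testing against a one-parameter family on which the form is \<open>u k\<close> forces \<open>k = 0\<close>, as \<open>\<phi>\<close> is nontrivial.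
\<close>

lemma selfcent_test:
  assumes "\<forall>a\<in>L \<times> UNIV. \<phi> (form i (model_comm g a)) = 1" "\<And>u. f u \<in> L \<times> UNIV"
    "\<And>u. form i (model_comm g (f u)) = u * k"
  shows "k = 0"
  by (rule phi_trivialD) (use assms in metis)

lemmas eval_simps = form_def central_form_def model_comm_def gen_zero_def cen_zero_def

text \<open>
  The equations obtained from the commutators with \<open>24, 13, 49, 38\<close> and with the generators
  \<open>12, 23, 25, 48, 56, 67, 78, 89\<close>, in this order.
\<close>

lemma selfcent_tests:
  assumes "\<forall>a\<in>L \<times> UNIV. \<phi> (form ((b, p), (c, t), (r, s)) (model_comm (x, z) a)) = 1"
  shows "gen_zero \<in> L \<Longrightarrow> b * x12 x = 0"
    and "gen_zero \<in> L \<Longrightarrow> b * x34 x = 0"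
    and "gen_zero \<in> L \<Longrightarrow> c * x34 x = 0"
    and "gen_zero \<in> L \<Longrightarrow> c * x89 x = 0"
    and "(\<And>u. Gen u 0 0 0 0 0 0 0 0 \<in> L) \<Longrightarrow> b * (x23 x * x34 x - c24 z) - p * x23 x - a1 * x25 x = 0"
    and "(\<And>u. Gen 0 u 0 0 0 0 0 0 0 \<in> L) \<Longrightarrow> p * x12 x - r * x34 x - b * x12 x * x34 x = 0"
    and "(\<And>u. Gen 0 0 0 u 0 0 0 0 0 \<in> L) \<Longrightarrow> a1 * x12 x - a2 * x56 x = 0"
    and "(\<And>u. Gen 0 0 0 0 u 0 0 0 0 \<in> L) \<Longrightarrow> s * x34 x - t * x89 x - c * x34 x * x89 x = 0"
    and "(\<And>u. Gen 0 0 0 0 0 u 0 0 0 \<in> L) \<Longrightarrow> a2 * x25 x - a3 * x67 x = 0"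
    and "(\<And>u. Gen 0 0 0 0 0 0 u 0 0 \<in> L) \<Longrightarrow> a3 * x56 x - a4 * x78 x = 0"
    and "(\<And>u. Gen 0 0 0 0 0 0 0 u 0 \<in> L) \<Longrightarrow> a4 * x67 x - a5 * x89 x = 0"
    and "(\<And>u. Gen 0 0 0 0 0 0 0 0 u \<in> L) \<Longrightarrow> t * x48 x + a5 * x78 x + c * c38 z = 0"
proof -
  note T = selfcent_test[OF assms] and E = eval_simps algebra_simps
  show "gen_zero \<in> L \<Longrightarrow> b * x12 x = 0"
    by (rule T[of "\<lambda>u. (gen_zero, Cen 0 0 u 0 0 0 0 0 0 0 0)"]) (simp_all add: E)
  have "gen_zero \<in> L \<Longrightarrow> - (b * x34 x) = 0"
    by (rule T[of "\<lambda>u. (gen_zero, Cen u 0 0 0 0 0 0 0 0 0 0)"]) (simp_all add: E)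
  thus "gen_zero \<in> L \<Longrightarrow> b * x34 x = 0" by simp
  show "gen_zero \<in> L \<Longrightarrow> c * x34 x = 0"
    by (rule T[of "\<lambda>u. (gen_zero, Cen 0 0 0 0 0 u 0 0 0 0 0)"]) (simp_all add: E)
  have "gen_zero \<in> L \<Longrightarrow> - (c * x89 x) = 0"
    by (rule T[of "\<lambda>u. (gen_zero, Cen 0 0 0 u 0 0 0 0 0 0 0)"]) (simp_all add: E)
  thus "gen_zero \<in> L \<Longrightarrow> c * x89 x = 0" by simp
  show "(\<And>u. Gen u 0 0 0 0 0 0 0 0 \<in> L) \<Longrightarrow> b * (x23 x * x34 x - c24 z) - p * x23 x - a1 * x25 x = 0"
    by (rule T[of "\<lambda>u. (Gen u 0 0 0 0 0 0 0 0, cen_zero)"]) (simp_all add: E)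
  show "(\<And>u. Gen 0 u 0 0 0 0 0 0 0 \<in> L) \<Longrightarrow> p * x12 x - r * x34 x - b * x12 x * x34 x = 0"
    by (rule T[of "\<lambda>u. (Gen 0 u 0 0 0 0 0 0 0, cen_zero)"]) (simp_all add: E)
  show "(\<And>u. Gen 0 0 0 u 0 0 0 0 0 \<in> L) \<Longrightarrow> a1 * x12 x - a2 * x56 x = 0"
    by (rule T[of "\<lambda>u. (Gen 0 0 0 u 0 0 0 0 0, cen_zero)"]) (simp_all add: E)
  show "(\<And>u. Gen 0 0 0 0 u 0 0 0 0 \<in> L) \<Longrightarrow> s * x34 x - t * x89 x - c * x34 x * x89 x = 0"
    by (rule T[of "\<lambda>u. (Gen 0 0 0 0 u 0 0 0 0, cen_zero)"]) (simp_all add: E)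
  show "(\<And>u. Gen 0 0 0 0 0 u 0 0 0 \<in> L) \<Longrightarrow> a2 * x25 x - a3 * x67 x = 0"
    by (rule T[of "\<lambda>u. (Gen 0 0 0 0 0 u 0 0 0, cen_zero)"]) (simp_all add: E)
  show "(\<And>u. Gen 0 0 0 0 0 0 u 0 0 \<in> L) \<Longrightarrow> a3 * x56 x - a4 * x78 x = 0"
    by (rule T[of "\<lambda>u. (Gen 0 0 0 0 0 0 u 0 0, cen_zero)"]) (simp_all add: E)
  show "(\<And>u. Gen 0 0 0 0 0 0 0 u 0 \<in> L) \<Longrightarrow> a4 * x67 x - a5 * x89 x = 0"
    by (rule T[of "\<lambda>u. (Gen 0 0 0 0 0 0 0 u 0, cen_zero)"]) (simp_all add: E)
  show "(\<And>u. Gen 0 0 0 0 0 0 0 0 u \<in> L) \<Longrightarrow> t * x48 x + a5 * x78 x + c * c38 z = 0"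
    by (rule T[of "\<lambda>u. (Gen 0 0 0 0 0 0 0 0 u, cen_zero)"]) (simp_all add: E)
qed

lemma selfcentI:
  assumes "\<And>x z y w. x \<in> L \<Longrightarrow> y \<in> L \<Longrightarrow> form i (model_comm (x, z) (y, w)) = 0"
    and "\<And>x z. \<forall>a\<in>L \<times> UNIV. \<phi> (form i (model_comm (x, z) a)) = 1 \<Longrightarrow> x \<in> L"
  shows "selfcentralising i L"
  unfolding selfcentralising_def
proof (intro allI iffI ballI)
  fix g a assume "g \<in> L \<times> (UNIV :: 'a cen set)" "a \<in> L \<times> (UNIV :: 'a cen set)"
  thus "\<phi> (form i (model_comm g a)) = 1" using assms(1) phi_0 by (cases g; cases a) simp
next
  fix g assume "\<forall>a\<in>L \<times> UNIV. \<phi> (form i (model_comm g a)) = 1"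
  thus "g \<in> L \<times> UNIV" using assms(2)[of "fst g" "snd g"] by (cases g) (simp only: prod.sel, simp)
qed

lemma selfcent_L_generic:
  assumes "(b, p) \<noteq> (0, 0)" "(c, t) \<noteq> (0, 0)" "b \<noteq> 0 \<or> c \<noteq> 0"
  shows "selfcentralising ((b, p), (c, t), (r, s)) L_generic"
proof (rule selfcentI)
  fix x y and z w :: "'a cen" assume "x \<in> L_generic" "y \<in> L_generic"
  thus "form ((b, p), (c, t), (r, s)) (model_comm (x, z) (y, w)) = 0" by (simp add: eval_simps L_generic_def)
next
  fix x z assume T: "\<forall>a\<in>L_generic \<times> UNIV. \<phi> (form ((b, p), (c, t), (r, s)) (model_comm (x, z) a)) = 1"
  have e: "b * x12 x = 0" "b * x34 x = 0" "c * x34 x = 0" "c * x89 x = 0"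
    "p * x12 x - r * x34 x - b * x12 x * x34 x = 0" "s * x34 x - t * x89 x - c * x34 x * x89 x = 0"
    "a1 * x12 x - a2 * x56 x = 0" "a3 * x56 x - a4 * x78 x = 0"
    by (rule selfcent_tests[OF T]; simp add: L_generic_def gen_zero_def)+
  have x34: "x34 x = 0" using e(2,3) assms by auto
  have x12: "x12 x = 0" using e(1,5) x34 assms by auto
  have x89: "x89 x = 0" using e(4,6) x34 assms by auto
  have "x56 x = 0" using e(7) x12 a_nz by simp
  moreover from this have "x78 x = 0" using e(8) a_nz by simp
  ultimately show "x \<in> L_generic" using x34 x12 x89 by (simp add: L_generic_def)
qed

lemma selfcent_L_lower:
  assumes "c = 0" "t = 0" "b \<noteq> 0 \<or> r \<noteq> 0 \<or> s \<noteq> 0"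
  shows "selfcentralising ((b, p), (c, t), (r, s)) L_lower"
proof (rule selfcentI)
  fix x y and z w :: "'a cen" assume "x \<in> L_lower" "y \<in> L_lower"
  thus "form ((b, p), (c, t), (r, s)) (model_comm (x, z) (y, w)) = 0" using assms by (simp add: eval_simps L_lower_def)
next
  fix x z assume T: "\<forall>a\<in>L_lower \<times> UNIV. \<phi> (form ((b, p), (c, t), (r, s)) (model_comm (x, z) a)) = 1"
  have e: "b * x34 x = 0" "t * x48 x + a5 * x78 x + c * c38 z = 0"
    "p * x12 x - r * x34 x - b * x12 x * x34 x = 0" "s * x34 x - t * x89 x - c * x34 x * x89 x = 0"
    "a1 * x12 x - a2 * x56 x = 0" "a3 * x56 x - a4 * x78 x = 0"
    by (rule selfcent_tests[OF T]; simp add: L_lower_def gen_zero_def)+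
  have x78: "x78 x = 0" using e(2) assms a_nz by simp
  have x56: "x56 x = 0" using e(6) x78 a_nz by simp
  have x12: "x12 x = 0" using e(5) x56 a_nz by simp
  have "x34 x = 0" using e(1,3,4) x12 assms by auto
  thus "x \<in> L_lower" using x78 x56 x12 by (simp add: L_lower_def)
qed

lemma selfcent_L_upper:
  assumes "b = 0" "p = 0" "c \<noteq> 0 \<or> r \<noteq> 0 \<or> s \<noteq> 0"
  shows "selfcentralising ((b, p), (c, t), (r, s)) L_upper"
proof (rule selfcentI)
  fix x y and z w :: "'a cen" assume "x \<in> L_upper" "y \<in> L_upper"
  thus "form ((b, p), (c, t), (r, s)) (model_comm (x, z) (y, w)) = 0" using assms by (simp add: eval_simps L_upper_def)
next
  fix x z assume T: "\<forall>a\<in>L_upper \<times> UNIV. \<phi> (form ((b, p), (c, t), (r, s)) (model_comm (x, z) a)) = 1"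
  have e: "c * x34 x = 0" "b * (x23 x * x34 x - c24 z) - p * x23 x - a1 * x25 x = 0"
    "p * x12 x - r * x34 x - b * x12 x * x34 x = 0" "s * x34 x - t * x89 x - c * x34 x * x89 x = 0"
    "a2 * x25 x - a3 * x67 x = 0" "a4 * x67 x - a5 * x89 x = 0"
    by (rule selfcent_tests[OF T]; simp add: L_upper_def gen_zero_def)+
  have x25: "x25 x = 0" using e(2) assms a_nz by simp
  have x67: "x67 x = 0" using e(5) x25 a_nz by simp
  have x89: "x89 x = 0" using e(6) x67 a_nz by simp
  have "x34 x = 0" using e(1,3,4) x89 assms by auto
  thus "x \<in> L_upper" using x25 x67 x89 by (simp add: L_upper_def)
qed

lemma selfcent_L_upper_wide:
  assumes "b = 0" "p = 0" "c = 0" "r = 0" "s = 0"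
  shows "selfcentralising ((b, p), (c, t), (r, s)) L_upper_wide"
proof (rule selfcentI)
  fix x y and z w :: "'a cen" assume "x \<in> L_upper_wide" "y \<in> L_upper_wide"
  thus "form ((b, p), (c, t), (r, s)) (model_comm (x, z) (y, w)) = 0" using assms by (simp add: eval_simps L_upper_wide_def)
next
  fix x z assume T: "\<forall>a\<in>L_upper_wide \<times> UNIV. \<phi> (form ((b, p), (c, t), (r, s)) (model_comm (x, z) a)) = 1"
  have e: "b * (x23 x * x34 x - c24 z) - p * x23 x - a1 * x25 x = 0"
    "a2 * x25 x - a3 * x67 x = 0" "a4 * x67 x - a5 * x89 x = 0"
    by (rule selfcent_tests[OF T]; simp add: L_upper_wide_def gen_zero_def)+
  have x25: "x25 x = 0" using e(1) assms a_nz by simp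
  have x67: "x67 x = 0" using e(2) x25 a_nz by simp
  have "x89 x = 0" using e(3) x67 a_nz by simp
  thus "x \<in> L_upper_wide" using x25 x67 by (simp add: L_upper_wide_def)
qed

lemma selfcent_L_lower_wide:
  assumes "c = 0" "t = 0" "b = 0" "r = 0" "s = 0"
  shows "selfcentralising ((b, p), (c, t), (r, s)) L_lower_wide"
proof (rule selfcentI)
  fix x y and z w :: "'a cen" assume "x \<in> L_lower_wide" "y \<in> L_lower_wide"
  thus "form ((b, p), (c, t), (r, s)) (model_comm (x, z) (y, w)) = 0" using assms by (simp add: eval_simps L_lower_wide_def)
next
  fix x z assume T: "\<forall>a\<in>L_lower_wide \<times> UNIV. \<phi> (form ((b, p), (c, t), (r, s)) (model_comm (x, z) a)) = 1"
  have e: "t * x48 x + a5 * x78 x + c * c38 z = 0"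
    "a1 * x12 x - a2 * x56 x = 0" "a3 * x56 x - a4 * x78 x = 0"
    by (rule selfcent_tests[OF T]; simp add: L_lower_wide_def gen_zero_def)+
  have x78: "x78 x = 0" using e(1) assms a_nz by simp
  have x56: "x56 x = 0" using e(3) x78 a_nz by simp
  have "x12 x = 0" using e(2) x56 a_nz by simp
  thus "x \<in> L_lower_wide" using x78 x56 by (simp add: L_lower_wide_def)
qed

text \<open>
  Two elements commute modulo the kernel because they agree up to a scalar outside \<open>L_generic\<close>; the only
  edge of the cycle with no endpoint in \<open>L_generic\<close> is the one from \<open>78\<close> to \<open>89\<close>.
\<close>

lemma selfcent_L_cycle:
  assumes "b = 0" "c = 0" "p \<noteq> 0" "t \<noteq> 0"
  shows "selfcentralising ((b, p), (c, t), (r, s)) (L_cycle p t r s)"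
proof (rule selfcentI)
  fix x y and z w :: "'a cen" assume "x \<in> L_cycle p t r s" "y \<in> L_cycle p t r s"
  hence x: "p * x12 x = r * x34 x" "t * x89 x = s * x34 x" "a1 * x12 x = a2 * x56 x" "a3 * x56 x = a4 * x78 x"
    and y: "p * x12 y = r * x34 y" "t * x89 y = s * x34 y" "a1 * x12 y = a2 * x56 y" "a3 * x56 y = a4 * x78 y"
    by (auto simp: L_cycle_def)
  have "(p * a2 * a4 * t) * (x78 x * x89 y - x78 y * x89 x) = 0"
  proof -
    have 1: "p * a2 * a4 * x78 x = a3 * a1 * r * x34 x"
    proof -
      have "p * a2 * a4 * x78 x = p * a2 * (a4 * x78 x)" by simp
      also have "\<dots> = a3 * p * (a2 * x56 x)" unfolding x(4)[symmetric] by simp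
      also have "\<dots> = a3 * a1 * (p * x12 x)" unfolding x(3)[symmetric] by simp
      finally show ?thesis unfolding x(1) by (simp add: mult_ac)
    qed
    have 2: "p * a2 * a4 * x78 y = a3 * a1 * r * x34 y"
    proof -
      have "p * a2 * a4 * x78 y = p * a2 * (a4 * x78 y)" by simp
      also have "\<dots> = a3 * p * (a2 * x56 y)" unfolding y(4)[symmetric] by simp
      also have "\<dots> = a3 * a1 * (p * x12 y)" unfolding y(3)[symmetric] by simp
      finally show ?thesis unfolding y(1) by (simp add: mult_ac)
    qed
    have "(p * a2 * a4 * t) * (x78 x * x89 y - x78 y * x89 x) =
      (p * a2 * a4 * x78 x) * (t * x89 y) - (p * a2 * a4 * x78 y) * (t * x89 x)" by (simp add: algebra_simps)
    thus ?thesis unfolding 1 2 x(2) y(2) by (simp add: algebra_simps)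
  qed
  hence last: "x78 x * x89 y - x78 y * x89 x = 0" using assms a_nz by simp
  have "form ((b, p), (c, t), (r, s)) (model_comm (x, z) (y, w)) =
      x23 y * (p * x12 x - r * x34 x) - x23 x * (p * x12 y - r * x34 y)
      + x48 y * (s * x34 x - t * x89 x) - x48 x * (s * x34 y - t * x89 y)
      + x25 y * (a1 * x12 x - a2 * x56 x) - x25 x * (a1 * x12 y - a2 * x56 y)
      + x67 y * (a3 * x56 x - a4 * x78 x) - x67 x * (a3 * x56 y - a4 * x78 y)
      + a5 * (x78 x * x89 y - x78 y * x89 x)"
    using assms by (simp add: eval_simps algebra_simps)
  thus "form ((b, p), (c, t), (r, s)) (model_comm (x, z) (y, w)) = 0"
    unfolding last x y by simp
next
  fix x z assume T: "\<forall>a\<in>L_cycle p t r s \<times> UNIV. \<phi> (form ((b, p), (c, t), (r, s)) (model_comm (x, z) a)) = 1"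
  have e: "p * x12 x - r * x34 x - b * x12 x * x34 x = 0" "s * x34 x - t * x89 x - c * x34 x * x89 x = 0"
    "a1 * x12 x - a2 * x56 x = 0" "a3 * x56 x - a4 * x78 x = 0"
    by (rule selfcent_tests[OF T]; simp add: L_cycle_def gen_zero_def)+
  thus "x \<in> L_cycle p t r s" using assms by (simp add: L_cycle_def)
qed

end

section \<open>Decomposition in the model\<close>

lemma card_parametrised:
  fixes f :: "'b \<Rightarrow> 'c"
  assumes "\<And>x. x \<in> L \<Longrightarrow> x = f (g x)" "\<And>y. f y \<in> L" "\<And>y. g (f y) = y"
  shows "card L = card (UNIV :: 'b set)"
proof -
  have "bij_betw f UNIV L"
    by (rule bij_betw_byWitness[where f' = g]) (use assms in \<open>auto simp: assms(1)[symmetric]\<close>)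
  thus ?thesis by (simp add: bij_betw_same_card)
qed

locale sized_weighted_model = weighted_model +
  fixes q :: nat
  assumes card_field [simp]: "card (UNIV :: 'a set) = q"
begin

lemma q_ge_2: "q \<ge> 2"
proof -
  have "card {0, 1 :: 'a} \<le> card (UNIV :: 'a set)" by (rule card_mono) auto
  thus ?thesis by simp
qed

lemma card_L_generic: "card L_generic = q ^ 4"
proof -
  have "card L_generic = card (UNIV :: ('a \<times> 'a \<times> 'a \<times> 'a) set)"
    by (rule card_parametrised[of _ "\<lambda>(a, b, c, d). Gen 0 a 0 b c 0 d 0 0" "\<lambda>x. (x23 x, x25 x, x48 x, x67 x)"])
       (auto simp: L_generic_def intro: gen.expand)
  thus ?thesis by (simp add: card_UNIV_prod eval_nat_numeral)
qed

lemma card_L_lower: "card L_lower = q ^ 5"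
proof -
  have "card L_lower = card (UNIV :: ('a \<times> 'a \<times> 'a \<times> 'a \<times> 'a) set)"
    by (rule card_parametrised[of _ "\<lambda>(a, b, c, d, e). Gen 0 a 0 b c 0 d 0 e" "\<lambda>x. (x23 x, x25 x, x48 x, x67 x, x89 x)"])
       (auto simp: L_lower_def intro: gen.expand)
  thus ?thesis by (simp add: card_UNIV_prod eval_nat_numeral)
qed

lemma card_L_upper: "card L_upper = q ^ 5"
proof -
  have "card L_upper = card (UNIV :: ('a \<times> 'a \<times> 'a \<times> 'a \<times> 'a) set)"
    by (rule card_parametrised[of _ "\<lambda>(a, b, c, d, e). Gen a b 0 0 c d 0 e 0" "\<lambda>x. (x12 x, x23 x, x48 x, x56 x, x78 x)"])
       (auto simp: L_upper_def intro: gen.expand)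
  thus ?thesis by (simp add: card_UNIV_prod eval_nat_numeral)
qed

lemma card_L_upper_wide: "card L_upper_wide = q ^ 6"
proof -
  have "card L_upper_wide = card (UNIV :: ('a \<times> 'a \<times> 'a \<times> 'a \<times> 'a \<times> 'a) set)"
    by (rule card_parametrised[of _ "\<lambda>(a, b, c, d, e, f). Gen a b c 0 d e 0 f 0"
          "\<lambda>x. (x12 x, x23 x, x34 x, x48 x, x56 x, x78 x)"])
       (auto simp: L_upper_wide_def intro: gen.expand)
  thus ?thesis by (simp add: card_UNIV_prod eval_nat_numeral)
qed

lemma card_L_lower_wide: "card L_lower_wide = q ^ 6"
proof -
  have "card L_lower_wide = card (UNIV :: ('a \<times> 'a \<times> 'a \<times> 'a \<times> 'a \<times> 'a) set)"
    by (rule card_parametrised[of _ "\<lambda>(a, b, c, d, e, f). Gen 0 a b c d 0 e 0 f"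
          "\<lambda>x. (x23 x, x34 x, x25 x, x48 x, x67 x, x89 x)"])
       (auto simp: L_lower_wide_def intro: gen.expand)
  thus ?thesis by (simp add: card_UNIV_prod eval_nat_numeral)
qed

lemma card_L_cycle:
  assumes "p \<noteq> 0" "t \<noteq> 0"
  shows "card (L_cycle p t r s) = q ^ 5"
proof -
  let ?u = "\<lambda>e. r * e / p" and ?v = "\<lambda>e. a1 * (r * e / p) / a2"
  have "card (L_cycle p t r s) = card (UNIV :: ('a \<times> 'a \<times> 'a \<times> 'a \<times> 'a) set)"
  proof (rule card_parametrised[of _
      "\<lambda>(a, b, c, d, e). Gen (?u e) a e b c (?v e) d (a3 * ?v e / a4) (s * e / t)"
      "\<lambda>x. (x23 x, x25 x, x48 x, x67 x, x34 x)"])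
    fix x assume x: "x \<in> L_cycle p t r s"
    have "x12 x = ?u (x34 x)" "x89 x = s * x34 x / t" "x56 x = a1 * x12 x / a2" "x78 x = a3 * x56 x / a4"
      using x assms a_nz by (auto simp: L_cycle_def field_simps)
    thus "x = (case (x23 x, x25 x, x48 x, x67 x, x34 x) of (a, b, c, d, e) \<Rightarrow>
        Gen (?u e) a e b c (?v e) d (a3 * ?v e / a4) (s * e / t))"
      by (intro gen.expand) simp
  qed (use assms a_nz in \<open>auto simp: L_cycle_def\<close>)
  thus ?thesis by (simp add: card_UNIV_prod eval_nat_numeral)
qed

text \<open>
  A self-centralising choice for each weight. The wide subspaces come first because \<open>L_lower\<close> and
  \<open>L_upper\<close> fail to be maximal exactly for their weights.
\<close>

definition polar :: "'a idx \<Rightarrow> 'a gen set" where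
  "polar = (\<lambda>((b, p), (c, t), (r, s)).
     if b = 0 \<and> c = 0 \<and> r = 0 \<and> s = 0 \<and> p = 0 then L_upper_wide
     else if b = 0 \<and> c = 0 \<and> r = 0 \<and> s = 0 \<and> t = 0 then L_lower_wide
     else if b = 0 \<and> c = 0 \<and> p \<noteq> 0 \<and> t \<noteq> 0 then L_cycle p t r s
     else if b = 0 \<and> p = 0 then L_upper
     else if c = 0 \<and> t = 0 then L_lower
     else L_generic)"

text \<open>
  Each alternative carries the hypotheses under which its subspace is self-centralising.
\<close>

lemma polar_cases:
  assumes "\<lbrakk>b = 0; p = 0; c = 0; r = 0; s = 0\<rbrakk> \<Longrightarrow> P L_upper_wide" "\<lbrakk>c = 0; t = 0; b = 0; r = 0; s = 0\<rbrakk> \<Longrightarrow> P L_lower_wide"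
    "\<lbrakk>b = 0; c = 0; p \<noteq> 0; t \<noteq> 0\<rbrakk> \<Longrightarrow> P (L_cycle p t r s)"
    "\<lbrakk>b = 0; p = 0; c \<noteq> 0 \<or> r \<noteq> 0 \<or> s \<noteq> 0\<rbrakk> \<Longrightarrow> P L_upper"
    "\<lbrakk>c = 0; t = 0; b \<noteq> 0 \<or> r \<noteq> 0 \<or> s \<noteq> 0\<rbrakk> \<Longrightarrow> P L_lower"
    "\<lbrakk>(b, p) \<noteq> (0, 0); (c, t) \<noteq> (0, 0); b \<noteq> 0 \<or> c \<noteq> 0\<rbrakk> \<Longrightarrow> P L_generic"
  shows "P (polar ((b, p), (c, t), (r, s)))"
  unfolding polar_def split if_split[of P]
proof (intro conjI impI)
  assume "\<not> (b = 0 \<and> c = 0 \<and> r = 0 \<and> s = 0 \<and> p = 0)" "b = 0 \<and> p = 0"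
  thus "P L_upper" by (intro assms(4)) auto
next
  assume "\<not> (b = 0 \<and> c = 0 \<and> r = 0 \<and> s = 0 \<and> t = 0)" "c = 0 \<and> t = 0"
  thus "P L_lower" by (intro assms(5)) auto
next
  assume "\<not> (b = 0 \<and> p = 0)" "\<not> (c = 0 \<and> t = 0)" "\<not> (b = 0 \<and> c = 0 \<and> p \<noteq> 0 \<and> t \<noteq> 0)"
  thus "P L_generic" by (intro assms(6)) auto
qed (use assms(1-3) in blast)+

lemma polar_selfcentralising:
  "g \<in> polar i \<times> UNIV \<longleftrightarrow> (\<forall>a\<in>polar i \<times> UNIV. lam i (finite_group.commutator model g a) = 1)"
proof -
  obtain b p c t r s where i: "i = ((b, p), (c, t), (r, s))" by (metis prod.exhaust)
  have "selfcentralising i (polar i)"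
    unfolding i
    by (rule polar_cases; rule selfcent_L_upper_wide selfcent_L_lower_wide selfcent_L_cycle selfcent_L_upper selfcent_L_lower selfcent_L_generic; assumption)
  hence "g \<in> polar i \<times> UNIV \<longleftrightarrow> (\<forall>a\<in>polar i \<times> UNIV. \<phi> (form i (model_comm g a)) = 1)"
    unfolding selfcentralising_def by (rule spec)
  thus ?thesis by (simp add: commutator_M lam_def model_C_def)
qed

lemma polar_subgroup: "subgroup (polar i \<times> UNIV) model"
proof -
  obtain b p c t r s where i: "i = ((b, p), (c, t), (r, s))" by (metis prod.exhaust)
  have "polar i \<in> {L_generic, L_lower, L_upper, L_cycle p t r s, L_upper_wide, L_lower_wide}" unfolding i by (rule polar_cases) simp_all
  moreover have "subgroup (L \<times> UNIV) model" if "L \<in> {L_generic, L_lower, L_upper, L_cycle p t r s, L_upper_wide, L_lower_wide}" for L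
    by (rule subgroup_over_C) (use that in \<open>auto simp: L_defs gen_zero_def ring_distribs\<close>)
  ultimately show ?thesis by blast
qed

definition idx_deg3 :: "'a idx set" where
  "idx_deg3 = {((0, p), (0, t), (0, 0)) |p t. p = 0 \<or> t = 0}"

definition idx_deg5 :: "'a idx set" where
  "idx_deg5 = {((b, p), (c, t), (r, s)) |b p c t r s. (b, p) \<noteq> (0, 0) \<and> (c, t) \<noteq> (0, 0) \<and> (b \<noteq> 0 \<or> c \<noteq> 0)}"

lemma card_polar: "card (polar i) = (if i \<in> idx_deg3 then q ^ 6 else if i \<in> idx_deg5 then q ^ 4 else q ^ 5)"
proof -
  obtain b p c t r s where i: "i = ((b, p), (c, t), (r, s))" by (metis prod.exhaust)
  have 3: "i \<in> idx_deg3 \<longleftrightarrow> b = 0 \<and> c = 0 \<and> r = 0 \<and> s = 0 \<and> (p = 0 \<or> t = 0)"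
    unfolding i idx_deg3_def by auto
  have 5: "i \<in> idx_deg5 \<longleftrightarrow> (b, p) \<noteq> (0, 0) \<and> (c, t) \<noteq> (0, 0) \<and> (b \<noteq> 0 \<or> c \<noteq> 0)"
    unfolding i idx_deg5_def by auto
  show ?thesis unfolding 3 5 unfolding i
    by (rule polar_cases) (auto simp: card_L_generic card_L_lower card_L_upper card_L_cycle card_L_upper_wide card_L_lower_wide)
qed

lemma idx_disjoint: "idx_deg3 \<inter> idx_deg5 = {}"
  by (auto simp: idx_deg3_def idx_deg5_def)

lemma card_idx_deg3: "card idx_deg3 = 2 * q - 1"
proof -
  let ?S = "{0} \<times> UNIV \<union> UNIV \<times> {0} :: ('a \<times> 'a) set"
  have "?S = {0} \<times> UNIV \<union> (UNIV - {0}) \<times> {0}" by auto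
  moreover have "card ({0} \<times> UNIV \<union> (UNIV - {0}) \<times> {0} :: ('a \<times> 'a) set) = q + (q - 1)"
    by (subst card_Un_disjoint) (auto simp: card_cartesian_product)
  ultimately have "card ?S = 2 * q - 1" using q_ge_2 by simp
  moreover have bij: "bij_betw (\<lambda>x. ((0, fst x), (0, snd x), (0, 0))) ?S idx_deg3"
    by (rule bij_betw_byWitness[where f' = "\<lambda>(u, v, w). (snd u, snd v)"]) (auto simp: idx_deg3_def)
  ultimately show ?thesis using bij_betw_same_card[OF bij] by simp
qed

text \<open>
  The pairs \<open>(b, p)\<close> and \<open>(c, t)\<close> are nonzero but not both of the form \<open>(0, *)\<close>, whence
  \<open>(q\<^sup>2 - 1)\<^sup>2 - (q - 1)\<^sup>2\<close> choices; \<open>r\<close> and \<open>s\<close> are arbitrary.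
\<close>

lemma card_idx_deg5: "card idx_deg5 = q ^ 3 * (q + 2) * (q - 1) ^ 2"
proof -
  let ?N = "UNIV - {(0, 0)} :: ('a \<times> 'a) set" and ?Z = "{0} \<times> (UNIV - {0}) :: ('a \<times> 'a) set"
  have "bij_betw (\<lambda>(u, v, w). ((u, v), w)) idx_deg5 ((?N \<times> ?N - ?Z \<times> ?Z) \<times> (UNIV :: ('a \<times> 'a) set))"
    by (rule bij_betw_byWitness[where f' = "\<lambda>((u, v), w). (u, v, w)"]) (auto simp: idx_deg5_def)
  hence "card idx_deg5 = card ((?N \<times> ?N - ?Z \<times> ?Z) \<times> (UNIV :: ('a \<times> 'a) set))"
    by (rule bij_betw_same_card)
  also have "\<dots> = card (?N \<times> ?N - ?Z \<times> ?Z) * q ^ 2"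
    by (simp add: card_cartesian_product card_UNIV_prod power2_eq_square)
  also have "card (?N \<times> ?N - ?Z \<times> ?Z) = (q ^ 2 - 1) ^ 2 - (q - 1) ^ 2"
    by (subst card_Diff_subset)
       (auto simp: card_cartesian_product card_Diff_subset card_UNIV_prod power2_eq_square)
  also have "\<dots> = q * (q + 2) * (q - 1) ^ 2"
  proof -
    obtain m where m: "q = Suc m" using q_ge_2 by (cases q) auto
    have "q ^ 2 - 1 = m * (m + 2)" by (simp add: m power2_eq_square)
    hence "(q ^ 2 - 1) ^ 2 = q * (q + 2) * m ^ 2 + m ^ 2"
      by (simp add: m power2_eq_square algebra_simps)
    thus ?thesis by (simp add: m)
  qed
  finally have "card idx_deg5 = q * (q + 2) * (q - 1) ^ 2 * q ^ 2" .
  moreover have "q * u * v * q ^ 2 = q ^ 3 * u * v" for u v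
    by (simp add: power2_eq_square power3_eq_cube mult_ac)
  ultimately show ?thesis by (simp only:)
qed

lemma card_UNIV_idx: "card (UNIV :: 'a idx set) = q ^ 6"
  by (simp add: card_UNIV_prod eval_nat_numeral)

lemma card_idx_deg4: "card (- (idx_deg3 \<union> idx_deg5)) = (q - 1) * (3 * q ^ 3 + q ^ 2 + q - 1)"
proof -
  obtain m where m: "q = Suc m" using q_ge_2 by (cases q) auto
  have "card (- (idx_deg3 \<union> idx_deg5)) = q ^ 6 - card (idx_deg3 \<union> idx_deg5)"
    unfolding Compl_eq_Diff_UNIV by (subst card_Diff_subset) (auto simp: card_UNIV_idx)
  also have "card (idx_deg3 \<union> idx_deg5) = (2 * q - 1) + q ^ 3 * (q + 2) * (q - 1) ^ 2"
    using idx_disjoint by (subst card_Un_disjoint) (auto simp: card_idx_deg3 card_idx_deg5)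
  also have "q ^ 6 - \<dots> = (q - 1) * (3 * q ^ 3 + q ^ 2 + q - 1)"
  proof -
    have "q ^ 6 = m * (3 * q ^ 3 + q ^ 2 + m) + ((2 * m + 1) + q ^ 3 * (q + 2) * m ^ 2)"
      unfolding m by (simp add: eval_nat_numeral algebra_simps)
    thus ?thesis by (simp add: m)
  qed
  finally show ?thesis .
qed

theorem model_decomposition:
  "\<exists>A B C. A \<subseteq> irr_characters model \<and> B \<subseteq> irr_characters model \<and> C \<subseteq> irr_characters model \<and>
     card A = q ^ 3 * (2 * q - 1) \<and>
     card B = q * (q - 1) * (3 * q ^ 3 + q ^ 2 + q - 1) \<and>
     card C = q ^ 2 * (q + 2) * (q - 1) ^ 2 \<and>
     (\<forall>\<chi>\<in>A. \<chi> \<one>\<^bsub>model\<^esub> = of_nat (q ^ 3)) \<and>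
     (\<forall>\<chi>\<in>B. \<chi> \<one>\<^bsub>model\<^esub> = of_nat (q ^ 4)) \<and>
     (\<forall>\<chi>\<in>C. \<chi> \<one>\<^bsub>model\<^esub> = of_nat (q ^ 5)) \<and>
     (\<forall>g\<in>carrier model. induced_character model model_V mu g =
        of_nat (q ^ 3) * (\<Sum>\<chi>\<in>A. \<chi> g) + of_nat (q ^ 4) * (\<Sum>\<chi>\<in>B. \<chi> g) + of_nat (q ^ 5) * (\<Sum>\<chi>\<in>C. \<chi> g))"
proof -
  let ?T = "{q ^ 3, q ^ 4, q ^ 5}"
  let ?A = "\<lambda>i. polar i \<times> (UNIV :: 'a cen set)"
  let ?deg = "\<lambda>i. card (carrier (model :: ('a gen \<times> 'a cen) monoid)) div card (?A i)"
  have q: "q > 1" using q_ge_2 by simp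
  have cardA: "card (?A i) = card (polar i) * q ^ 11" for i
    by (simp add: card_cartesian_product card_UNIV_cen)
  have deg: "?deg i = (if i \<in> idx_deg3 then q ^ 3 else if i \<in> idx_deg5 then q ^ 5 else q ^ 4)" for i
    unfolding cardA card_polar using q
    by (auto simp: card_UNIV_prod card_UNIV_gen card_UNIV_cen power_add[symmetric] power_diff[symmetric])
  have idx: "card (?A i) div card (model_C :: ('a gen \<times> 'a cen) set) = card (polar i)" for i
    unfolding cardA card_M_C using q by simp
  have q0: "q ^ a \<noteq> 0" for a using q by simp
  have inj: "q ^ a = q ^ b \<longleftrightarrow> a = b" for a b using q by (simp add: power_inject_exp)
  have sets: "{i\<in>UNIV. ?deg i = q ^ 3} = idx_deg3" "{i\<in>UNIV. ?deg i = q ^ 4} = - (idx_deg3 \<union> idx_deg5)" "{i\<in>UNIV. ?deg i = q ^ 5} = idx_deg5"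
    unfolding deg using idx_disjoint by (auto simp: inj)
  have "\<exists>X :: nat \<Rightarrow> ('a gen \<times> 'a cen \<Rightarrow> complex) set.
    (\<forall>d. X d \<subseteq> irr_characters model \<and> (\<forall>\<chi>\<in>X d. \<chi> \<one>\<^bsub>model\<^esub> = of_nat d) \<and>
       d * card (X d) = (\<Sum>i\<in>{i\<in>UNIV. ?deg i = d}. card (?A i) div card (model_C :: ('a gen \<times> 'a cen) set))) \<and>
    (\<forall>g\<in>carrier model. induced_character model model_V mu g = (\<Sum>d\<in>?T. of_nat d * (\<Sum>\<chi>\<in>X d. \<chi> g)))"
  proof (rule model.central_induced_decomposition[where lam = lam])
    show "model_V \<subseteq> model_C" by (auto simp: model_V_def model_C_def)
    show "v \<otimes>\<^bsub>model\<^esub> g = g \<otimes>\<^bsub>model\<^esub> v" if "v \<in> model_V" for v g :: "'a gen \<times> 'a cen"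
      using model_V_central[OF that] by simp
    show "finite_group.commutator model g h \<in> model_C" for g h :: "'a gen \<times> 'a cen"
      by (simp add: commutator_M model_C_def)
    show "model_C \<subseteq> ?A i" for i
      using subgroup.one_closed[OF polar_subgroup[of i]] by (auto simp: model_C_def)
    show "?deg i \<in> ?T" for i unfolding deg by simp
    show "subgroup (?A i) model" for i by (rule polar_subgroup)
  qed (simp_all only: model_V_subgroup model_C_subgroup lam_linear lam_M_V sum_lam finite finite.intros
         polar_selfcentralising[symmetric])
  then obtain X where X0: "\<And>d. X d \<subseteq> irr_characters model \<and> (\<forall>\<chi>\<in>X d. \<chi> \<one>\<^bsub>model\<^esub> = of_nat d) \<and>
       d * card (X d) = (\<Sum>i\<in>{i\<in>UNIV. ?deg i = d}. card (?A i) div card (model_C :: ('a gen \<times> 'a cen) set))"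
    and X4: "\<And>g. g \<in> carrier model \<Longrightarrow> induced_character model model_V mu g = (\<Sum>d\<in>?T. of_nat d * (\<Sum>\<chi>\<in>X d. \<chi> g))"
    by (elim exE conjE) blast
  have X: "X d \<subseteq> irr_characters model" "\<forall>\<chi>\<in>X d. \<chi> \<one>\<^bsub>model\<^esub> = of_nat d"
    "d * card (X d) = (\<Sum>i\<in>{i\<in>UNIV. ?deg i = d}. card (?A i) div card (model_C :: ('a gen \<times> 'a cen) set))" for d
    using X0[of d] by blast+
  have "q ^ 3 * card (X (q ^ 3)) = (\<Sum>i\<in>idx_deg3. q ^ 6)"
    unfolding X(3) sets idx by (rule sum.cong) (auto simp: card_polar)
  hence "q ^ 3 * card (X (q ^ 3)) = q ^ 3 * (q ^ 3 * (2 * q - 1))"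
    by (simp add: card_idx_deg3 eval_nat_numeral mult_ac)
  hence A: "card (X (q ^ 3)) = q ^ 3 * (2 * q - 1)" using q0 by (simp only: mult_cancel1 simp_thms)
  have "q ^ 4 * card (X (q ^ 4)) = (\<Sum>i\<in>- (idx_deg3 \<union> idx_deg5). q ^ 5)"
    unfolding X(3) sets idx by (rule sum.cong) (auto simp: card_polar)
  hence "q ^ 4 * card (X (q ^ 4)) = q ^ 4 * (q * (q - 1) * (3 * q ^ 3 + q ^ 2 + q - 1))"
    by (simp only: sum_constant card_idx_deg4) (simp add: eval_nat_numeral mult_ac)
  hence B: "card (X (q ^ 4)) = q * (q - 1) * (3 * q ^ 3 + q ^ 2 + q - 1)" using q0 by (simp only: mult_cancel1 simp_thms)
  have "q ^ 5 * card (X (q ^ 5)) = (\<Sum>i\<in>idx_deg5. q ^ 4)"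
    unfolding X(3) sets idx using idx_disjoint by (intro sum.cong) (auto simp: card_polar)
  hence "q ^ 5 * card (X (q ^ 5)) = q ^ 5 * (q ^ 2 * (q + 2) * (q - 1) ^ 2)"
    by (simp only: sum_constant card_idx_deg5) (simp add: eval_nat_numeral mult_ac)
  hence C: "card (X (q ^ 5)) = q ^ 2 * (q + 2) * (q - 1) ^ 2" using q0 by (simp only: mult_cancel1 simp_thms)
  have T: "(\<Sum>d\<in>?T. f d) = f (q ^ 3) + f (q ^ 4) + f (q ^ 5)" for f :: "nat \<Rightarrow> complex"
    by (simp add: inj)
  show ?thesis
    by (rule exI[of _ "X (q ^ 3)"], rule exI[of _ "X (q ^ 4)"], rule exI[of _ "X (q ^ 5)"], intro conjI ballI X A B C)
       (simp only: X4 T)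
qed

end

section \<open>Transport along an isomorphism\<close>

lemma irr_characters_pullback:
  assumes G: "group G" and H: "group H" and h: "h \<in> Group.iso G H" and \<chi>: "\<chi> \<in> irr_characters H"
  shows "(\<lambda>g\<in>carrier G. \<chi> (h g)) \<in> irr_characters G"
proof -
  obtain d \<rho> where \<rho>: "irreducible_representation H d \<rho>" "\<chi> = rep_character H \<rho>"
    using \<chi> by (auto simp: irr_characters_def)
  have rep: "representation H d \<rho>" and d: "d > 0" using \<rho> by (auto simp: irreducible_representation_def)
  have hom: "h \<in> hom G H" and bij: "bij_betw h (carrier G) (carrier H)" using h by (auto simp: Group.iso_def)
  have hG: "h g \<in> carrier H" if "g \<in> carrier G" for g using hom_carrier[OF hom] that by blast
  have "representation G d (\<lambda>g. \<rho> (h g))"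
    by (rule representationI[OF G])
       (use representationD[OF H rep] hG hom_mult[OF hom] hom_one[OF hom G H] in auto)
  moreover have "(\<forall>g\<in>carrier G. \<forall>w\<in>W. \<rho> (h g) *\<^sub>v w \<in> W) \<longleftrightarrow> (\<forall>g\<in>carrier H. \<forall>w\<in>W. \<rho> g *\<^sub>v w \<in> W)" for W
    unfolding bij_betw_imp_surj_on[OF bij, symmetric] by simp
  ultimately have "irreducible_representation G d (\<lambda>g. \<rho> (h g))"
    using \<rho>(1) by (simp add: irreducible_representation_def)
  moreover have "(\<lambda>g\<in>carrier G. \<chi> (h g)) = rep_character G (\<lambda>g. \<rho> (h g))"
    unfolding rep_character_def \<rho>(2) using hG by (intro restrict_ext) simp
  ultimately show ?thesis unfolding irr_characters_def by blast
qed

lemma pullback_inj: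
  assumes bij: "bij_betw h (carrier G) (carrier H)"
  shows "inj_on (\<lambda>\<chi>. \<lambda>g\<in>carrier G. \<chi> (h g)) (irr_characters H)"
proof (rule inj_onI)
  fix \<chi> \<xi> assume c: "\<chi> \<in> irr_characters H" "\<xi> \<in> irr_characters H"
    and e: "(\<lambda>g\<in>carrier G. \<chi> (h g)) = (\<lambda>g\<in>carrier G. \<xi> (h g))"
  have ext: "\<chi> \<in> extensional (carrier H)" "\<xi> \<in> extensional (carrier H)"
    using c by (auto simp: irr_characters_def rep_character_def)
  show "\<chi> = \<xi>"
  proof (rule extensionalityI[OF ext])
    fix x assume "x \<in> carrier H"
    then obtain g where "g \<in> carrier G" "x = h g" using bij by (auto simp: bij_betw_def)
    thus "\<chi> x = \<xi> x" using fun_cong[OF e, of g] by simp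
  qed
qed

lemma induced_character_pullback:
  assumes G: "group G" and H: "group H" and h: "h \<in> Group.iso G H" and V: "V \<subseteq> carrier G"
    and \<mu>: "\<And>v. v \<in> V \<Longrightarrow> \<mu> v = \<nu> (h v)" and g: "g \<in> carrier G"
  shows "induced_character G V \<mu> g = induced_character H (h ` V) \<nu> (h g)"
proof -
  interpret G: group G by fact
  interpret H: group H by fact
  have hom: "h \<in> hom G H" and bij: "bij_betw h (carrier G) (carrier H)" using h by (auto simp: Group.iso_def)
  interpret h: group_hom G H h by unfold_locales (rule hom)
  have inj: "inj_on h (carrier G)" using bij by (simp add: bij_betw_def)
  have card: "card (h ` V) = card V" by (rule card_image) (use inj V inj_on_subset in blast)
  have hV: "h y \<in> h ` V \<longleftrightarrow> y \<in> V" if "y \<in> carrier G" for y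
    by (rule inj_on_image_mem_iff[OF inj that V])
  have eq: "h (inv\<^bsub>G\<^esub> x \<otimes>\<^bsub>G\<^esub> g \<otimes>\<^bsub>G\<^esub> x) = inv\<^bsub>H\<^esub> (h x) \<otimes>\<^bsub>H\<^esub> h g \<otimes>\<^bsub>H\<^esub> h x" if "x \<in> carrier G" for x
    using that g by simp
  let ?y = "\<lambda>x. inv\<^bsub>G\<^esub> x \<otimes>\<^bsub>G\<^esub> g \<otimes>\<^bsub>G\<^esub> x" and ?z = "\<lambda>x. inv\<^bsub>H\<^esub> x \<otimes>\<^bsub>H\<^esub> h g \<otimes>\<^bsub>H\<^esub> x"
  have "(\<Sum>x\<in>carrier G. if ?y x \<in> V then \<mu> (?y x) else 0) =
      (\<Sum>x\<in>carrier G. if ?z (h x) \<in> h ` V then \<nu> (?z (h x)) else 0)"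
  proof (rule sum.cong[OF refl])
    fix x assume x: "x \<in> carrier G"
    hence "?y x \<in> carrier G" using g by simp
    thus "(if ?y x \<in> V then \<mu> (?y x) else 0) = (if ?z (h x) \<in> h ` V then \<nu> (?z (h x)) else 0)"
      unfolding eq[OF x, symmetric] using hV \<mu> by simp
  qed
  also have "\<dots> = (\<Sum>x\<in>carrier H. if ?z x \<in> h ` V then \<nu> (?z x) else 0)"
    by (rule sum.reindex_bij_betw[OF bij])
  finally show ?thesis using g by (simp add: induced_character_eval card)
qed

section \<open>Pattern subgroups of the unitriangular group\<close>

text \<open>
  In terms of roots, the position in row \<open>r\<close> and column \<open>c\<close>, counted from 0, is the root \<open>(Suc r, c)\<close>.
\<close>

definition pattern :: "nat \<Rightarrow> root set \<Rightarrow> 'a::field mat set" where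
  "pattern n S = {A \<in> carrier (unitri n). \<forall>r c. r < c \<and> c < n \<and> (Suc r, c) \<notin> S \<longrightarrow> A $$ (r, c) = 0}"

lemma patternD: "A \<in> pattern n S \<Longrightarrow> r < c \<Longrightarrow> c < n \<Longrightarrow> (Suc r, c) \<notin> S \<Longrightarrow> A $$ (r, c) = 0"
  by (simp add: pattern_def)

text \<open>
  Peeling off the entries row by row from the top factors a matrix into root elements supported on
  its own nonzero entries; no new entries arise since the rows above the current one are trivial.
\<close>

lemma pattern_subset_generated:
  assumes A: "A \<in> pattern n S" and S: "S \<subseteq> pos_roots n"
  shows "A \<in> generated_by_roots n S"
  using A
proof (induction "card {(r, c). r < c \<and> c < n \<and> A $$ (r, c) \<noteq> 0}" arbitrary: A rule: less_induct)
  case less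
  let ?supp = "\<lambda>A :: 'a mat. {(r, c). r < c \<and> c < n \<and> A $$ (r, c) \<noteq> 0}"
  have fin: "finite (?supp B)" for B :: "'a mat"
    by (rule finite_subset[of _ "{..<n} \<times> {..<n}"]) auto
  have Au: "A \<in> carrier (unitri n)" using less.prems by (simp add: pattern_def)
  hence Ac: "A \<in> carrier_mat n n" and low: "\<And>i j. i < n \<Longrightarrow> j < i \<Longrightarrow> A $$ (i, j) = 0" "\<And>i. i < n \<Longrightarrow> A $$ (i, i) = 1"
    by (auto simp: unitri_simps upper_triangular_def)
  show ?case
  proof (cases "?supp A = {}")
    case True
    have "A = 1\<^sub>m n"
    proof (rule eq_matI)
      fix i j assume "i < dim_row (1\<^sub>m n :: 'a mat)" "j < dim_col (1\<^sub>m n :: 'a mat)"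
      hence ij: "i < n" "j < n" by auto
      have "A $$ (i, j) = 0" if "i < j" using True ij that by auto
      thus "A $$ (i, j) = 1\<^sub>m n $$ (i, j)" using ij low by (cases i j rule: linorder_cases) auto
    qed (use Ac in auto)
    thus ?thesis unfolding generated_by_roots_def
      using generate.one[of "unitri n"] by (simp add: unitri_simps)
  next
    case False
    define r where "r = (LEAST r. \<exists>c. r < c \<and> c < n \<and> A $$ (r, c) \<noteq> 0)"
    have ex: "\<exists>r c. r < c \<and> c < n \<and> A $$ (r, c) \<noteq> 0" using False by auto
    obtain c where c: "r < c" "c < n" "A $$ (r, c) \<noteq> 0" using LeastI_ex[OF ex] unfolding r_def by blast
    have top: "A $$ (i, k) = 0" if "i < r" "i < k" "k < n" for i k
      using not_less_Least[of i "\<lambda>r. \<exists>c. r < c \<and> c < n \<and> A $$ (r, c) \<noteq> 0"] that unfolding r_def by blast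
    have root: "(Suc r, c) \<in> S" using patternD[OF less.prems c(1,2)] c(3) by blast
    hence pr: "(Suc r, c) \<in> pos_roots n" using S by auto
    let ?v = "A $$ (r, c)"
    define B where "B = mat n n (\<lambda>p. if p = (r, c) then 0 else A $$ p)"
    have Bc: "B \<in> carrier_mat n n" by (simp add: B_def)
    have Be: "B $$ (i, j) = (if (i, j) = (r, c) then 0 else A $$ (i, j))" if "i < n" "j < n" for i j
      using that by (simp add: B_def)
    have Bp: "B \<in> pattern n S"
    proof -
      have "B $$ (i, j) = 0" if "i < n" "j < i" for i j using that low by (simp add: Be)
      moreover have "B $$ (i, i) = 1" if "i < n" for i using that low c by (simp add: Be)
      moreover have "B $$ (i, j) = 0" if "i < j" "j < n" "(Suc i, j) \<notin> S" for i j
        using that patternD[OF less.prems that] by (simp add: Be)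
      ultimately show ?thesis using Bc by (auto simp: pattern_def unitri_simps upper_triangular_def)
    qed
    have "?supp B \<subset> ?supp A"
    proof
      show "?supp B \<subseteq> ?supp A" by (auto simp: Be split: if_splits)
      have "(r, c) \<in> ?supp A" "(r, c) \<notin> ?supp B" using c by (auto simp: Be)
      thus "?supp B \<noteq> ?supp A" by blast
    qed
    hence IH: "B \<in> generated_by_roots n S"
      by (intro less.hyps Bp psubset_card_mono fin)
    have Rc: "root_elt n (Suc r, c) ?v \<in> carrier_mat n n"
      using root_elt_carrier[OF pr, of ?v] by (simp add: unitri_simps)
    have "A = B * root_elt n (Suc r, c) ?v"
    proof (rule eq_matI)
      fix i j assume "i < dim_row (B * root_elt n (Suc r, c) ?v)" "j < dim_col (B * root_elt n (Suc r, c) ?v)"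
      hence ij: "i < n" "j < n" using Bc Rc by auto
      have rn: "r < n" using c by simp
      have "(B * root_elt n (Suc r, c) ?v) $$ (i, j) = (\<Sum>k<n. B $$ (i, k) * root_elt n (Suc r, c) ?v $$ (k, j))"
        by (rule mat_mult_entry[OF Bc Rc ij])
      also have "\<dots> = (\<Sum>k<n. (if k = j then B $$ (i, j) else 0) + (if k = r then (if j = c then B $$ (i, r) * ?v else 0) else 0))"
        by (intro sum.cong refl) (use ij c in \<open>auto simp: root_elt_index[OF pr]\<close>)
      also have "\<dots> = B $$ (i, j) + (if j = c then B $$ (i, r) * ?v else 0)"
        using ij rn by (simp add: sum.distrib)
      also have "\<dots> = A $$ (i, j)"
        using ij rn c top low by (cases i r rule: linorder_cases) (auto simp: Be)
      finally show "A $$ (i, j) = (B * root_elt n (Suc r, c) ?v) $$ (i, j)" by simp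
    qed (use Ac Bc Rc in auto)
    moreover have "root_elt n (Suc r, c) ?v \<in> generated_by_roots n S"
      unfolding generated_by_roots_def using root by (intro generate.incl) (auto simp: root_subgroup_def)
    ultimately show ?thesis
      using IH generate.eng[of B "unitri n"] unfolding generated_by_roots_def by (metis unitri_simps(2))
  qed
qed

text \<open>
  For roots the hypothesis says that \<open>S\<close> is closed under addition.
\<close>

lemma pattern_subgroup:
  assumes closed: "\<And>i j k. (i, j) \<in> S \<Longrightarrow> (Suc j, k) \<in> S \<Longrightarrow> (i, k) \<in> S"
  shows "subgroup (pattern n S :: 'a::field mat set) (unitri n)"
proof (rule group.subgroupI[OF unitri_group])
  show "pattern n S \<subseteq> carrier (unitri n)" by (auto simp: pattern_def)
  have "1\<^sub>m n \<in> (pattern n S :: 'a mat set)" by (auto simp: pattern_def unitri_simps upper_triangular_def)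
  thus "(pattern n S :: 'a mat set) \<noteq> {}" by blast
next
  fix A B :: "'a mat" assume AB: "A \<in> pattern n S" "B \<in> pattern n S"
  have U: "A \<in> carrier (unitri n)" "B \<in> carrier (unitri n)" using AB by (auto simp: pattern_def)
  have "(A * B) $$ (r, c) = 0" if rc: "r < c" "c < n" "(Suc r, c) \<notin> S" for r c
  proof -
    have "A $$ (r, k) * B $$ (k, c) = 0" if k: "k \<in> {r..c}" for k
    proof (cases "k = r \<or> k = c")
      case True
      thus ?thesis using patternD[OF AB(1) rc] patternD[OF AB(2) rc] by auto
    next
      case False
      hence k: "r < k" "k < c" using k by auto
      hence "(Suc r, k) \<notin> S \<or> (Suc k, c) \<notin> S" using closed rc by blast
      thus ?thesis using patternD[OF AB(1), of r k] patternD[OF AB(2), of k c] k rc by auto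
    qed
    hence "(\<Sum>k\<in>{r..c}. A $$ (r, k) * B $$ (k, c)) = 0" by (intro sum.neutral) blast
    thus ?thesis using unitri_mult_index[OF U, of r c] rc by simp
  qed
  thus "A \<otimes>\<^bsub>unitri n\<^esub> B \<in> pattern n S"
    using unitri_mult_closed[OF U] by (simp add: pattern_def unitri_simps(2))
next
  fix A :: "'a mat" assume A: "A \<in> pattern n S"
  let ?B = "inv\<^bsub>unitri n\<^esub> A"
  have Au: "A \<in> carrier (unitri n)" using A by (auto simp: pattern_def)
  have Bu: "?B \<in> carrier (unitri n)" by (rule group.inv_closed[OF unitri_group Au])
  have AB: "A * ?B = 1\<^sub>m n" using group.r_inv[OF unitri_group Au] by (simp add: unitri_simps)
  have "?B $$ (r, c) = 0" if "r < c" "c < n" "(Suc r, c) \<notin> S" for r c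
    using that
  proof (induction "c - r" arbitrary: r rule: less_induct)
    case less
    have diag: "A $$ (r, r) = 1" using Au less.prems by (simp add: unitri_simps)
    have "A $$ (r, k) * ?B $$ (k, c) = 0" if k: "k \<in> {r..c} - {r}" for k
    proof (cases "k = c")
      case True
      thus ?thesis using patternD[OF A less.prems] by simp
    next
      case False
      hence k: "r < k" "k < c" using k by auto
      show ?thesis
      proof (cases "(Suc r, k) \<in> S")
        case True
        hence "(Suc k, c) \<notin> S" using closed less.prems by blast
        hence "?B $$ (k, c) = 0" using k less.prems by (intro less.hyps) auto
        thus ?thesis by simp
      next
        case False
        thus ?thesis using patternD[OF A, of r k] k less.prems by simp
      qed
    qed
    hence "(\<Sum>k\<in>{r..c} - {r}. A $$ (r, k) * ?B $$ (k, c)) = 0" by (intro sum.neutral) blast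
    hence "(\<Sum>k\<in>{r..c}. A $$ (r, k) * ?B $$ (k, c)) = ?B $$ (r, c)"
      using less.prems diag by (subst sum.remove[of _ r]) auto
    moreover have "(A * ?B) $$ (r, c) = 0" unfolding AB using less.prems by simp
    ultimately show ?case using unitri_mult_index[OF Au Bu, of r c] less.prems by simp
  qed
  thus "?B \<in> pattern n S" using Bu by (simp add: pattern_def)
qed

lemma generated_by_roots_eq_pattern:
  assumes S: "S \<subseteq> pos_roots n" and closed: "\<And>i j k. (i, j) \<in> S \<Longrightarrow> (Suc j, k) \<in> S \<Longrightarrow> (i, k) \<in> S"
  shows "(generated_by_roots n S :: 'a::field mat set) = pattern n S"
proof
  show "(generated_by_roots n S :: 'a mat set) \<subseteq> pattern n S"
    unfolding generated_by_roots_def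
  proof (rule group.generate_subgroup_incl[OF unitri_group _ pattern_subgroup[OF closed]])
    show "(\<Union>\<beta>\<in>S. root_subgroup n \<beta>) \<subseteq> (pattern n S :: 'a mat set)"
    proof
      fix g :: "'a mat" assume "g \<in> (\<Union>\<beta>\<in>S. root_subgroup n \<beta>)"
      then obtain a b x where ab: "(a, b) \<in> S" "g = root_elt n (a, b) x" by (auto simp: root_subgroup_def)
      have pr: "(a, b) \<in> pos_roots n" using ab S by auto
      hence "a \<ge> 1" by (simp add: pos_roots_def)
      thus "g \<in> pattern n S"
        using root_elt_carrier[OF pr, of x] ab root_elt_index[OF pr, of _ _ x] by (auto simp: pattern_def)
    qed
  qed
qed (use pattern_subset_generated[OF _ S] in blast)

lemma pattern_subset_V_root:
  "pattern n (pos_roots n - arm \<alpha>) \<subseteq> V_root n \<alpha>"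
  unfolding V_root_def using pattern_subset_generated by blast

lemma root_subgroup_subset_V_root:
  assumes "\<beta> \<in> pos_roots n - arm \<alpha>"
  shows "root_subgroup n \<beta> \<subseteq> V_root n \<alpha>"
  using assms unfolding V_root_def generated_by_roots_def by (auto intro: generate.incl)

lemma phi_simps:
  fixes \<phi> :: "'a::field \<Rightarrow> complex"
  assumes "linear_character (add_monoid class_ring) \<phi>"
  shows "\<phi> (x + y) = \<phi> x * \<phi> y" "\<phi> x \<noteq> 0" "\<phi> 0 = 1"
proof -
  have e: "add_monoid class_ring\<lparr>carrier := UNIV\<rparr> = add_monoid class_ring" by simp
  have "linear_character (add_monoid class_ring\<lparr>carrier := UNIV\<rparr>) \<phi>" using assms by (simp only: e)
  note l = this[unfolded linear_character_on_iff]
  show m: "\<phi> (x + y) = \<phi> x * \<phi> y" and nz: "\<phi> x \<noteq> 0" for x y using l by auto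
  show "\<phi> 0 = 1" using m[of 0 0] nz[of 0] by simp
qed

text \<open>
  The elements on which the formula holds form a subgroup, because the entry at \<open>(a, b)\<close> is additive where
  the arm vanishes, and this subgroup contains the generators.
\<close>

lemma lambda_root_value:
  assumes \<phi>: "linear_character (add_monoid class_ring) \<phi>" and ab: "(a, b) \<in> pos_roots n"
    and g: "g \<in> V_root n (a, b)"
  shows "lambda_root n \<phi> (a, b) s g = \<phi> (g $$ (a - 1, b) * s)"
proof -
  let ?V = "V_root n (a, b) :: 'a mat set" and ?\<chi> = "lambda_root n \<phi> (a, b) s"
  note ph = phi_simps[OF \<phi>]
  have "is_lambda_root n \<phi> (a, b) s ?\<chi>"
    unfolding lambda_root_def by (rule theI'[OF lambda_root_unique[OF \<phi> ab]])
  hence lin: "linear_character (unitri n\<lparr>carrier := ?V\<rparr>) ?\<chi>"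
    and val: "\<And>d. ?\<chi> (root_elt n (a, b) d) = \<phi> (d * s)"
    and triv: "\<And>\<beta> g. \<beta> \<in> pos_roots n - {(a, b)} \<Longrightarrow> root_subgroup n \<beta> \<subseteq> ?V \<Longrightarrow> g \<in> root_subgroup n \<beta> \<Longrightarrow> ?\<chi> g = 1"
    by (auto simp: is_lambda_root_def)
  note l = lin[unfolded linear_character_on_iff]
  have sub: "subgroup ?V (unitri n)" unfolding V_root_def by (rule generated_by_roots_subgroup) auto
  have free: "?V \<subseteq> arm_free n a b" by (rule V_root_arm_free[OF ab])
  have VU: "?V \<subseteq> carrier (unitri n)" by (rule subgroup.subset[OF sub])
  have mult: "?\<chi> (x * y) = ?\<chi> x * ?\<chi> y" "?\<chi> x \<noteq> 0" if "x \<in> ?V" "y \<in> ?V" for x y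
    using l that by (auto simp: unitri_simps)
  have entry: "(x * y) $$ (a - 1, b) = x $$ (a - 1, b) + y $$ (a - 1, b)" if "x \<in> ?V" "y \<in> ?V" for x y
    using arm_free_mult[OF ab, of x y b] that free VU ab by (auto simp: pos_roots_def add.commute)
  have one: "1\<^sub>m n \<in> ?V" using subgroup.one_closed[OF sub] by (simp add: unitri_simps)
  have chi1: "?\<chi> (1\<^sub>m n) = 1" using mult[OF one one] by simp
  have ab': "a - 1 < n" "b < n" "a - 1 \<noteq> b" using ab by (auto simp: pos_roots_def)
  let ?E = "{g \<in> ?V. ?\<chi> g = \<phi> (g $$ (a - 1, b) * s)}"
  have "subgroup ?E (unitri n)"
  proof (rule group.subgroupI[OF unitri_group])
    show "?E \<subseteq> carrier (unitri n)" using VU by auto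
    show "?E \<noteq> {}" using one chi1 ab' ph(3) by (auto intro!: exI[of _ "1\<^sub>m n"])
  next
    fix x y :: "'a mat" assume "x \<in> ?E" "y \<in> ?E"
    thus "x \<otimes>\<^bsub>unitri n\<^esub> y \<in> ?E"
      using subgroup.m_closed[OF sub, of x y] mult entry ph(1) by (simp add: unitri_simps ring_distribs)
  next
    fix x :: "'a mat" assume x: "x \<in> ?E"
    let ?y = "inv\<^bsub>unitri n\<^esub> x"
    have y: "?y \<in> ?V" using subgroup.m_inv_closed[OF sub] x by auto
    have xy: "x * ?y = 1\<^sub>m n" using group.r_inv[OF unitri_group, of x n] x VU by (auto simp: unitri_simps)
    have 1: "?\<chi> x * ?\<chi> ?y = 1" using mult(1)[of x ?y] x y xy chi1 by simp
    have "x $$ (a - 1, b) + ?y $$ (a - 1, b) = 0" using entry[of x ?y] x y xy ab' by simp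
    hence "x $$ (a - 1, b) * s + ?y $$ (a - 1, b) * s = 0" by (metis mult_zero_left ring_distribs(2))
    hence "\<phi> (x $$ (a - 1, b) * s) * \<phi> (?y $$ (a - 1, b) * s) = 1" using ph(1,3) by metis
    hence "?\<chi> x * ?\<chi> ?y = ?\<chi> x * \<phi> (?y $$ (a - 1, b) * s)" using x 1 by simp
    thus "?y \<in> ?E" using mult(2)[of x x] x y by simp
  qed
  moreover have "(\<Union>\<beta>\<in>pos_roots n - arm (a, b). root_subgroup n \<beta>) \<subseteq> ?E"
  proof
    fix g :: "'a mat" assume "g \<in> (\<Union>\<beta>\<in>pos_roots n - arm (a, b). root_subgroup n \<beta>)"
    then obtain \<beta> where \<beta>: "\<beta> \<in> pos_roots n - arm (a, b)" "g \<in> root_subgroup n \<beta>" by blast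
    then obtain i j x where ij: "\<beta> = (i, j)" "g = root_elt n (i, j) x" by (cases \<beta>) (auto simp: root_subgroup_def)
    have sV: "root_subgroup n \<beta> \<subseteq> ?V" by (rule root_subgroup_subset_V_root[OF \<beta>(1)])
    have pr: "(i, j) \<in> pos_roots n" using \<beta> ij by simp
    have e: "g $$ (a - 1, b) = (if (i, j) = (a, b) then x else 0)"
      using root_elt_index[OF pr ab'(1,2), of x] ij ab' ab pr by (auto simp: pos_roots_def)
    have "?\<chi> g = \<phi> (g $$ (a - 1, b) * s)"
    proof (cases "(i, j) = (a, b)")
      case True thus ?thesis using val e ij by simp
    next
      case False
      thus ?thesis using triv[of \<beta> g] \<beta> sV ij e ph(3) by auto
    qed
    thus "g \<in> ?E" using sV \<beta> by auto
  qed
  ultimately have "?V \<subseteq> ?E"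
    using group.generate_subgroup_incl[OF unitri_group] unfolding V_root_def generated_by_roots_def by blast
  thus ?thesis using g by blast
qed

section \<open>The groups attached to the basic set\<close>

definition D13 :: "root set" where
  "D13 = {(1,4), (2,5), (3,9), (4,10), (5,6), (6,7), (7,8), (8,11), (9,12)}"

definition Gam :: "root set" where
  "Gam = {(i, j). 1 \<le> i \<and> i \<le> j \<and> j \<le> 8 \<and> \<not> (i \<in> {3, 4} \<and> 4 \<le> j \<and> j \<le> 6)}"

lemma Gamma_set_D13: "Gamma_set D13 = Gam"
proof
  have "Gamma_set D13 = (\<Union>\<sigma>\<in>D13. \<Union>\<tau>\<in>D13.
      if root_col \<sigma> < root_col \<tau> \<and> root_row \<sigma> < root_row \<tau> then {(root_row \<sigma>, root_row \<tau> - 1)} else {})"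
    by (auto simp: Gamma_set_def)
  hence e: "Gamma_set D13 = {(1, 1), (1, 2), (1, 3), (1, 4), (1, 5), (1, 6), (1, 7), (1, 8),
      (2, 2), (2, 3), (2, 4), (2, 5), (2, 6), (2, 7), (2, 8), (3, 3), (3, 7), (3, 8), (4, 7), (4, 8),
      (5, 5), (5, 6), (5, 7), (5, 8), (6, 6), (6, 7), (6, 8), (7, 7), (7, 8), (8, 8)}"
    unfolding D13_def root_col_def root_row_def by (simp add: insert_commute)
  show "Gamma_set D13 \<subseteq> Gam" unfolding e Gam_def by simp
  show "Gam \<subseteq> Gamma_set D13"
  proof
    fix \<alpha> assume "\<alpha> \<in> Gam"
    then obtain i j where ij: "\<alpha> = (i, j)" "1 \<le> i" "i \<le> j" "j \<le> 8" "\<not> (i \<in> {3, 4} \<and> 4 \<le> j \<and> j \<le> 6)"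
      by (auto simp: Gam_def)
    have "i = 1 \<or> i = 2 \<or> i = 3 \<or> i = 4 \<or> i = 5 \<or> i = 6 \<or> i = 7 \<or> i = 8"
      "j = 1 \<or> j = 2 \<or> j = 3 \<or> j = 4 \<or> j = 5 \<or> j = 6 \<or> j = 7 \<or> j = 8" using ij(2-4) by arith+
    thus "\<alpha> \<in> Gamma_set D13" using ij(3,5) unfolding e ij(1) by (elim disjE) simp_all
  qed
qed

lemma R_group_pattern: "(R_group 13 D13 :: 'a::field mat set) = pattern 13 Gam"
  unfolding R_group_def Gamma_set_D13
proof (rule generated_by_roots_eq_pattern)
  show "Gam \<subseteq> pos_roots 13" by (auto simp: Gam_def pos_roots_def)
  show "(i, k) \<in> Gam" if "(i, j) \<in> Gam" "(Suc j, k) \<in> Gam" for i j k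
    using that by (simp add: Gam_def) presburger
qed

text \<open>
  The entry named \<open>ij\<close> sits at index \<open>(i - 1, j - 1)\<close>.
\<close>

definition coord :: "'a::field mat \<Rightarrow> 'a gen \<times> 'a cen" where
  "coord A = (Gen (A $$ (0, 1)) (A $$ (1, 2)) (A $$ (2, 3)) (A $$ (1, 4)) (A $$ (3, 7)) (A $$ (4, 5))
       (A $$ (5, 6)) (A $$ (6, 7)) (A $$ (7, 8)),
     Cen (A $$ (0, 2)) (A $$ (0, 3)) (A $$ (1, 3)) (A $$ (2, 7)) (A $$ (2, 8)) (A $$ (3, 8))
       (A $$ (0, 4)) (A $$ (1, 5)) (A $$ (4, 6)) (A $$ (5, 7)) (A $$ (6, 8)))"

lemma pattern_Gam_zero:
  assumes "A \<in> pattern 13 Gam"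
  shows "A $$ (2, 4) = 0" "A $$ (2, 5) = 0" "A $$ (2, 6) = 0" "A $$ (3, 4) = 0" "A $$ (3, 5) = 0" "A $$ (3, 6) = 0"
    "A $$ (2, 9) = 0" "A $$ (3, 9) = 0" "A $$ (3, 10) = 0" "A $$ (7, 9) = 0" "A $$ (7, 10) = 0" "A $$ (7, 11) = 0"
    "A $$ (8, 9) = 0" "A $$ (8, 10) = 0" "A $$ (8, 11) = 0" "A $$ (8, 12) = 0"
  by (rule patternD[OF assms]; simp add: Gam_def)+

lemma unitri_mult_entry:
  assumes A: "A \<in> carrier (unitri n)" and B: "B \<in> carrier (unitri n)" and "i < n" "j < n"
  shows "(A * B) $$ (i, j) = (\<Sum>k\<leftarrow>[i..<Suc j]. A $$ (i, k) * B $$ (k, j))"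
  unfolding unitri_mult_index[OF assms] by (simp only: interv_sum_list_conv_sum_set_nat set_upt atLeastLessThanSuc_atLeastAtMost)

lemma coord_mult:
  assumes A: "A \<in> pattern 13 Gam" and B: "B \<in> pattern 13 Gam"
  shows "coord (A * B) = model_mult (coord A) (coord B)"
proof -
  have U: "A \<in> carrier (unitri 13)" "B \<in> carrier (unitri 13)" using A B by (auto simp: pattern_def)
  have diag: "A $$ (i, i) = 1" "B $$ (i, i) = 1" if "i < 13" for i using U that by (auto simp: unitri_simps)
  show ?thesis
    using pattern_Gam_zero[OF A] pattern_Gam_zero[OF B]
    by (simp add: coord_def model_mult_def unitri_mult_entry[OF U] diag upt_conv_Cons numeral_2_eq_2[symmetric])
qed

definition entries :: "'a gen \<times> 'a cen \<Rightarrow> ((nat \<times> nat) \<times> 'a) list" where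
  "entries = (\<lambda>(x, z).
     [((0, 1), x12 x), ((1, 2), x23 x), ((2, 3), x34 x), ((1, 4), x25 x), ((3, 7), x48 x),
      ((4, 5), x56 x), ((5, 6), x67 x), ((6, 7), x78 x), ((7, 8), x89 x),
      ((0, 2), c13 z), ((0, 3), c14 z), ((1, 3), c24 z), ((2, 7), c38 z), ((2, 8), c39 z), ((3, 8), c49 z),
      ((0, 4), z15 z), ((1, 5), z26 z), ((4, 6), z57 z), ((5, 7), z68 z), ((6, 8), z79 z)])"

text \<open>
  A section of \<open>coord\<close>, which shows that \<open>coord\<close> is surjective.
\<close>

definition mat_of :: "'a::field gen \<times> 'a cen \<Rightarrow> 'a mat" where
  "mat_of m = mat 13 13 (\<lambda>p. if fst p = snd p then 1 else
     (case map_of (entries m) p of None \<Rightarrow> 0 | Some v \<Rightarrow> v))"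

lemma mat_of_entry:
  assumes "map_of (entries m) (r, c) = Some v" "r < 13" "c < 13" "r \<noteq> c"
  shows "mat_of m $$ (r, c) = v"
  using assms by (simp add: mat_of_def)

lemma coord_mat_of: "coord (mat_of m) = m"
proof -
  obtain x z where m: "m = (x, z)" by force
  have "coord (mat_of m) = (Gen (x12 x) (x23 x) (x34 x) (x25 x) (x48 x) (x56 x) (x67 x) (x78 x) (x89 x),
      Cen (c13 z) (c14 z) (c24 z) (c38 z) (c39 z) (c49 z) (z15 z) (z26 z) (z57 z) (z68 z) (z79 z))"
    unfolding coord_def prod.inject gen.inject cen.inject
    by (intro conjI; rule mat_of_entry; simp add: m entries_def)
  thus ?thesis by (simp add: m)
qed

lemma mat_of_pattern: "mat_of m \<in> pattern 13 Gam"
proof -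
  have "mat_of m $$ (r, c) = 0" if rc: "r < 13" "c < 13" "r \<noteq> c" "\<not> (r < c \<and> (Suc r, c) \<in> Gam)" for r c
  proof -
    have "\<forall>(r, c)\<in>fst ` set (entries m). r < c \<and> (Suc r, c) \<in> Gam"
      by (cases m) (simp add: entries_def Gam_def)
    hence "(r, c) \<notin> fst ` set (entries m)" using rc(4) by blast
    hence "map_of (entries m) (r, c) = None" by (subst map_of_eq_None_iff)
    thus ?thesis using rc by (simp add: mat_of_def)
  qed
  moreover have "mat_of m \<in> carrier_mat 13 13" "\<And>i. i < 13 \<Longrightarrow> mat_of m $$ (i, i) = 1"
    by (auto simp: mat_of_def)
  ultimately show ?thesis by (auto simp: pattern_def unitri_simps upper_triangular_def)
qed

lemma D13_pos: "\<alpha> \<in> D13 \<Longrightarrow> \<alpha> \<in> pos_roots 13"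
  by (auto simp: D13_def pos_roots_def)

lemma V_group_arm_free: "(a, b) \<in> D13 \<Longrightarrow> V_group 13 D13 \<subseteq> arm_free 13 a b"
  using V_root_arm_free[OF D13_pos] by (auto simp: V_group_def)

lemma V_group_subgroup: "subgroup (V_group 13 D13 :: 'a::field mat set) (unitri 13)"
  unfolding V_group_def
  by (rule group.subgroups_Inter[OF unitri_group])
     (auto simp: D13_def V_root_def intro!: generated_by_roots_subgroup)

text \<open>
  The arms of \<open>D\<close> meet \<open>\<Gamma>\<close> exactly in the fifteen positions other than \<open>15, 26, 57, 68, 79\<close> that survive
  in the quotient.
\<close>

lemma V_group_coord:
  assumes A: "A \<in> pattern 13 Gam"
  shows "A \<in> V_group 13 D13 \<longleftrightarrow> coord A \<in> model_V"
proof
  assume V: "A \<in> V_group 13 D13"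
  have z: "A $$ (a - 1, k) = 0" if "(a, b) \<in> D13" "a \<le> k" "k < b" for a b k
    using V_group_arm_free[OF that(1)] V that by (auto simp: arm_free_def)
  show "coord A \<in> model_V"
    using z[of 1 4 1] z[of 1 4 2] z[of 1 4 3] z[of 2 5 2] z[of 2 5 3] z[of 2 5 4] z[of 3 9 3] z[of 3 9 7] z[of 3 9 8]
      z[of 4 10 7] z[of 4 10 8] z[of 5 6 5] z[of 6 7 6] z[of 7 8 7] z[of 8 11 8]
    by (simp add: D13_def coord_def model_V_def gen_zero_def)
next
  assume C: "coord A \<in> model_V"
  note Z = C[unfolded coord_def model_V_def gen_zero_def, simplified] pattern_Gam_zero[OF A]
  have arms: "\<forall>(a, b)\<in>D13. \<forall>k\<in>set [a..<b]. A $$ (a - 1, k) = 0"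
    using Z by (simp add: D13_def upt_conv_Cons numeral_2_eq_2[symmetric] del: set_upt)
  have U: "A \<in> carrier (unitri 13)" using A by (simp add: pattern_def)
  have "A \<in> V_root 13 \<alpha>" if \<alpha>: "\<alpha> \<in> D13" for \<alpha>
  proof -
    obtain a b where ab: "\<alpha> = (a, b)" by force
    have "A \<in> pattern 13 (pos_roots 13 - arm \<alpha>)"
      unfolding pattern_def
    proof (intro CollectI conjI allI impI U)
      fix r c assume rc: "r < c \<and> c < 13 \<and> (Suc r, c) \<notin> pos_roots 13 - arm \<alpha>"
      hence "(Suc r, c) \<in> arm \<alpha>" by (auto simp: pos_roots_def)
      hence "Suc r = a" "c \<in> set [a..<b]" by (auto simp: arm_def ab)
      thus "A $$ (r, c) = 0" using arms \<alpha> by (force simp: ab)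
    qed
    thus ?thesis using pattern_subset_V_root by blast
  qed
  thus "A \<in> V_group 13 D13" by (auto simp: V_group_def)
qed

text \<open>
  Elements of \<open>K\<close> have vanishing arms and, since the generators avoid \<open>D\<close>, vanishing entries at
  \<open>D \<inter> \<Gamma>\<close>. Conversely only ten positions of \<open>\<Gamma>\<close> remain, and their root subgroups lie in \<open>K\<close>.
\<close>

lemma K_group_coord:
  assumes A: "A \<in> pattern 13 Gam"
  shows "A \<in> K_group 13 D13 \<longleftrightarrow> coord A = (gen_zero, cen_zero)"
proof
  let ?S = "{\<alpha> \<in> pos_roots 13. (root_subgroup 13 \<alpha> :: 'a mat set) \<subseteq> V_group 13 D13 \<and> \<alpha> \<notin> D13}"
  assume K: "A \<in> K_group 13 D13"
  have "K_group 13 D13 \<subseteq> (V_group 13 D13 :: 'a mat set)"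
    unfolding K_group_def generated_by_roots_def
    by (rule group.generate_subgroup_incl[OF unitri_group _ V_group_subgroup]) auto
  hence V: "coord A \<in> model_V" using K V_group_coord[OF A] by blast
  \<comment> \<open>On generators the entry at \<open>(a, b)\<close> vanishes too, so the arm may be prolonged by one;
    \<open>b < 12\<close> makes the longer arm that of a root.\<close>
  have z: "A $$ (a - 1, b) = 0" if ab: "(a, b) \<in> D13" "b < 12" for a b
  proof -
    have pr: "(a, b) \<in> pos_roots 13" "(a, Suc b) \<in> pos_roots 13" using D13_pos[OF ab(1)] ab by (auto simp: pos_roots_def)
    have "K_group 13 D13 \<subseteq> (arm_free 13 a (Suc b) :: 'a mat set)"
      unfolding K_group_def generated_by_roots_def
    proof (rule group.generate_subgroup_incl[OF unitri_group _ arm_free_subgroup[OF pr(2)]])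
      show "(\<Union>\<beta>\<in>?S. root_subgroup 13 \<beta>) \<subseteq> (arm_free 13 a (Suc b) :: 'a mat set)"
      proof
        fix g :: "'a mat" assume "g \<in> (\<Union>\<beta>\<in>?S. root_subgroup 13 \<beta>)"
        then obtain \<beta> where \<beta>: "\<beta> \<in> ?S" "g \<in> root_subgroup 13 \<beta>" by blast
        have g: "g \<in> arm_free 13 a b" using \<beta> V_group_arm_free[OF ab(1)] by blast
        obtain i j x where ij: "\<beta> = (i, j)" "g = root_elt 13 (i, j) x" using \<beta> by (cases \<beta>) (auto simp: root_subgroup_def)
        have "(i, j) \<noteq> (a, b)" "(i, j) \<in> pos_roots 13" using \<beta> ij ab by auto
        hence "g $$ (a - 1, b) = 0"
          using pr unfolding ij(2) by (subst root_elt_index) (auto simp: pos_roots_def)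
        thus "g \<in> arm_free 13 a (Suc b)" using g by (auto simp: arm_free_def less_Suc_eq)
      qed
    qed
    moreover have "a \<le> b" using pr by (simp add: pos_roots_def)
    ultimately show ?thesis using K by (auto simp: arm_free_def)
  qed
  show "coord A = (gen_zero, cen_zero)"
    using V z[of 1 4] z[of 2 5] z[of 5 6] z[of 6 7] z[of 7 8]
    by (simp add: D13_def coord_def model_V_def gen_zero_def cen_zero_def)
next
  let ?S = "{\<alpha> \<in> pos_roots 13. (root_subgroup 13 \<alpha> :: 'a mat set) \<subseteq> V_group 13 D13 \<and> \<alpha> \<notin> D13}"
  let ?T = "{(1, 5), (1, 6), (1, 7), (1, 8), (2, 6), (2, 7), (2, 8), (5, 7), (5, 8), (6, 8)} :: root set"
  assume C: "coord A = (gen_zero, cen_zero)"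
  note Z = C[unfolded coord_def gen_zero_def cen_zero_def, simplified]
  have U: "A \<in> carrier (unitri 13)" using A by (simp add: pattern_def)
  have "A \<in> pattern 13 ?T"
    unfolding pattern_def
  proof (intro CollectI conjI allI impI U)
    fix r c assume rc: "r < c \<and> c < 13 \<and> (Suc r, c) \<notin> ?T"
    show "A $$ (r, c) = 0"
    proof (cases "(Suc r, c) \<in> Gam")
      case False thus ?thesis using patternD[OF A] rc by blast
    next
      case True
      hence "Suc r \<le> c" "c \<le> 8" by (simp_all add: Gam_def)
      hence "r = 0 \<or> r = 1 \<or> r = 2 \<or> r = 3 \<or> r = 4 \<or> r = 5 \<or> r = 6 \<or> r = 7"
        "c = 1 \<or> c = 2 \<or> c = 3 \<or> c = 4 \<or> c = 5 \<or> c = 6 \<or> c = 7 \<or> c = 8" by arith+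
      thus ?thesis using rc True Z by (elim disjE) (simp_all add: Gam_def)
    qed
  qed
  hence "A \<in> generated_by_roots 13 ?T" by (rule pattern_subset_generated) (auto simp: pos_roots_def)
  moreover have "?T \<subseteq> ?S"
  proof
    fix \<beta> assume b: "\<beta> \<in> ?T"
    hence na: "\<beta> \<in> pos_roots 13 - arm \<alpha>" if "\<alpha> \<in> D13" for \<alpha>
      using that by (auto simp: D13_def pos_roots_def arm_def)
    have "(root_subgroup 13 \<beta> :: 'a mat set) \<subseteq> V_group 13 D13"
      unfolding V_group_def by (rule INT_greatest) (rule root_subgroup_subset_V_root[OF na])
    moreover have "\<beta> \<notin> D13" using b by (auto simp: D13_def)
    moreover have "\<beta> \<in> pos_roots 13" using b by (auto simp: pos_roots_def)
    ultimately show "\<beta> \<in> ?S" by blast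
  qed
  hence "(\<Union>\<beta>\<in>?T. root_subgroup 13 \<beta>) \<subseteq> (\<Union>\<beta>\<in>?S. root_subgroup 13 \<beta> :: 'a mat set)" by blast
  hence "generated_by_roots 13 ?T \<subseteq> (K_group 13 D13 :: 'a mat set)"
    unfolding K_group_def generated_by_roots_def by (rule group.mono_generate[OF unitri_group])
  ultimately show "A \<in> K_group 13 D13" by blast
qed

section \<open>Identification of the quotient with the model\<close>

lemma pattern_Gam_subgroup: "subgroup (pattern 13 Gam :: 'a::field mat set) (unitri 13)"
  by (rule pattern_subgroup) (simp add: Gam_def, presburger)

lemma pattern_Gam_group: "group (unitri 13\<lparr>carrier := pattern 13 Gam :: 'a::field mat set\<rparr>)"
  by (rule group.subgroup_imp_group[OF unitri_group pattern_Gam_subgroup])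

lemma coord_hom: "group_hom (unitri 13\<lparr>carrier := pattern 13 Gam :: 'a::field mat set\<rparr>) model coord"
  by (intro group_hom.intro group_hom_axioms.intro pattern_Gam_group model_group homI)
     (simp_all add: unitri_simps coord_mult)

definition K_R :: "'a::field mat set" where
  "K_R = {A \<in> pattern 13 Gam. coord A = (gen_zero, cen_zero)}"

lemma K_R_eq: "K_group 13 D13 \<inter> R_group 13 D13 = K_R"
  unfolding R_group_pattern K_R_def using K_group_coord by blast

lemma kernel_coord: "kernel (unitri 13\<lparr>carrier := pattern 13 Gam\<rparr>) model coord = K_R"
  by (simp add: kernel_def K_R_def)

lemma R_quot_eq: "R_quot 13 D13 = unitri 13\<lparr>carrier := pattern 13 Gam\<rparr> Mod K_R"
  unfolding R_quot_def K_R_eq unfolding R_group_pattern ..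

definition coset :: "'a::field mat \<Rightarrow> 'a mat set" where
  "coset a = (\<lambda>h. h * a) ` K_R"

definition quot_coord :: "'a::field mat set \<Rightarrow> 'a gen \<times> 'a cen" where
  "quot_coord X = the_elem (coord ` X)"

lemma R_quot_group: "group (R_quot 13 D13 :: 'a::field mat set monoid)"
proof -
  interpret group_hom "unitri 13\<lparr>carrier := pattern 13 Gam :: 'a mat set\<rparr>" model coord by (rule coord_hom)
  show ?thesis unfolding R_quot_eq kernel_coord[symmetric] by (rule normal.factorgroup_is_group[OF normal_kernel])
qed

lemma quot_coord_iso: "quot_coord \<in> Group.iso (R_quot 13 D13 :: 'a::field mat set monoid) model"
proof -
  interpret group_hom "unitri 13\<lparr>carrier := pattern 13 Gam :: 'a mat set\<rparr>" model coord by (rule coord_hom)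
  have "coord ` pattern 13 Gam = (UNIV :: ('a gen \<times> 'a cen) set)"
    using coord_mat_of mat_of_pattern by (metis UNIV_eq_I image_eqI)
  thus ?thesis
    unfolding R_quot_eq kernel_coord[symmetric] quot_coord_def[abs_def] by (intro FactGroup_iso_set) simp
qed

lemma carrier_R_quot: "carrier (R_quot 13 D13) = coset ` pattern 13 Gam"
  unfolding R_quot_eq by (auto simp: FactGroup_def RCOSETS_def r_coset_def coset_def unitri_simps)

lemma V_quot_eq: "V_quot 13 D13 = coset ` {a \<in> pattern 13 Gam. coord a \<in> model_V}"
proof -
  have "V_group 13 D13 \<inter> R_group 13 D13 = {a \<in> pattern 13 Gam. coord a \<in> model_V}"
    unfolding R_group_pattern using V_group_coord by blast
  thus ?thesis unfolding V_quot_def K_R_eq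
    by (auto simp: FactGroup_def RCOSETS_def r_coset_def coset_def unitri_simps)
qed

lemma coset_coord:
  assumes a: "a \<in> pattern 13 Gam" and v: "v \<in> coset a"
  shows "v \<in> pattern 13 Gam" "coord v = coord a"
proof -
  obtain h where h: "h \<in> K_R" "v = h * a" using v by (auto simp: coset_def)
  have hp: "h \<in> pattern 13 Gam" "coord h = (gen_zero, cen_zero)" using h by (auto simp: K_R_def)
  show "v \<in> pattern 13 Gam" using subgroup.m_closed[OF pattern_Gam_subgroup hp(1) a] h by (simp add: unitri_simps)
  have "coord v = model_mult (gen_zero, cen_zero) (coord a)" unfolding h(2) coord_mult[OF hp(1) a] hp(2) ..
  also have "\<dots> = coord a" using group.is_monoid[OF model_group] monoid.l_one[of model "coord a"] by simp
  finally show "coord v = coord a" .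
qed

lemma coset_nonempty: "a \<in> pattern 13 Gam \<Longrightarrow> coset a \<noteq> {}"
proof -
  have "mat_of (gen_zero, cen_zero) \<in> K_R" by (simp add: K_R_def mat_of_pattern coord_mat_of)
  thus "coset a \<noteq> {}" by (auto simp: coset_def)
qed

lemma the_elem_const:
  assumes "X \<noteq> {}" "\<And>x. x \<in> X \<Longrightarrow> f x = c"
  shows "the_elem (f ` X) = c"
proof -
  have "f ` X = {c}" using assms by auto
  thus ?thesis by simp
qed

lemma quot_coord_coset: "a \<in> pattern 13 Gam \<Longrightarrow> quot_coord (coset a) = coord a"
  unfolding quot_coord_def by (rule the_elem_const[OF coset_nonempty]) (auto dest: coset_coord(2))

lemma quot_coord_V_quot: "quot_coord ` V_quot 13 D13 = (model_V :: ('a::field gen \<times> 'a cen) set)"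
proof -
  have "quot_coord ` V_quot 13 D13 = coord ` {a \<in> pattern 13 Gam. coord a \<in> model_V}"
    unfolding V_quot_eq image_image by (intro image_cong refl) (simp add: quot_coord_coset)
  also have "\<dots> = (model_V :: ('a gen \<times> 'a cen) set)"
  proof (rule subset_antisym)
    show "(model_V :: ('a gen \<times> 'a cen) set) \<subseteq> coord ` {a \<in> pattern 13 Gam. coord a \<in> model_V}"
    proof (rule subsetI)
      fix m :: "'a gen \<times> 'a cen" assume "m \<in> model_V"
      thus "m \<in> coord ` {a \<in> pattern 13 Gam. coord a \<in> model_V}"
        by (intro image_eqI[of _ _ "mat_of m"]) (simp_all add: coord_mat_of mat_of_pattern)
    qed
  qed auto
  finally show ?thesis .
qed

text \<open>
  The four roots of \<open>D\<close> outside \<open>\<Gamma>\<close> contribute trivial factors.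
\<close>

lemma lambda_D_value:
  assumes \<phi>: "linear_character (add_monoid class_ring) \<phi>"
    and \<psi>: "\<And>\<alpha>. \<alpha> \<in> D13 \<Longrightarrow> \<psi> \<alpha> = lambda_root 13 \<phi> \<alpha> (s \<alpha>)"
    and v: "v \<in> pattern 13 Gam" "coord v \<in> model_V"
  shows "lambda_D 13 D13 \<psi> v = \<phi> (s (1, 4) * v $$ (0, 4) + s (2, 5) * v $$ (1, 5) + s (5, 6) * v $$ (4, 6) +
     s (6, 7) * v $$ (5, 7) + s (7, 8) * v $$ (6, 8))"
proof -
  note ph = phi_simps[OF \<phi>]
  have V: "v \<in> V_group 13 D13" using V_group_coord[OF v(1)] v(2) by simp
  have val: "\<psi> (a, b) v = \<phi> (v $$ (a - 1, b) * s (a, b))" if ab: "(a, b) \<in> D13" for a b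
  proof -
    have "v \<in> V_root 13 (a, b)" using V ab by (auto simp: V_group_def)
    thus ?thesis unfolding \<psi>[OF ab] by (rule lambda_root_value[OF \<phi> D13_pos[OF ab]])
  qed
  have "lambda_D 13 D13 \<psi> v = (\<Prod>\<alpha>\<in>D13. \<phi> (v $$ (fst \<alpha> - 1, snd \<alpha>) * s \<alpha>))"
    using V val by (auto simp: lambda_D_def intro!: prod.cong)
  also have "\<dots> = \<phi> (v $$ (0, 4) * s (1, 4)) * \<phi> (v $$ (1, 5) * s (2, 5)) * \<phi> (v $$ (4, 6) * s (5, 6)) *
      \<phi> (v $$ (5, 7) * s (6, 7)) * \<phi> (v $$ (6, 8) * s (7, 8))"
    by (simp add: D13_def pattern_Gam_zero[OF v(1)] ph(3))
  finally show ?thesis by (simp add: ph(1) mult.commute)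
qed

theorem proposition4p4:
  fixes \<phi> :: "'a::{field,finite} \<Rightarrow> complex"
    and \<psi> :: "root \<Rightarrow> 'a mat \<Rightarrow> complex"
    and q :: nat
    and D :: "root set"
  assumes q: "q = card (UNIV :: 'a set)"
    and phi: "linear_character (add_monoid class_ring) \<phi>"
    and phi_nontrivial: "\<exists>c. \<phi> c \<noteq> 1"
    and D: "D = {(1,4), (2,5), (3,9), (4,10), (5,6), (6,7), (7,8), (8,11), (9,12)}"
    and psi: "\<psi> \<in> E_set 13 \<phi> D"
  shows "basic_set 13 D \<and>
    (\<exists>A B C.
      A \<subseteq> irr_characters (R_quot 13 D) \<and>
      B \<subseteq> irr_characters (R_quot 13 D) \<and>
      C \<subseteq> irr_characters (R_quot 13 D) \<and>
      card A = q ^ 3 * (2 * q - 1) \<and>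
      card B = q * (q - 1) * (3 * q ^ 3 + q ^ 2 + q - 1) \<and>
      card C = q ^ 2 * (q + 2) * (q - 1) ^ 2 \<and>
      (\<forall>\<chi>\<in>A. \<chi> \<one>\<^bsub>R_quot 13 D\<^esub> = of_nat (q ^ 3)) \<and>
      (\<forall>\<chi>\<in>B. \<chi> \<one>\<^bsub>R_quot 13 D\<^esub> = of_nat (q ^ 4)) \<and>
      (\<forall>\<chi>\<in>C. \<chi> \<one>\<^bsub>R_quot 13 D\<^esub> = of_nat (q ^ 5)) \<and>
      (\<forall>g\<in>carrier (R_quot 13 D).
         induced_character (R_quot 13 D) (V_quot 13 D) (mu_char 13 D \<psi>) g =
           of_nat (q ^ 3) * (\<Sum>\<chi>\<in>A. \<chi> g) +
           of_nat (q ^ 4) * (\<Sum>\<chi>\<in>B. \<chi> g) +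
           of_nat (q ^ 5) * (\<Sum>\<chi>\<in>C. \<chi> g)))"
proof (rule conjI, goal_cases)
  case 1
  show ?case
    unfolding basic_set_def D by (simp add: pos_roots_def root_row_def root_col_def)
next
  case 2
  have DD: "D = D13" unfolding D D13_def ..
  let ?Q = "R_quot 13 D13 :: 'a mat set monoid"
  have "\<forall>\<alpha>\<in>D13. \<exists>s. \<psi> \<alpha> = lambda_root 13 \<phi> \<alpha> s \<and> s \<noteq> 0"
    using psi unfolding E_set_def DD by (auto simp: PiE_iff)
  then obtain s where s: "\<And>\<alpha>. \<alpha> \<in> D13 \<Longrightarrow> \<psi> \<alpha> = lambda_root 13 \<phi> \<alpha> (s \<alpha>)" "\<And>\<alpha>. \<alpha> \<in> D13 \<Longrightarrow> s \<alpha> \<noteq> 0"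
    by metis
  interpret W: sized_weighted_model \<phi> "s (1, 4)" "s (2, 5)" "s (5, 6)" "s (6, 7)" "s (7, 8)" q
    by unfold_locales (use phi_simps[OF phi] phi_nontrivial s(2) q in \<open>auto simp: D13_def\<close>)
  have bij: "bij_betw quot_coord (carrier ?Q) (carrier model)" and hom: "quot_coord \<in> hom ?Q model"
    using quot_coord_iso by (auto simp: Group.iso_def)
  have mu: "mu_char 13 D13 \<psi> X = W.mu (quot_coord X)" if X: "X \<in> V_quot 13 D13" for X
  proof -
    obtain a where a: "a \<in> pattern 13 Gam" "coord a \<in> model_V" "X = coset a" using X by (auto simp: V_quot_eq)
    have "the_elem (lambda_D 13 D13 \<psi> ` coset a) = W.mu (coord a)"
    proof (rule the_elem_const[OF coset_nonempty[OF a(1)]])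
      fix v assume v: "v \<in> coset a"
      have c: "v \<in> pattern 13 Gam" "coord v = coord a" using coset_coord[OF a(1) v] by auto
      have "W.mu (coord a) = \<phi> (W.central_form (snd (coord v)))"
        unfolding W.mu_def using a(2) c by simp
      also have "\<dots> = lambda_D 13 D13 \<psi> v"
      proof -
        have cV: "coord v \<in> model_V" using a(2) c(2) by simp
        have "lambda_D 13 D13 \<psi> v = \<phi> (s (1, 4) * v $$ (0, 4) + s (2, 5) * v $$ (1, 5) + s (5, 6) * v $$ (4, 6) +
            s (6, 7) * v $$ (5, 7) + s (7, 8) * v $$ (6, 8))"
          by (rule lambda_D_value[OF phi _ c(1) cV]) (rule s(1))
        thus ?thesis unfolding W.central_form_def by (simp add: coord_def)
      qed
      finally show "lambda_D 13 D13 \<psi> v = W.mu (coord a)" by simp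
    qed
    thus ?thesis using X a by (simp add: mu_char_def quot_coord_coset)
  qed
  have VQ: "V_quot 13 D13 \<subseteq> carrier ?Q" by (auto simp: V_quot_eq carrier_R_quot)
  \<comment> \<open>Inflation of class functions of the model to the quotient group.\<close>
  define pull where "pull = (\<lambda>\<chi> :: 'a gen \<times> 'a cen \<Rightarrow> complex. \<lambda>X\<in>carrier ?Q. \<chi> (quot_coord X))"
  have pirr: "pull ` A \<subseteq> irr_characters ?Q" if "A \<subseteq> irr_characters model" for A
    using irr_characters_pullback[OF R_quot_group model_group quot_coord_iso] that by (auto simp: pull_def)
  have pinj: "inj_on pull A" if "A \<subseteq> irr_characters model" for A
    unfolding pull_def using pullback_inj[OF bij] that by (rule inj_on_subset)
  have one: "\<one>\<^bsub>?Q\<^esub> \<in> carrier ?Q" "quot_coord \<one>\<^bsub>?Q\<^esub> = \<one>\<^bsub>model\<^esub>"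
    using monoid.one_closed[OF group.is_monoid[OF R_quot_group]] hom_one[OF hom R_quot_group model_group] by auto
  have pdeg: "\<forall>\<chi>\<in>pull ` A. \<chi> \<one>\<^bsub>?Q\<^esub> = c" if "\<forall>\<chi>\<in>A. \<chi> \<one>\<^bsub>model\<^esub> = c" for A c
    using that one by (simp add: pull_def)
  have psum: "(\<Sum>\<chi>\<in>pull ` A. \<chi> X) = (\<Sum>\<chi>\<in>A. \<chi> (quot_coord X))"
    if "A \<subseteq> irr_characters model" "X \<in> carrier ?Q" for A X
    using sum.reindex[OF pinj[OF that(1)], of "\<lambda>\<chi>. \<chi> X"] that(2) by (simp add: pull_def)
  obtain A B C where ABC: "A \<subseteq> irr_characters model" "B \<subseteq> irr_characters model" "C \<subseteq> irr_characters model"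
    "card A = q ^ 3 * (2 * q - 1)" "card B = q * (q - 1) * (3 * q ^ 3 + q ^ 2 + q - 1)"
    "card C = q ^ 2 * (q + 2) * (q - 1) ^ 2"
    "\<forall>\<chi>\<in>A. \<chi> \<one>\<^bsub>model\<^esub> = of_nat (q ^ 3)" "\<forall>\<chi>\<in>B. \<chi> \<one>\<^bsub>model\<^esub> = of_nat (q ^ 4)" "\<forall>\<chi>\<in>C. \<chi> \<one>\<^bsub>model\<^esub> = of_nat (q ^ 5)"
    "\<forall>g\<in>carrier model. induced_character model model_V W.mu g =
        of_nat (q ^ 3) * (\<Sum>\<chi>\<in>A. \<chi> g) + of_nat (q ^ 4) * (\<Sum>\<chi>\<in>B. \<chi> g) + of_nat (q ^ 5) * (\<Sum>\<chi>\<in>C. \<chi> g)"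
    using W.model_decomposition by (elim exE conjE)
  have ind: "induced_character ?Q (V_quot 13 D13) (mu_char 13 D13 \<psi>) X =
      of_nat (q ^ 3) * (\<Sum>\<chi>\<in>pull ` A. \<chi> X) + of_nat (q ^ 4) * (\<Sum>\<chi>\<in>pull ` B. \<chi> X) +
      of_nat (q ^ 5) * (\<Sum>\<chi>\<in>pull ` C. \<chi> X)" if X: "X \<in> carrier ?Q" for X
  proof -
    have "induced_character ?Q (V_quot 13 D13) (mu_char 13 D13 \<psi>) X =
        induced_character model model_V W.mu (quot_coord X)"
      unfolding quot_coord_V_quot[symmetric]
      by (rule induced_character_pullback[OF R_quot_group model_group quot_coord_iso VQ _ X]) (rule mu)
    also have "\<dots> = of_nat (q ^ 3) * (\<Sum>\<chi>\<in>A. \<chi> (quot_coord X)) + of_nat (q ^ 4) * (\<Sum>\<chi>\<in>B. \<chi> (quot_coord X)) +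
        of_nat (q ^ 5) * (\<Sum>\<chi>\<in>C. \<chi> (quot_coord X))"
      by (rule bspec[OF ABC(10)]) simp
    finally show ?thesis unfolding psum[OF ABC(1) X] psum[OF ABC(2) X] psum[OF ABC(3) X] .
  qed
  show ?case
    unfolding DD
  proof (rule exI[of _ "pull ` A"], rule exI[of _ "pull ` B"], rule exI[of _ "pull ` C"],
      intro conjI ballI[where A = "carrier ?Q"])
    show "card (pull ` A) = q ^ 3 * (2 * q - 1)" using card_image[OF pinj[OF ABC(1)]] ABC(4) by simp
    show "card (pull ` B) = q * (q - 1) * (3 * q ^ 3 + q ^ 2 + q - 1)"
      using card_image[OF pinj[OF ABC(2)]] ABC(5) by simp
    show "card (pull ` C) = q ^ 2 * (q + 2) * (q - 1) ^ 2" using card_image[OF pinj[OF ABC(3)]] ABC(6) by simp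
  qed (rule pirr[OF ABC(1)] pirr[OF ABC(2)] pirr[OF ABC(3)] pdeg[OF ABC(7)] pdeg[OF ABC(8)] pdeg[OF ABC(9)] ind, assumption?)+
qed

end
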